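(* For any tree poset $T$, $\mathrm{ar}^*(n,T)=(1+o(1))\,\mathrm{La}^*(n,\mathcal{P}^-(T))$ as $n\to\infty$.
   Context: $[n]=\{1,\dots,n\}$, $2^{[n]}$ its power set. A family $\mathcal{G}$ of sets is a strong copy of a poset $(P,\leqslant)$ if there is a bijection $f:P\to\mathcal{G}$ with $p\leqslant q\iff f(p)\subseteq f(q)$. $\mathrm{ar}^*(n,P)$ is the maximum number of colors used in a coloring of $2^{[n]}$ that admits no strong copy of $P$ whose sets all receive distinct colors. For a set $\mathcal{P}$ of posets, $\mathrm{La}^*(n,\mathcal{P})$ is the maximum size of a family $\mathcal{F}\subseteq 2^{[n]}$ containing no strong copy of any member of $\mathcal{P}$. $\mathcal{P}^-(T)=\{T\setminus\{m\}: m \text{ maximal or minimal in } T\}$ with induced orders. The Hasse diagram of a poset is the graph on its elements where $p,q$ are adjacent if one covers the other ($p<q$ with no $z$ strictly between); $T$ is a tree poset if its Hasse diagram is a tree.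
   Formalization: Four tree posets are excluded: the one-element poset (both maxima undefined), the 2-chain (ar*=1, La*=0), and the 3-element V and its dual (La*=1 but ar* is at least 3), where the claim fails; tree posets are taken to be finite. *)

theory Defs
  imports Complex_Main "HOL-Library.Landau_Symbols"
begin

text \<open>
  A poset is a reflexive, antisymmetric and transitive relation \<open>r\<close>
  (\<open>Partial_order r\<close>); by reflexivity its ground set is \<open>Field r\<close>.
  In a poset, \<open>(p, q) \<in> r\<close> means \<open>p \<le> q\<close>.
\<close>

definition strong_copy :: "'a rel \<Rightarrow> 'b set set \<Rightarrow> bool" where
  "strong_copy r G \<longleftrightarrow>
     (\<exists>f. bij_betw f (Field r) G \<and>
          (\<forall>p\<in>Field r. \<forall>q\<in>Field r. (p, q) \<in> r \<longleftrightarrow> f p \<subseteq> f q))"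

definition covers :: "'a rel \<Rightarrow> 'a \<Rightarrow> 'a \<Rightarrow> bool" where
  "covers r q p \<longleftrightarrow> (p, q) \<in> r \<and> p \<noteq> q \<and>
     \<not> (\<exists>z. (p, z) \<in> r \<and> p \<noteq> z \<and> (z, q) \<in> r \<and> z \<noteq> q)"

definition hasse_edges :: "'a rel \<Rightarrow> 'a rel" where
  "hasse_edges r = {(p, q). covers r q p \<or> covers r p q}"

text \<open>
  Simple graphs are given by a vertex set and a symmetric, irreflexive edge relation.  A cycle
  is a list of at least three distinct vertices, cyclically consecutive ones being adjacent.
\<close>

definition graph_cycle :: "'a set \<Rightarrow> 'a rel \<Rightarrow> 'a list \<Rightarrow> bool" where
  "graph_cycle V E vs \<longleftrightarrow> 3 \<le> length vs \<and> distinct vs \<and> set vs \<subseteq> V \<and>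
     (\<forall>i<length vs. (vs ! i, vs ! (Suc i mod length vs)) \<in> E)"

definition tree_graph :: "'a set \<Rightarrow> 'a rel \<Rightarrow> bool" where
  "tree_graph V E \<longleftrightarrow> V \<noteq> {} \<and> (\<forall>u\<in>V. \<forall>v\<in>V. (u, v) \<in> E\<^sup>*) \<and> \<not> (\<exists>vs. graph_cycle V E vs)"

definition tree_poset :: "'a rel \<Rightarrow> bool" where
  "tree_poset r \<longleftrightarrow> Partial_order r \<and> finite (Field r) \<and> tree_graph (Field r) (hasse_edges r)"

definition maximal_in :: "'a rel \<Rightarrow> 'a \<Rightarrow> bool" where
  "maximal_in r m \<longleftrightarrow> m \<in> Field r \<and> (\<forall>q. (m, q) \<in> r \<longrightarrow> q = m)"

definition minimal_in :: "'a rel \<Rightarrow> 'a \<Rightarrow> bool" where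
  "minimal_in r m \<longleftrightarrow> m \<in> Field r \<and> (\<forall>q. (q, m) \<in> r \<longrightarrow> q = m)"

definition Pminus :: "'a rel \<Rightarrow> 'a rel set" where
  "Pminus r = {Restr r (Field r - {m}) | m. maximal_in r m \<or> minimal_in r m}"

text \<open>
  The maxima below are over finite sets of natural numbers.  If no colouring (or no family) is
  admissible, they are \<open>Max {}\<close> and carry no meaning; this happens for \<open>ar_star\<close> only
  when the poset has at most one element, and for \<open>La_star\<close> only when one of the
  forbidden posets is empty.
\<close>

definition ar_star :: "nat \<Rightarrow> 'a rel \<Rightarrow> nat" where
  "ar_star n r = Max {card (c ` Pow {1..n}) | c :: nat set \<Rightarrow> nat.
     \<not> (\<exists>G\<subseteq>Pow {1..n}. strong_copy r G \<and> inj_on c G)}"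

definition La_star :: "nat \<Rightarrow> 'a rel set \<Rightarrow> nat" where
  "La_star n R = Max {card F | F :: nat set set.
     F \<subseteq> Pow {1..n} \<and> \<not> (\<exists>r\<in>R. \<exists>G\<subseteq>F. strong_copy r G)}"

end

theory Submission
  imports Defs "HOL-Combinatorics.Permutations"
begin

text \<open>
  Let \<open>k + 1\<close> be the least height of a member of \<open>Pminus T\<close>, attained by deleting \<open>m\<close>, which may be
  taken maximal by passing to complements.  If \<open>k \<ge> 1\<close>, both quantities are asymptotically \<open>k\<close>
  times the central binomial coefficient: \<open>k\<close> middle levels give the lower bounds, because a rainbow
  copy has at most one element outside these levels and that element is extremal.  For the upper
  bounds, take a family \<open>F\<close> in the middle levels of size \<open>k + \<epsilon>\<close> central binomials.  A random
  maximal chain meets \<open>F\<close> more than \<open>k\<close> times on average, so there are many windows of \<open>k + 1\<close>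
  consecutive members of \<open>F\<close> on chains.  After discarding few windows, every surviving member in
  position \<open>i\<close> has, for each bounded collection of sets to avoid, a surviving neighbour in position
  \<open>j\<close> without accidental inclusions.  Choose a set \<open>M\<close> slightly above the middle levels with many
  surviving windows below it; sending \<open>m\<close> to \<open>M\<close>, the rest of \<open>T\<close> embeds greedily into \<open>F\<close> along the
  Hasse tree, while also avoiding the one member of \<open>F\<close> that shares the colour of \<open>M\<close>.
  If \<open>k = 0\<close>, then \<open>T\<close> is a star with \<open>s \<ge> 3\<close> leaves and both quantities are asymptotically
  \<open>(s - 1) n\<close>.
\<close>

section \<open>Counting maximal chains\<close>

text \<open>A strong copy must exclude every inclusion that \<open>T\<close> does not prescribe. The
  tree makes this local: a vertex joined to the embedded part by one Hasse edge is comparable to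
  that part only through its neighbour there. Greedy growth then needs members of \<open>F\<close>
  that can be continued from any position to any other, hence the cleaning of windows to a set
  closed under such moves. The middle band has linear width, half-width \<open>d = n div s\<close>
  for a constant \<open>s\<close>. A chain through a band member meets one of \<open>t\<close> given
  sets wrongly with probability of order t(L - l)/q, which is a constant 6t/c with \<open>c\<close>
  at our disposal, while the sets outside the band are exponentially few compared with the central
  binomial coefficient. Neighbours of \<open>m\<close> must go below \<open>M\<close> and be
  incomparable to everything else placed; failing this is exponentially rare, because
  \<open>M\<close> lies a linear number of levels above the band. The order of choices matters: the
  member \<open>Y\<close> with the colour of \<open>M\<close> is known only after \<open>M\<close>,
  so one \<open>M\<close> has to serve every \<open>Y\<close>. As \<open>M\<close> need not belong
  to \<open>F\<close>, only the height of \<open>T\<close> without \<open>m\<close> counts.\<close>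

definition chain :: "(nat \<Rightarrow> nat) \<Rightarrow> nat \<Rightarrow> nat set" where
  "chain p j = p ` {1..j}"

text \<open>A maximal chain is encoded by the order in which elements are added, so random chains
  become counts of permutations.\<close>

definition perms :: "nat \<Rightarrow> (nat \<Rightarrow> nat) set" where
  "perms n = {p. p permutes {1..n}}"

definition through :: "nat \<Rightarrow> nat set \<Rightarrow> (nat \<Rightarrow> nat) set" where
  "through n A = {p \<in> perms n. chain p (card A) = A}"

lemma finite_perms [simp]: "finite (perms n)"
  unfolding perms_def by (rule finite_permutations) simp

lemma card_perms: "card (perms n) = fact n"
  unfolding perms_def using card_permutations[of "{1..n}" n] by simp

lemma finite_through [simp]: "finite (through n A)"
  unfolding through_def by simp

lemma chain_subset: "p \<in> perms n \<Longrightarrow> j \<le> n \<Longrightarrow> chain p j \<subseteq> {1..n}"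
  unfolding perms_def chain_def using permutes_image[of p "{1..n}"] image_mono[of "{1..j}" "{1..n}" p] by simp

lemma card_chain: "p \<in> perms n \<Longrightarrow> card (chain p j) = j"
  unfolding perms_def chain_def
  by (subst card_image) (simp_all add: permutes_inj_on)

lemma finite_chain [simp]: "finite (chain p j)"
  unfolding chain_def by simp

lemma chain_full: "p \<in> perms n \<Longrightarrow> chain p n = {1..n}"
  unfolding perms_def chain_def by (simp add: permutes_image)

lemma chain_mono: "i \<le> j \<Longrightarrow> chain p i \<subseteq> chain p j"
  unfolding chain_def by auto

lemma chain_compose: "chain (\<sigma> \<circ> p) j = \<sigma> ` chain p j"
  unfolding chain_def by (simp add: image_comp)

lemma perms_compose: "\<sigma> permutes {1..n} \<Longrightarrow> p \<in> perms n \<Longrightarrow> \<sigma> \<circ> p \<in> perms n"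
  unfolding perms_def by (simp add: permutes_compose)

text \<open>Relabelling the ground set injects one class of chains into another. Applied in both
  directions it yields the uniformity statements below: sets or elements in one orbit occur on
  equally many chains.\<close>

lemma card_perms_shift_le:
  assumes s: "\<sigma> permutes {1..n}" and imp: "\<And>p. p \<in> perms n \<Longrightarrow> P p \<Longrightarrow> Q (\<sigma> \<circ> p)"
  shows "card {p \<in> perms n. P p} \<le> card {p \<in> perms n. Q p}"
proof (rule card_inj_on_le[where f = "\<lambda>p. \<sigma> \<circ> p"])
  show "inj_on ((\<circ>) \<sigma>) {p \<in> perms n. P p}"
    using permutes_inj[OF s] by (auto simp: inj_on_def fun_eq_iff dest: injD)
  show "(\<circ>) \<sigma> ` {p \<in> perms n. P p} \<subseteq> {p \<in> perms n. Q p}"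
    using imp perms_compose[OF s] by auto
qed simp

lemma ex_permutes_image:
  assumes "finite M" "Y \<subseteq> M" "Y' \<subseteq> M" "card Y = card Y'"
  shows "\<exists>\<sigma>. \<sigma> permutes M \<and> \<sigma> ` Y = Y'"
proof -
  have fin: "finite Y" "finite Y'" using assms finite_subset by auto
  obtain g where g: "bij_betw g Y Y'"
    using assms fin finite_same_card_bij by blast
  have "card (M - Y) = card (M - Y')"
    using assms fin by (simp add: card_Diff_subset)
  then obtain h where h: "bij_betw h (M - Y) (M - Y')"
    using assms finite_same_card_bij by blast
  define \<sigma> where "\<sigma> x = (if x \<in> Y then g x else if x \<in> M then h x else x)" for x
  have 1: "bij_betw \<sigma> Y Y'"
    using g by (rule bij_betw_cong[THEN iffD1, rotated]) (simp add: \<sigma>_def)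
  have 2: "bij_betw \<sigma> (M - Y) (M - Y')"
    using h by (rule bij_betw_cong[THEN iffD1, rotated]) (simp add: \<sigma>_def)
  have "bij_betw \<sigma> (Y \<union> (M - Y)) (Y' \<union> (M - Y'))"
    by (rule bij_betw_combine[OF 1 2]) auto
  moreover have "Y \<union> (M - Y) = M" "Y' \<union> (M - Y') = M" using assms by auto
  ultimately have "bij_betw \<sigma> M M" by simp
  then have "\<sigma> permutes M"
    by (rule bij_imp_permutes) (use assms(2) in \<open>auto simp: \<sigma>_def\<close>)
  with 1 show ?thesis by (auto simp: bij_betw_def)
qed

lemma card_filter: "finite A \<Longrightarrow> card {x \<in> A. P x} = (\<Sum>x\<in>A. if P x then 1 else 0)"
  by (subst card_eq_sum, subst sum.inter_filter) auto

lemma sum_card_fibres: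
  assumes "finite P" "finite B" "\<And>p. p \<in> P \<Longrightarrow> f p \<in> B"
  shows "(\<Sum>y\<in>B. card {p \<in> P. f p = y}) = card P"
proof -
  have "card P = card (\<Union>y\<in>B. {p \<in> P. f p = y})"
    using assms(3) by (intro arg_cong[where f = card]) auto
  also have "\<dots> = (\<Sum>y\<in>B. card {p \<in> P. f p = y})"
    by (rule card_UN_disjoint) (use assms in auto)
  finally show ?thesis by simp
qed

text \<open>Permutations of \<open>M\<close> act transitively on its subsets of a given size, so the
  chains through \<open>M\<close> are shared equally among them. The quotient is written as a
  product to stay in the naturals.\<close>

lemma card_through_pair:
  assumes M: "M \<subseteq> {1..n}" and Y: "Y \<subseteq> M" 
  shows "card {p \<in> through n M. chain p (card Y) = Y} * (card M choose card Y) = card (through n M)"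
proof -
  let ?l = "card Y"
  let ?N = "\<lambda>Y. card {p \<in> through n M. chain p ?l = Y}"
  have fM: "finite M" using M finite_subset by blast
  have lM: "?l \<le> card M" using Y fM by (simp add: card_mono)
  have le: "?N Y1 \<le> ?N Y2" if "Y1 \<subseteq> M" "Y2 \<subseteq> M" "card Y1 = ?l" "card Y2 = ?l" for Y1 Y2
  proof -
    have "card Y1 = card Y2" using that by simp
    from ex_permutes_image[OF fM that(1,2) this]
    obtain \<sigma> where s: "\<sigma> permutes M" "\<sigma> ` Y1 = Y2" by blast
    have s': "\<sigma> permutes {1..n}" using s(1) M by (rule permutes_subset)
    have "card {p \<in> perms n. chain p (card M) = M \<and> chain p ?l = Y1}
       \<le> card {p \<in> perms n. chain p (card M) = M \<and> chain p ?l = Y2}"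
      by (rule card_perms_shift_le[OF s']) (simp add: chain_compose s(2) permutes_image[OF s(1)])
    then show ?thesis by (simp add: through_def conj_assoc)
  qed
  have "chain p ?l \<in> {Z. Z \<subseteq> M \<and> card Z = ?l}" if "p \<in> through n M" for p
    using that chain_mono[OF lM, of p] card_chain[of p n ?l] by (simp add: through_def)
  then have "card (through n M) = (\<Sum>Z\<in>{Z. Z \<subseteq> M \<and> card Z = ?l}. ?N Z)"
    using fM by (intro sum_card_fibres[symmetric]) simp_all
  also have "\<dots> = (\<Sum>Z\<in>{Z. Z \<subseteq> M \<and> card Z = ?l}. ?N Y)"
    by (intro sum.cong refl antisym le) (simp_all add: Y)
  also have "\<dots> = ?N Y * (card M choose ?l)"
    using n_subsets[OF fM, of ?l] by simp
  finally show ?thesis by simp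
qed

lemma through_full: "through n {1..n} = perms n"
  unfolding through_def by (auto simp: chain_full)

lemma card_through:
  assumes "A \<subseteq> {1..n}"
  shows "card (through n A) * (n choose card A) = fact n"
proof -
  have "{p \<in> perms n. chain p (card A) = A} = through n A" by (simp add: through_def)
  then show ?thesis
    using card_through_pair[OF subset_refl assms] by (simp only: through_full card_perms card_atLeastAtMost) simp
qed

text \<open>Transposing two elements outside \<open>A\<close> fixes \<open>A\<close>, so all
  \<open>n - card A\<close> of them are acquired by level \<open>u\<close> equally often, and each
  chain acquires exactly \<open>u - card A\<close>. Double counting gives the proportion (u -
  |A|)/(n - |A|).\<close>

lemma card_through_up:
  assumes A: "A \<subseteq> {1..n}" and x: "x \<in> {1..n} - A" and u: "card A \<le> u" "u \<le> n"
  shows "card {p \<in> through n A. x \<in> chain p u} * (n - card A) = card (through n A) * (u - card A)"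
proof -
  let ?B = "{1..n} - A"
  let ?g = "\<lambda>y. card {p \<in> through n A. y \<in> chain p u}"
  have fA: "finite A" using A finite_subset by blast
  have le: "?g y \<le> ?g z" if "y \<in> ?B" "z \<in> ?B" for y z
  proof -
    have s: "transpose y z permutes {1..n}" using that by (intro permutes_swap_id) auto
    have "transpose y z ` A = A"
      using that by (auto simp: transpose_def image_iff)
    then have "card {p \<in> perms n. chain p (card A) = A \<and> y \<in> chain p u}
       \<le> card {p \<in> perms n. chain p (card A) = A \<and> z \<in> chain p u}"
      by (intro card_perms_shift_le[OF s]) (auto simp: chain_compose image_iff intro: bexI[of _ y])
    then show ?thesis by (simp add: through_def conj_assoc)
  qed
  have "(\<Sum>y\<in>?B. ?g y) = (\<Sum>y\<in>?B. \<Sum>p\<in>through n A. if y \<in> chain p u then 1 else 0)"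
    by (rule sum.cong[OF refl]) (subst card_eq_sum, subst sum.inter_filter[symmetric], auto)
  also have "\<dots> = (\<Sum>p\<in>through n A. \<Sum>y\<in>?B. if y \<in> chain p u then 1 else 0)"
    by (rule sum.swap)
  also have "\<dots> = (\<Sum>p\<in>through n A. u - card A)"
  proof (rule sum.cong[OF refl])
    fix p assume p: "p \<in> through n A"
    then have pp: "p \<in> perms n" and AA: "chain p (card A) = A" by (auto simp: through_def)
    have "(\<Sum>y\<in>?B. if y \<in> chain p u then 1 else 0) = card {y \<in> ?B. y \<in> chain p u}"
      by (subst card_eq_sum, subst sum.inter_filter) auto
    also have "{y \<in> ?B. y \<in> chain p u} = chain p u - A"
      using chain_subset[OF pp u(2)] by auto
    also have "card \<dots> = u - card A"
      using chain_mono[OF u(1), of p] AA fA card_chain[OF pp] by (simp add: card_Diff_subset)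
    finally show "(\<Sum>y\<in>?B. if y \<in> chain p u then 1 else 0) = u - card A" .
  qed
  finally have "(\<Sum>y\<in>?B. ?g y) = card (through n A) * (u - card A)" by simp
  moreover have "(\<Sum>y\<in>?B. ?g y) = (\<Sum>y\<in>?B. ?g x)"
    by (intro sum.cong refl antisym le) (use x in auto)
  moreover have "card ?B = n - card A" using A fA by (simp add: card_Diff_subset)
  ultimately show ?thesis by (simp add: mult.commute)
qed

text \<open>Dual count: by transposition the elements of \<open>A\<close> are equally often missing
  at level \<open>l\<close>, and exactly \<open>card A - l\<close> of them are missing.\<close>

lemma card_through_down:
  assumes A: "A \<subseteq> {1..n}" and x: "x \<in> A" and l: "l \<le> card A"
  shows "card {p \<in> through n A. x \<notin> chain p l} * card A = card (through n A) * (card A - l)"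
proof -
  let ?g = "\<lambda>y. card {p \<in> through n A. y \<notin> chain p l}"
  have fA: "finite A" using A finite_subset by blast
  have le: "?g y \<le> ?g z" if "y \<in> A" "z \<in> A" for y z
  proof -
    have s: "transpose y z permutes {1..n}" using that A by (intro permutes_swap_id) auto
    have "transpose y z ` A = A"
      using that by (auto simp: transpose_def image_iff)
    moreover have "z \<notin> transpose y z ` C" if "y \<notin> C" for C
      using that by (auto simp: transpose_def image_iff split: if_splits)
    ultimately have "card {p \<in> perms n. chain p (card A) = A \<and> y \<notin> chain p l}
       \<le> card {p \<in> perms n. chain p (card A) = A \<and> z \<notin> chain p l}"
      by (intro card_perms_shift_le[OF s]) (auto simp: chain_compose)
    then show ?thesis by (simp add: through_def conj_assoc)
  qed
  have "(\<Sum>y\<in>A. ?g y) = (\<Sum>y\<in>A. \<Sum>p\<in>through n A. if y \<notin> chain p l then 1 else 0)"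
    by (rule sum.cong[OF refl]) (subst card_eq_sum, subst sum.inter_filter[symmetric], auto)
  also have "\<dots> = (\<Sum>p\<in>through n A. \<Sum>y\<in>A. if y \<notin> chain p l then 1 else 0)"
    by (rule sum.swap)
  also have "\<dots> = (\<Sum>p\<in>through n A. card A - l)"
  proof (rule sum.cong[OF refl])
    fix p assume p: "p \<in> through n A"
    then have pp: "p \<in> perms n" and AA: "chain p (card A) = A" by (auto simp: through_def)
    have "(\<Sum>y\<in>A. if y \<notin> chain p l then 1 else 0) = card {y \<in> A. y \<notin> chain p l}"
      using fA by (subst card_eq_sum, subst sum.inter_filter) auto
    also have "{y \<in> A. y \<notin> chain p l} = A - chain p l" by auto
    also have "card \<dots> = card A - l"
      using chain_mono[OF l, of p] AA card_chain[OF pp] by (simp add: card_Diff_subset)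
    finally show "(\<Sum>y\<in>A. if y \<notin> chain p l then 1 else 0) = card A - l" .
  qed
  finally have "(\<Sum>y\<in>A. ?g y) = card (through n A) * (card A - l)" by simp
  moreover have "(\<Sum>y\<in>A. ?g y) = (\<Sum>y\<in>A. ?g x)"
    by (intro sum.cong refl antisym le) (use x in auto)
  ultimately show ?thesis by (simp add: mult.commute)
qed

text \<open>The quotient of the two binomial coefficients is a product of factors (u - i)/(v - i),
  each at most u/v.\<close>

lemma binomial_ratio_le:
  assumes "u \<le> v" "z \<le> u"
  shows "(u choose z) * v ^ z \<le> (v choose z) * u ^ z"
  using assms(2)
proof (induction z)
  case (Suc z)
  have eq: "(w choose Suc z) * Suc z = (w choose z) * (w - z)" if "z \<le> w" for w
    using that by (metis binomial_absorb_comp binomial_absorption mult.commute)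
  have "(u - z) * v \<le> (v - z) * u"
    using assms(1) by (simp add: algebra_simps diff_mult_distrib diff_mult_distrib2 diff_le_mono2)
  then have "((u choose z) * v ^ z) * ((u - z) * v) \<le> ((v choose z) * u ^ z) * ((v - z) * u)"
    by (rule mult_le_mono[rotated]) (use Suc in auto)
  also have "((u choose z) * v ^ z) * ((u - z) * v) = ((u choose z) * (u - z)) * v ^ Suc z"
    by (simp add: ac_simps)
  also have "\<dots> = Suc z * ((u choose Suc z) * v ^ Suc z)"
    using eq[of u] Suc.prems by (metis Suc_leD mult.assoc mult.commute)
  also have "((v choose z) * u ^ z) * ((v - z) * u) = ((v choose z) * (v - z)) * u ^ Suc z"
    by (simp add: ac_simps)
  also have "\<dots> = Suc z * ((v choose Suc z) * u ^ Suc z)"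
    using eq[of v] Suc.prems assms(1) by (metis Suc_leD le_trans mult.assoc mult.commute)
  finally show ?case by (metis mult_le_cancel1 zero_less_Suc)
qed simp

lemma card_supersets:
  assumes "finite M" "Z \<subseteq> M"
  shows "card {Y. Z \<subseteq> Y \<and> Y \<subseteq> M \<and> card Y = u} \<le> (card M - card Z) choose (u - card Z)"
proof -
  have fin: "finite Z" "finite (M - Z)" using assms finite_subset by auto
  have "card {Y. Z \<subseteq> Y \<and> Y \<subseteq> M \<and> card Y = u} \<le> card {Y. Y \<subseteq> M - Z \<and> card Y = u - card Z}"
  proof (rule card_inj_on_le[where f = "\<lambda>Y. Y - Z"])
    show "inj_on (\<lambda>Y. Y - Z) {Y. Z \<subseteq> Y \<and> Y \<subseteq> M \<and> card Y = u}"
      by (rule inj_onI) blast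
    show "(\<lambda>Y. Y - Z) ` {Y. Z \<subseteq> Y \<and> Y \<subseteq> M \<and> card Y = u} \<subseteq> {Y. Y \<subseteq> M - Z \<and> card Y = u - card Z}"
      using fin by (auto simp: card_Diff_subset)
    show "finite {Y. Y \<subseteq> M - Z \<and> card Y = u - card Z}"
      using fin by simp
  qed
  also have "\<dots> = (card M - card Z) choose (u - card Z)"
    using n_subsets[OF fin(2)] assms fin by (simp add: card_Diff_subset)
  finally show ?thesis .
qed

text \<open>\<open>chain p l\<close> is a uniform \<open>l\<close>-subset of \<open>M\<close>, and
  at most \<open>u choose l\<close> of these lie in \<open>Z\<close>. The proportion is thus at most
  (u/|M|)^l, exponentially small in \<open>l\<close>.\<close>

lemma card_through_inside:
  assumes M: "M \<subseteq> {1..n}" and l: "l \<le> u" "u \<le> card M" and Z: "card Z \<le> u" "finite Z"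
  shows "card {p \<in> through n M. chain p l \<subseteq> Z} * card M ^ l \<le> card (through n M) * u ^ l"
proof -
  have fM: "finite M" using M finite_subset by blast
  let ?S = "{Y. Y \<subseteq> Z \<inter> M \<and> card Y = l}"
  let ?N = "\<lambda>Y. card {p \<in> through n M. chain p l = Y}"
  have lM: "l \<le> card M" using l by simp
  have "chain p l \<in> ?S" if "p \<in> {p \<in> through n M. chain p l \<subseteq> Z}" for p
    using that chain_mono[OF lM, of p] card_chain[of p n l] by (simp add: through_def)
  then have "card {p \<in> through n M. chain p l \<subseteq> Z} = (\<Sum>Y\<in>?S. card {p \<in> {p \<in> through n M. chain p l \<subseteq> Z}. chain p l = Y})"
    using fM by (intro sum_card_fibres[symmetric]) simp_all
  also have "\<dots> = (\<Sum>Y\<in>?S. ?N Y)"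
    by (intro sum.cong refl arg_cong[where f = card]) auto
  finally have "card {p \<in> through n M. chain p l \<subseteq> Z} * (card M choose l) = (\<Sum>Y\<in>?S. ?N Y * (card M choose l))"
    by (simp add: sum_distrib_right)
  also have "\<dots> = (\<Sum>Y\<in>?S. card (through n M))"
    by (rule sum.cong) (use card_through_pair[OF M] in auto)
  also have "\<dots> = (card (Z \<inter> M) choose l) * card (through n M)"
    using n_subsets[of "Z \<inter> M" l] fM by simp
  also have "\<dots> \<le> (u choose l) * card (through n M)"
    by (intro mult_le_mono binomial_right_mono) 
      (use Z card_mono[of Z "Z \<inter> M"] in auto)
  finally have "(card {p \<in> through n M. chain p l \<subseteq> Z} * card M ^ l) * (card M choose l) 
      \<le> card (through n M) * ((u choose l) * card M ^ l)"
    using mult_right_mono[of _ _ "card M ^ l"] by (simp add: ac_simps)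
  also have "\<dots> \<le> card (through n M) * ((card M choose l) * u ^ l)"
    using binomial_ratio_le[OF l(2,1)] by (rule mult_left_mono) simp
  also have "\<dots> = (card (through n M) * u ^ l) * (card M choose l)" by (simp add: ac_simps)
  finally show ?thesis using lM by (simp only: mult_le_cancel2 zero_less_binomial)
qed

text \<open>With m = |M| and z = |Z|, the proportion is at most (m - z choose u - z)/(m choose u) =
  (u choose z)/(m choose z), and the ratio bound turns this into (u/m)^z.\<close>

lemma card_through_covering:
  assumes M: "M \<subseteq> {1..n}" and u: "card Z \<le> u" "u \<le> card M" and Z: "Z \<subseteq> M"
  shows "card {p \<in> through n M. Z \<subseteq> chain p u} * card M ^ card Z \<le> card (through n M) * u ^ card Z"
proof -
  have fM: "finite M" using M finite_subset by blast
  let ?S = "{Y. Z \<subseteq> Y \<and> Y \<subseteq> M \<and> card Y = u}"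
  let ?N = "\<lambda>Y. card {p \<in> through n M. chain p u = Y}"
  let ?z = "card Z" and ?m = "card M"
  let ?c = "card {p \<in> through n M. Z \<subseteq> chain p u}"
  have "chain p u \<in> ?S" if "p \<in> {p \<in> through n M. Z \<subseteq> chain p u}" for p
    using that chain_mono[OF u(2), of p] card_chain[of p n u] by (simp add: through_def)
  then have "?c = (\<Sum>Y\<in>?S. card {p \<in> {p \<in> through n M. Z \<subseteq> chain p u}. chain p u = Y})"
    using fM by (intro sum_card_fibres[symmetric]) simp_all
  also have "\<dots> = (\<Sum>Y\<in>?S. ?N Y)"
    by (intro sum.cong refl arg_cong[where f = card]) auto
  finally have "?c * (?m choose u) = (\<Sum>Y\<in>?S. ?N Y * (?m choose u))"
    by (simp add: sum_distrib_right)
  also have "\<dots> = (\<Sum>Y\<in>?S. card (through n M))"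
    by (rule sum.cong) (use card_through_pair[OF M] in auto)
  also have "\<dots> \<le> ((?m - ?z) choose (u - ?z)) * card (through n M)"
    using card_supersets[OF fM Z, of u] by simp
  finally have "?c * (?m choose u) * (?m choose ?z) \<le> ((?m - ?z) choose (u - ?z)) * card (through n M) * (?m choose ?z)"
    by (rule mult_right_mono) simp
  also have "\<dots> = card (through n M) * (u choose ?z) * (?m choose u)"
    using choose_mult[OF u] by (simp add: ac_simps)
  finally have "?c * (?m choose ?z) \<le> card (through n M) * (u choose ?z)"
    using u(2) by (simp add: ac_simps)
  then have "?c * (?m choose ?z) * ?m ^ ?z \<le> card (through n M) * ((u choose ?z) * ?m ^ ?z)"
    by (simp add: mult.assoc[symmetric])
  also have "\<dots> \<le> card (through n M) * ((?m choose ?z) * u ^ ?z)"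
    using binomial_ratio_le[OF u(2,1)] by (rule mult_left_mono) simp
  finally have "(?c * ?m ^ ?z) * (?m choose ?z) \<le> (card (through n M) * u ^ ?z) * (?m choose ?z)"
    by (simp add: ac_simps)
  moreover have "?z \<le> ?m" using u by simp
  ultimately show ?thesis by (simp only: mult_le_cancel2 zero_less_binomial)
qed

section \<open>Windows of a family in the middle levels\<close>

text \<open>Discarding the elements of a bad key can make other keys bad, so discarding is iterated.
  A treated key never returns, since \<open>U \<kappa>\<close> no longer meets the survivors; each
  \<open>b \<kappa>\<close> is paid at most once. The loss is bounded for every \<open>W'\<close>
  because badness refers to the current survivors.\<close>

lemma clean_keys:
  fixes b :: "'k \<Rightarrow> real"
  assumes "finite K" "finite W"
    and "\<And>\<kappa> W'. \<kappa> \<in> K \<Longrightarrow> W' \<subseteq> W \<Longrightarrow> bad \<kappa> W' \<Longrightarrow> real (card (U \<kappa> \<inter> W')) \<le> b \<kappa>"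
    and "\<And>\<kappa>. \<kappa> \<in> K \<Longrightarrow> 0 \<le> b \<kappa>"
  shows "\<exists>W'\<subseteq>W. real (card W) \<le> card W' + (\<Sum>\<kappa>\<in>K. b \<kappa>) \<and> (\<forall>\<kappa>\<in>K. U \<kappa> \<inter> W' = {} \<or> \<not> bad \<kappa> W')"
  using assms
proof (induction "card K" arbitrary: K W)
  case 0
  then show ?case by (intro exI[of _ W]) auto
next
  case (Suc m)
  show ?case
  proof (cases "\<exists>\<kappa>\<in>K. bad \<kappa> W")
    case False
    then show ?thesis using Suc.prems by (intro exI[of _ W]) (auto intro: sum_nonneg)
  next
    case True
    then obtain \<kappa> where \<kappa>: "\<kappa> \<in> K" "bad \<kappa> W" by blast
    have "\<exists>W'\<subseteq>W - U \<kappa>. real (card (W - U \<kappa>)) \<le> card W' + (\<Sum>\<kappa>\<in>K - {\<kappa>}. b \<kappa>) \<and>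
        (\<forall>\<kappa>\<in>K - {\<kappa>}. U \<kappa> \<inter> W' = {} \<or> \<not> bad \<kappa> W')"
    proof (rule Suc.hyps(1))
      show "m = card (K - {\<kappa>})" using Suc \<kappa> by simp
      show "real (card (U \<kappa>' \<inter> W')) \<le> b \<kappa>'"
        if "\<kappa>' \<in> K - {\<kappa>}" "W' \<subseteq> W - U \<kappa>" "bad \<kappa>' W'" for \<kappa>' W'
        using Suc.prems(3)[of \<kappa>' W'] that by blast
    qed (use Suc.prems in auto)
    then obtain W' where W': "W' \<subseteq> W - U \<kappa>"
      "real (card (W - U \<kappa>)) \<le> card W' + (\<Sum>\<kappa>\<in>K - {\<kappa>}. b \<kappa>)"
      "\<forall>\<kappa>\<in>K - {\<kappa>}. U \<kappa> \<inter> W' = {} \<or> \<not> bad \<kappa> W'" by blast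
    have "card W = card (W - U \<kappa>) + card (U \<kappa> \<inter> W)"
      using card_Int_Diff[OF Suc.prems(2), of "U \<kappa>"] by (simp add: Int_commute)
    moreover have "real (card (U \<kappa> \<inter> W)) \<le> b \<kappa>"
      using Suc.prems(3)[OF \<kappa>(1) subset_refl \<kappa>(2)] .
    moreover have "(\<Sum>\<kappa>\<in>K. b \<kappa>) = b \<kappa> + (\<Sum>\<kappa>\<in>K - {\<kappa>}. b \<kappa>)"
      using Suc.prems(1) \<kappa>(1) by (rule sum.remove)
    ultimately have "real (card W) \<le> card W' + (\<Sum>\<kappa>\<in>K. b \<kappa>)"
      using W'(2) by simp
    moreover have "U \<kappa> \<inter> W' = {}" using W'(1) by blast
    ultimately show ?thesis
      using W' by (intro exI[of _ W']) blast
  qed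
qed

text \<open>
  \<open>attaches \<Z> A B\<close> says that, relative to the sets in \<open>\<Z>\<close>, every inclusion involving \<open>B\<close>
  passes through \<open>A\<close>; a new leaf of a tree poset is attached to its neighbour in the same way.
\<close>

definition attaches :: "'b set set \<Rightarrow> 'b set \<Rightarrow> 'b set \<Rightarrow> bool" where
  "attaches \<Z> A B \<longleftrightarrow>
     (\<forall>Z\<in>\<Z>. Z \<noteq> A \<longrightarrow> (Z \<subseteq> B \<longleftrightarrow> Z \<subseteq> A \<and> A \<subseteq> B) \<and> (B \<subseteq> Z \<longleftrightarrow> A \<subseteq> Z \<and> B \<subseteq> A))"

text \<open>\<open>F\<close> occupies levels \<open>l\<close> to \<open>u\<close>, and
  \<open>L\<close> is the level of the set that will carry \<open>m\<close>. On the levels of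
  \<open>F\<close> both |A| and n - |A| are at least \<open>q\<close>, which makes \<open>q\<close>
  the denominator in the bounds on bad chains.\<close>

locale layered_family =
  fixes n k l u L q :: nat and F :: "nat set set"
  assumes F: "A \<in> F \<Longrightarrow> A \<subseteq> {1..n} \<and> l \<le> card A \<and> card A \<le> u"
    and lu: "l \<le> u" and uL: "u < L" and Ln: "L \<le> n"
    and q: "0 < q" "q \<le> l" "q + u \<le> n"
begin

definition hits :: "(nat \<Rightarrow> nat) \<Rightarrow> nat set" where
  "hits p = {j \<in> {l..u}. chain p j \<in> F}"

text \<open>
  A window is a chain together with \<open>k + 1\<close> consecutive members of \<open>F\<close> on it.  A chain through
  \<open>A\<close> has at most one window in which \<open>A\<close> occupies a given position, so discarding windows at \<open>A\<close>
  costs at most the proportion of chains through \<open>A\<close> that behave badly, and the sum of all these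
  losses is a small multiple of the number of windows.
\<close>

definition windows :: "((nat \<Rightarrow> nat) \<times> nat) set" where
  "windows = (SIGMA p:perms n. {s. s + k < card (hits p)})"

definition mark :: "(nat \<Rightarrow> nat) \<times> nat \<Rightarrow> nat \<Rightarrow> nat set" where
  "mark w i = chain (fst w) (sorted_list_of_set (hits (fst w)) ! (snd w + i))"

text \<open>The size limit is \<open>L\<close> and not \<open>u\<close>, because the image of
  \<open>m\<close> is among the sets to be respected.\<close>

definition small_sets :: "nat \<Rightarrow> nat set set \<Rightarrow> bool" where
  "small_sets t \<Z> \<longleftrightarrow> finite \<Z> \<and> card \<Z> \<le> t \<and> (\<forall>Z\<in>\<Z>. Z \<subseteq> {1..n} \<and> l \<le> card Z \<and> card Z \<le> L)"

lemma finite_F: "finite F"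
  by (rule finite_subset[of _ "Pow {1..n}"]) (use F in auto)

lemma finite_hits [simp]: "finite (hits p)"
  unfolding hits_def by simp

lemma card_hits_le: "card (hits p) \<le> Suc n"
proof -
  have "card (hits p) \<le> card {0..n}"
    by (rule card_mono) (use uL Ln in \<open>auto simp: hits_def\<close>)
  then show ?thesis by simp
qed

lemma windows_nth:
  assumes "(p, s) \<in> windows" "i \<le> k"
  shows "sorted_list_of_set (hits p) ! (s + i) \<in> hits p"
proof -
  have "s + i < length (sorted_list_of_set (hits p))" using assms by (simp add: windows_def)
  then show ?thesis using nth_mem set_sorted_list_of_set[OF finite_hits] by metis
qed

lemma windows_perm: "w \<in> windows \<Longrightarrow> fst w \<in> perms n"
  by (auto simp: windows_def)

lemma mark_in_F: "w \<in> windows \<Longrightarrow> i \<le> k \<Longrightarrow> mark w i \<in> F"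
  using windows_nth[of "fst w" "snd w" i] by (simp add: mark_def hits_def)

lemma card_mark:
  "w \<in> windows \<Longrightarrow> card (mark w i) = sorted_list_of_set (hits (fst w)) ! (snd w + i)"
  by (simp add: mark_def card_chain[OF windows_perm])

lemma mark_through: "w \<in> windows \<Longrightarrow> fst w \<in> through n (mark w i)"
  unfolding through_def by (simp add: card_mark windows_perm) (simp add: mark_def)

lemma mark_eq_chain: "w \<in> windows \<Longrightarrow> mark w i = chain (fst w) (card (mark w i))"
  by (simp add: card_mark) (simp add: mark_def)

lemma card_mark_less:
  assumes "w \<in> windows" "i < j" "j \<le> k"
  shows "card (mark w i) < card (mark w j)"
proof -
  have "snd w + j < length (sorted_list_of_set (hits (fst w)))"
    using assms by (auto simp: windows_def)
  then show ?thesis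
    using assms sorted_wrt_nth_less[OF strict_sorted_list_of_set, of "snd w + i" "snd w + j" "hits (fst w)"]
    by (simp add: card_mark)
qed

lemma mark_psubset:
  assumes "w \<in> windows" "i < j" "j \<le> k"
  shows "mark w i \<subset> mark w j"
proof -
  have "mark w i \<subseteq> mark w j"
    using mark_eq_chain[OF assms(1)] chain_mono card_mark_less[OF assms] by (metis less_imp_le)
  then show ?thesis using card_mark_less[OF assms] by auto
qed

lemma inj_on_fst_windows: "i \<le> k \<Longrightarrow> inj_on fst {w \<in> windows. mark w i = A}"
proof (rule inj_onI)
  fix w w' assume i: "i \<le> k" and w: "w \<in> {w \<in> windows. mark w i = A}" "w' \<in> {w \<in> windows. mark w i = A}"
    and eq: "fst w = fst w'"
  let ?h = "sorted_list_of_set (hits (fst w))"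
  have "?h ! (snd w + i) = ?h ! (snd w' + i)" using w eq card_mark[of w i] card_mark[of w' i] by simp
  moreover have "snd w + i < length ?h" "snd w' + i < length ?h"
    using w i eq by (auto simp: windows_def)
  ultimately have "snd w = snd w'"
    using nth_eq_iff_index_eq[OF distinct_sorted_list_of_set] by fastforce
  then show "w = w'" using eq by (simp add: prod_eq_iff)
qed

text \<open>These are the two ways in which \<open>Z\<close> can spoil a later member of the chain,
  phrased without that member. In the first the chain picks up a fixed element of
  \<open>Z - A\<close> by level \<open>u\<close>; in the second the element added right after
  \<open>A\<close> falls into \<open>Z - A\<close>, which has at most \<open>L - l\<close>
  elements.\<close>

lemma card_up_bad:
  assumes A: "A \<in> F" and Z: "Z \<subseteq> {1..n}" "card Z \<le> L" "Z \<noteq> A"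
  shows "card {p \<in> through n A. (\<not> Z \<subseteq> A \<and> Z \<subseteq> chain p u) \<or> (A \<subseteq> Z \<and> chain p (Suc (card A)) \<subseteq> Z)} * q
    \<le> card (through n A) * (2 * (L - l))"
proof -
  let ?N = "card (through n A)" and ?a = "card A"
  have An: "A \<subseteq> {1..n}" and a: "l \<le> ?a" "?a \<le> u" using F[OF A] by auto
  have fin: "finite A" "finite Z" using An Z finite_subset by auto
  let ?P1 = "{p \<in> through n A. \<not> Z \<subseteq> A \<and> Z \<subseteq> chain p u}"
  let ?P2 = "{p \<in> through n A. A \<subseteq> Z \<and> chain p (Suc ?a) \<subseteq> Z}"
  have qa: "q \<le> n - ?a" using a q by simp
  have 1: "card ?P1 * q \<le> ?N * (L - l)"
  proof (cases "Z \<subseteq> A")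
    case False
    then obtain x where x: "x \<in> Z" "x \<notin> A" by blast
    have "card ?P1 * q \<le> card {p \<in> through n A. x \<in> chain p u} * (n - ?a)"
      using x qa by (intro mult_le_mono card_mono) auto
    also have "\<dots> = ?N * (u - ?a)"
      using x Z An a q by (intro card_through_up) auto
    also have "\<dots> \<le> ?N * (L - l)" using a uL by (intro mult_le_mono) auto
    finally show ?thesis .
  qed simp
  have 2: "card ?P2 * q \<le> ?N * (L - l)"
  proof (cases "A \<subseteq> Z")
    case True
    have "?P2 \<subseteq> (\<Union>z\<in>Z - A. {p \<in> through n A. z \<in> chain p (Suc ?a)})"
    proof
      fix p assume p: "p \<in> ?P2"
      then have pp: "p \<in> perms n" "chain p ?a = A" by (auto simp: through_def)
      have "card (chain p (Suc ?a)) = Suc ?a" using pp card_chain by blast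
      then have "\<not> chain p (Suc ?a) \<subseteq> A" using card_mono[OF fin(1), of "chain p (Suc ?a)"] by auto
      then show "p \<in> (\<Union>z\<in>Z - A. {p \<in> through n A. z \<in> chain p (Suc ?a)})" using p by blast
    qed
    then have "card ?P2 * q \<le> card (\<Union>z\<in>Z - A. {p \<in> through n A. z \<in> chain p (Suc ?a)}) * (n - ?a)"
      using fin qa by (intro mult_le_mono card_mono) auto
    also have "\<dots> \<le> (\<Sum>z\<in>Z - A. card {p \<in> through n A. z \<in> chain p (Suc ?a)}) * (n - ?a)"
      using fin by (intro mult_right_mono card_UN_le) auto
    also have "\<dots> = (\<Sum>z\<in>Z - A. card {p \<in> through n A. z \<in> chain p (Suc ?a)} * (n - ?a))"
      by (rule sum_distrib_right)
    also have "\<dots> = (\<Sum>z\<in>Z - A. ?N * (Suc ?a - ?a))"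
      by (intro sum.cong refl card_through_up) (use Z An a q in auto)
    also have "\<dots> = ?N * card (Z - A)" by simp
    also have "\<dots> \<le> ?N * (L - l)"
      using True fin Z a by (intro mult_left_mono) (auto simp: card_Diff_subset)
    finally show ?thesis .
  qed simp
  have "{p \<in> through n A. (\<not> Z \<subseteq> A \<and> Z \<subseteq> chain p u) \<or> (A \<subseteq> Z \<and> chain p (Suc (card A)) \<subseteq> Z)} = ?P1 \<union> ?P2"
    by blast
  moreover have "card (?P1 \<union> ?P2) * q \<le> (card ?P1 + card ?P2) * q"
    by (rule mult_le_mono1[OF card_Un_le])
  moreover have "\<dots> \<le> ?N * (2 * (L - l))"
    using add_le_mono[OF 1 2] by (simp add: algebra_simps)
  ultimately show ?thesis by (simp only: le_trans)
qed

text \<open>Dual to \<open>card_up_bad\<close>: either a fixed element of \<open>A - Z\<close> is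
  already dropped at level \<open>l\<close>, or the element dropped right below \<open>A\<close> is
  one of the at most \<open>L - l\<close> elements of \<open>A - Z\<close>.\<close>

lemma card_down_bad:
  assumes A: "A \<in> F" and Z: "l \<le> card Z" "Z \<noteq> A"
  shows "card {p \<in> through n A. (\<not> A \<subseteq> Z \<and> chain p l \<subseteq> Z) \<or> (Z \<subseteq> A \<and> Z \<subseteq> chain p (card A - 1))} * q
    \<le> card (through n A) * (2 * (L - l))"
proof -
  let ?N = "card (through n A)" and ?a = "card A"
  have An: "A \<subseteq> {1..n}" and a: "l \<le> ?a" "?a \<le> u" using F[OF A] by auto
  have fin: "finite A" using An finite_subset by auto
  let ?P1 = "{p \<in> through n A. \<not> A \<subseteq> Z \<and> chain p l \<subseteq> Z}"
  let ?P2 = "{p \<in> through n A. Z \<subseteq> A \<and> Z \<subseteq> chain p (?a - 1)}"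
  have qa: "q \<le> ?a" using a q by simp
  have 1: "card ?P1 * q \<le> ?N * (L - l)"
  proof (cases "A \<subseteq> Z")
    case False
    then obtain x where x: "x \<in> A" "x \<notin> Z" by blast
    have "card ?P1 * q \<le> card {p \<in> through n A. x \<notin> chain p l} * ?a"
      using x qa by (intro mult_le_mono card_mono) auto
    also have "\<dots> = ?N * (?a - l)"
      using x An a by (intro card_through_down) auto
    also have "\<dots> \<le> ?N * (L - l)" using a uL by (intro mult_le_mono) auto
    finally show ?thesis .
  qed simp
  have 2: "card ?P2 * q \<le> ?N * (L - l)"
  proof (cases "Z \<subseteq> A")
    case True
    have "?P2 \<subseteq> (\<Union>z\<in>A - Z. {p \<in> through n A. z \<notin> chain p (?a - 1)})"
    proof
      fix p assume p: "p \<in> ?P2"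
      then have pp: "p \<in> perms n" "chain p ?a = A" by (auto simp: through_def)
      have "card (chain p (?a - 1)) = ?a - 1" using pp card_chain by blast
      then have "\<not> A \<subseteq> chain p (?a - 1)" using card_mono[of "chain p (?a - 1)" A] q a by auto
      then show "p \<in> (\<Union>z\<in>A - Z. {p \<in> through n A. z \<notin> chain p (?a - 1)})" using p by blast
    qed
    then have "card ?P2 * q \<le> card (\<Union>z\<in>A - Z. {p \<in> through n A. z \<notin> chain p (?a - 1)}) * ?a"
      using fin qa by (intro mult_le_mono card_mono) auto
    also have "\<dots> \<le> (\<Sum>z\<in>A - Z. card {p \<in> through n A. z \<notin> chain p (?a - 1)}) * ?a"
      using fin by (intro mult_right_mono card_UN_le) auto
    also have "\<dots> = (\<Sum>z\<in>A - Z. card {p \<in> through n A. z \<notin> chain p (?a - 1)} * ?a)"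
      by (rule sum_distrib_right)
    also have "\<dots> = (\<Sum>z\<in>A - Z. ?N * (?a - (?a - 1)))"
      by (intro sum.cong refl card_through_down) (use An in auto)
    also have "\<dots> \<le> ?N * card (A - Z)" using a q by simp
    also have "\<dots> \<le> ?N * (L - l)"
      using True fin Z a uL by (intro mult_left_mono) (auto simp: card_Diff_subset finite_subset)
    finally show ?thesis .
  qed simp
  have "{p \<in> through n A. (\<not> A \<subseteq> Z \<and> chain p l \<subseteq> Z) \<or> (Z \<subseteq> A \<and> Z \<subseteq> chain p (?a - 1))} = ?P1 \<union> ?P2"
    by blast
  moreover have "card (?P1 \<union> ?P2) * q \<le> (card ?P1 + card ?P2) * q"
    by (rule mult_le_mono1[OF card_Un_le])
  moreover have "\<dots> \<le> ?N * (2 * (L - l))"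
    using add_le_mono[OF 1 2] by (simp add: algebra_simps)
  ultimately show ?thesis by (simp only: le_trans)
qed

text \<open>Each failure of \<open>attaches\<close> puts the underlying chain into the bad set
  \<open>Q Z\<close> of one \<open>Z\<close>, and a chain carries at most one window with
  \<open>A\<close> at position \<open>i\<close>; a union bound over the at most \<open>t\<close>
  sets finishes.\<close>

lemma card_not_attaching:
  assumes A: "A \<in> F" and Z: "small_sets t \<Z>" and ij: "i \<le> k" "j \<le> k" "i \<noteq> j"
  shows "card {w \<in> windows. mark w i = A \<and> \<not> attaches \<Z> A (mark w j)} * q
    \<le> t * (card (through n A) * (2 * (L - l)))"
proof -
  let ?S = "{w \<in> windows. mark w i = A \<and> \<not> attaches \<Z> A (mark w j)}"
  let ?a = "card A"
  define Q where "Q Z = (if i < j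
      then {p \<in> through n A. (\<not> Z \<subseteq> A \<and> Z \<subseteq> chain p u) \<or> (A \<subseteq> Z \<and> chain p (Suc ?a) \<subseteq> Z)}
      else {p \<in> through n A. (\<not> A \<subseteq> Z \<and> chain p l \<subseteq> Z) \<or> (Z \<subseteq> A \<and> Z \<subseteq> chain p (?a - 1))})" for Z
  have fZ: "finite \<Z>" "card \<Z> \<le> t" using Z by (auto simp: small_sets_def)
  have Qle: "card (Q Z) * q \<le> card (through n A) * (2 * (L - l))" if "Z \<in> \<Z> - {A}" for Z
    using card_up_bad[OF A, of Z] card_down_bad[OF A, of Z] that Z by (auto simp: Q_def small_sets_def)
  have sub: "fst ` ?S \<subseteq> (\<Union>Z\<in>\<Z> - {A}. Q Z)"
  proof
    fix p assume "p \<in> fst ` ?S"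
    then obtain w where w: "w \<in> windows" "mark w i = A" "\<not> attaches \<Z> A (mark w j)" "p = fst w"
      by blast
    let ?B = "mark w j"
    have p: "p \<in> through n A" using mark_through[OF w(1), of i] w by simp
    then have pA: "chain p ?a = A" by (simp add: through_def)
    have B: "?B \<in> F" using mark_in_F[OF w(1) ij(2)] .
    then have cB: "l \<le> card ?B" "card ?B \<le> u" using F by auto
    have eqB: "?B = chain p (card ?B)" using mark_eq_chain[OF w(1)] w(4) by simp
    have lB: "chain p l \<subseteq> ?B" using eqB chain_mono[OF cB(1), of p] by simp
    have uB: "?B \<subseteq> chain p u" using eqB chain_mono[OF cB(2), of p] by simp
    obtain Z where Z: "Z \<in> \<Z>" "Z \<noteq> A"
      and nZ: "\<not> ((Z \<subseteq> ?B \<longleftrightarrow> Z \<subseteq> A \<and> A \<subseteq> ?B) \<and> (?B \<subseteq> Z \<longleftrightarrow> A \<subseteq> Z \<and> ?B \<subseteq> A))"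
      using w(3) unfolding attaches_def by blast
    have "p \<in> Q Z"
    proof (cases "i < j")
      case True
      have AB: "A \<subset> ?B" using mark_psubset[OF w(1) True ij(2)] w(2) by simp
      have "Suc ?a \<le> card ?B" using card_mark_less[OF w(1) True ij(2)] w(2) by simp
      then have "chain p (Suc ?a) \<subseteq> ?B" using eqB chain_mono[of "Suc ?a" "card ?B" p] by simp
      \<comment> \<open>As \<open>A\<close> is a proper subset of the new member \<open>?B\<close>,
        attaching just means that \<open>Z \<subseteq> ?B\<close> implies
        \<open>Z \<subseteq> A\<close> and that \<open>?B \<subseteq> Z\<close> never holds; in the
        second kind of failure \<open>A\<close> and the next chain member also lie in
        \<open>Z\<close>.\<close>
      then have "(\<not> Z \<subseteq> A \<and> Z \<subseteq> chain p u) \<or> (A \<subseteq> Z \<and> chain p (Suc ?a) \<subseteq> Z)"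
        using nZ AB uB by blast
      then show ?thesis using True p by (simp add: Q_def)
    next
      case False
      then have ji: "j < i" using ij by simp
      have AB: "?B \<subset> A" using mark_psubset[OF w(1) ji ij(1)] w(2) by simp
      have "card ?B \<le> ?a - 1" using card_mark_less[OF w(1) ji ij(1)] w(2) by simp
      then have "?B \<subseteq> chain p (?a - 1)" using eqB chain_mono[of "card ?B" "?a - 1" p] by simp
      then have "(\<not> A \<subseteq> Z \<and> chain p l \<subseteq> Z) \<or> (Z \<subseteq> A \<and> Z \<subseteq> chain p (?a - 1))"
        using nZ AB lB by blast
      then show ?thesis using False p by (simp add: Q_def)
    qed
    then show "p \<in> (\<Union>Z\<in>\<Z> - {A}. Q Z)" using Z by blast
  qed
  have finQ: "finite (\<Union>Z\<in>\<Z> - {A}. Q Z)" using fZ by (auto simp: Q_def)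
  have "inj_on fst ?S" by (rule inj_on_subset[OF inj_on_fst_windows[OF ij(1), of A]]) auto
  then have "card ?S \<le> card (\<Union>Z\<in>\<Z> - {A}. Q Z)"
    using card_mono[OF finQ sub] by (simp only: card_image)
  also have "\<dots> \<le> (\<Sum>Z\<in>\<Z> - {A}. card (Q Z))" using fZ by (intro card_UN_le) auto
  finally have "card ?S * q \<le> (\<Sum>Z\<in>\<Z> - {A}. card (Q Z) * q)"
    unfolding sum_distrib_right[symmetric] by (rule mult_le_mono1)
  also have "\<dots> \<le> (\<Sum>Z\<in>\<Z> - {A}. card (through n A) * (2 * (L - l)))"
    by (rule sum_mono) (rule Qle)
  also have "\<dots> = card (\<Z> - {A}) * (card (through n A) * (2 * (L - l)))" by simp
  also have "\<dots> \<le> t * (card (through n A) * (2 * (L - l)))"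
    using fZ card_Diff1_le[of \<Z> A] by (intro mult_right_mono) auto
  finally show ?thesis .
qed

section \<open>Counting windows, cleaning them and choosing the top set\<close>

lemma sum_card_hits: "(\<Sum>p\<in>perms n. card (hits p)) = (\<Sum>A\<in>F. card (through n A))"
proof -
  have eq: "card (hits p) = card {A \<in> F. p \<in> through n A}" if p: "p \<in> perms n" for p
  proof (rule bij_betw_same_card[of "chain p"], rule bij_betw_imageI)
    show "inj_on (chain p) (hits p)" by (rule inj_onI, drule arg_cong[where f = card]) (simp add: card_chain[OF p])
    show "chain p ` hits p = {A \<in> F. p \<in> through n A}"
    proof (intro subset_antisym subsetI)
      fix A assume "A \<in> {A \<in> F. p \<in> through n A}"
      then have A: "A \<in> F" "chain p (card A) = A" by (auto simp: through_def)
      then have "card A \<in> hits p" using F by (auto simp: hits_def)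
      then show "A \<in> chain p ` hits p" using A(2) by (metis imageI)
    qed (use p in \<open>auto simp: hits_def through_def card_chain\<close>)
  qed
  have "(\<Sum>p\<in>perms n. card (hits p)) = (\<Sum>p\<in>perms n. \<Sum>A\<in>F. if p \<in> through n A then 1 else 0)"
    by (rule sum.cong[OF refl]) (simp only: eq card_filter[OF finite_F])
  also have "\<dots> = (\<Sum>A\<in>F. \<Sum>p\<in>perms n. if p \<in> through n A then 1 else 0)" by (rule sum.swap)
  also have "\<dots> = (\<Sum>A\<in>F. card (through n A))"
    by (rule sum.cong[OF refl], subst card_filter[symmetric]) (simp_all add: through_def)
  finally show ?thesis .
qed

lemma window_starts: "{s. s + k < c} = {..<c - k}"
  by auto

lemma finite_windows: "finite windows"
  unfolding windows_def by (rule finite_SigmaI) (simp_all add: window_starts)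

text \<open>A chain with h hits starts h - k windows (none if h is at most k), so h is at most its
  number of windows plus k.\<close>

lemma card_windows_ge: "(\<Sum>A\<in>F. card (through n A)) \<le> card windows + k * fact n"
proof -
  have "(\<Sum>A\<in>F. card (through n A)) \<le> (\<Sum>p\<in>perms n. card {s. s + k < card (hits p)} + k)"
    unfolding sum_card_hits[symmetric] by (rule sum_mono) (simp add: window_starts)
  also have "\<dots> = card windows + k * fact n"
    unfolding windows_def by (subst card_SigmaI)
      (simp_all add: sum.distrib card_perms window_starts)
  finally show ?thesis .
qed

text \<open>Let E be the number of incidences between chains and members of \<open>F\<close>.
  Windows number at least E - k n!, and by \<open>big\<close> this is at least E \<epsilon>/(k +
  \<epsilon>). Cleaning with the keys (A, i, j) costs at most (k + 1)^2 c E, and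
  \<open>small\<close> says that this is at most half of that amount.\<close>

lemma ex_rich_windows:
  fixes \<epsilon> :: real
  assumes e: "0 < \<epsilon>" and big: "(k + \<epsilon>) * fact n \<le> real (\<Sum>A\<in>F. card (through n A))"
    and small: "(k + 1)\<^sup>2 * (t * (2 * (L - l)) / q) \<le> \<epsilon> / (2 * (k + \<epsilon>))"
  shows "\<exists>W\<subseteq>windows. \<epsilon> / 2 * fact n \<le> card W \<and>
    (\<forall>w\<in>W. \<forall>i\<le>k. \<forall>j\<le>k. i \<noteq> j \<longrightarrow> (\<forall>\<Z>. small_sets t \<Z> \<longrightarrow>
      (\<exists>w'\<in>W. mark w' i = mark w i \<and> attaches \<Z> (mark w i) (mark w' j))))"
proof -
  let ?K = "F \<times> {(i, j). i \<le> k \<and> j \<le> k \<and> i \<noteq> j}"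
  define U where "U \<kappa> = (case \<kappa> of (A, i, j) \<Rightarrow> {w. mark w i = A})" for \<kappa> :: "nat set \<times> nat \<times> nat"
  define bad where "bad \<kappa> W = (case \<kappa> of (A, i, j) \<Rightarrow>
     \<exists>\<Z>. small_sets t \<Z> \<and> (\<forall>w\<in>W. mark w i = A \<longrightarrow> \<not> attaches \<Z> A (mark w j)))"
    for \<kappa> :: "nat set \<times> nat \<times> nat" and W
  define c where "c = t * (2 * (L - l)) / real q"
  define b where "b \<kappa> = card (through n (fst \<kappa>)) * c" for \<kappa> :: "nat set \<times> nat \<times> nat"
  let ?E = "real (\<Sum>A\<in>F. card (through n A))"
  have sub: "{(i, j). i \<le> k \<and> j \<le> k \<and> i \<noteq> j} \<subseteq> {..k} \<times> {..k}" by auto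
  then have finIJ: "finite {(i, j). i \<le> k \<and> j \<le> k \<and> i \<noteq> j}" by (rule finite_subset) simp
  have finK: "finite ?K" using finite_F finIJ by simp
  have c0: "0 \<le> c" by (simp add: c_def)
  have "\<exists>W\<subseteq>windows. real (card windows) \<le> card W + (\<Sum>\<kappa>\<in>?K. b \<kappa>) \<and> (\<forall>\<kappa>\<in>?K. U \<kappa> \<inter> W = {} \<or> \<not> bad \<kappa> W)"
  proof (rule clean_keys[OF finK finite_windows])
    fix \<kappa> W assume k: "\<kappa> \<in> ?K" and W: "W \<subseteq> windows" and bad: "bad \<kappa> W"
    obtain A i j where kk: "\<kappa> = (A, i, j)" by (cases \<kappa>)
    with k have A: "A \<in> F" and ij: "i \<le> k" "j \<le> k" "i \<noteq> j" by auto
    from bad kk obtain \<Z> where Z: "small_sets t \<Z>" "\<forall>w\<in>W. mark w i = A \<longrightarrow> \<not> attaches \<Z> A (mark w j)"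
      by (auto simp: bad_def)
    have "card (U \<kappa> \<inter> W) \<le> card {w \<in> windows. mark w i = A \<and> \<not> attaches \<Z> A (mark w j)}"
      using W Z(2) finite_windows by (intro card_mono) (auto simp: U_def kk)
    then have "card (U \<kappa> \<inter> W) * q \<le> t * (card (through n A) * (2 * (L - l)))"
      using card_not_attaching[OF A Z(1) ij] by (meson le_trans mult_le_mono1)
    then have "real (card (U \<kappa> \<inter> W) * q) \<le> real (t * (card (through n A) * (2 * (L - l))))"
      by (rule of_nat_mono)
    then show "real (card (U \<kappa> \<inter> W)) \<le> b \<kappa>"
      using q(1) by (simp add: b_def c_def kk field_simps)
  qed (simp add: b_def c0)
  then obtain W where W: "W \<subseteq> windows" and cW: "real (card windows) \<le> card W + (\<Sum>\<kappa>\<in>?K. b \<kappa>)"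
    and good: "\<forall>\<kappa>\<in>?K. U \<kappa> \<inter> W = {} \<or> \<not> bad \<kappa> W" by blast
  have "card {(i, j). i \<le> k \<and> j \<le> k \<and> i \<noteq> j} \<le> card ({..k} \<times> {..k})"
    using sub by (intro card_mono) auto
  then have cIJ: "card {(i, j). i \<le> k \<and> j \<le> k \<and> i \<noteq> j} \<le> (k + 1)\<^sup>2"
    by (simp add: power2_eq_square)
  have E0: "0 < ?E" using big e by (smt (verit) fact_gt_zero mult_pos_pos of_nat_0_le_iff)
  have "(\<Sum>\<kappa>\<in>?K. b \<kappa>) = (\<Sum>A\<in>F. \<Sum>y\<in>{(i, j). i \<le> k \<and> j \<le> k \<and> i \<noteq> j}. card (through n A) * c)"
    by (subst sum.cartesian_product) (simp add: b_def case_prod_beta)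
  also have "\<dots> = card {(i, j). i \<le> k \<and> j \<le> k \<and> i \<noteq> j} * c * ?E"
    by (simp add: sum_distrib_left sum_distrib_right ac_simps)
  also have "\<dots> \<le> real ((k + 1)\<^sup>2) * c * ?E"
    using cIJ c0 E0 by (intro mult_right_mono) (auto simp del: of_nat_power of_nat_sum)
  also have "\<dots> \<le> \<epsilon> / (2 * (k + \<epsilon>)) * ?E"
    using small E0 by (intro mult_right_mono) (auto simp: c_def)
  finally have loss: "(\<Sum>\<kappa>\<in>?K. b \<kappa>) \<le> \<epsilon> / (2 * (k + \<epsilon>)) * ?E" .
  have ke: "0 < k + \<epsilon>" using e by simp
  \<comment> \<open>This exchanges n! for a multiple of E, so that gains and losses are measured in
    the same unit.\<close>
  have fact_le: "fact n \<le> ?E / (k + \<epsilon>)"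
    using big pos_le_divide_eq[OF ke] by (simp add: mult.commute)
  have "?E \<le> card windows + k * fact n"
    using of_nat_mono[OF card_windows_ge, where 'a = real] by simp
  moreover have "k * fact n \<le> k / (k + \<epsilon>) * ?E"
    using mult_left_mono[OF fact_le, of "real k"] by simp
  ultimately have "?E - k / (k + \<epsilon>) * ?E - \<epsilon> / (2 * (k + \<epsilon>)) * ?E \<le> card W"
    using cW loss by linarith
  moreover have "?E - k / (k + \<epsilon>) * ?E - \<epsilon> / (2 * (k + \<epsilon>)) * ?E = \<epsilon> / (2 * (k + \<epsilon>)) * ?E"
  proof -
    have r: "k / (k + \<epsilon>) = 1 - \<epsilon> / (k + \<epsilon>)" "\<epsilon> / (2 * (k + \<epsilon>)) = \<epsilon> / (k + \<epsilon>) / 2"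
      using ke by (simp_all add: field_simps)
    have "x - (1 - y) * x - y / 2 * x = y / 2 * x" for x y :: real
      by (simp add: algebra_simps)
    then show ?thesis unfolding r .
  qed
  moreover have "\<epsilon> / 2 * fact n \<le> \<epsilon> / (2 * (k + \<epsilon>)) * ?E"
    using mult_left_mono[OF fact_le, of "\<epsilon> / 2"] ke e by (simp add: field_simps)
  ultimately have "\<epsilon> / 2 * fact n \<le> card W" by linarith
  moreover have "\<exists>w'\<in>W. mark w' i = mark w i \<and> attaches \<Z> (mark w i) (mark w' j)"
    if "w \<in> W" "i \<le> k" "j \<le> k" "i \<noteq> j" "small_sets t \<Z>" for w i j \<Z>
  proof -
    have "(mark w i, i, j) \<in> ?K" using that W mark_in_F[of w i] by auto
    moreover have "w \<in> U (mark w i, i, j) \<inter> W" using that by (simp add: U_def)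
    ultimately have "\<not> bad (mark w i, i, j) W" using good by blast
    then show ?thesis using that(5) by (auto simp: bad_def)
  qed
  ultimately show ?thesis using W by blast
qed

text \<open>Averaging yields an \<open>M\<close> on level \<open>L\<close> whose windows number at
  least \<epsilon>/2 times the chains through it. If position \<open>j\<close> of each of them were
  comparable to some \<open>Z\<close>, the chain would satisfy
  \<open>chain p l \<subseteq> Z\<close> or \<open>Z \<subseteq> chain p u\<close>. Both are
  exponentially rare among chains through \<open>M\<close>, and the factor \<open>n + 1\<close>
  bounds the windows on one chain.\<close>

lemma ex_top_set:
  fixes \<epsilon> :: real
  assumes W: "W \<subseteq> windows" and e: "0 < \<epsilon>" and big: "\<epsilon> / 2 * fact n \<le> card W"
    and tiny: "(n + 1) * (2 * t * (u / L) ^ l) < \<epsilon> / 2"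
  shows "\<exists>M\<subseteq>{1..n}. card M = L \<and> (\<forall>j\<le>k. \<forall>\<Z>. finite \<Z> \<and> card \<Z> \<le> t \<and>
      (\<forall>Z\<in>\<Z>. Z \<subseteq> {1..n} \<and> l \<le> card Z \<and> card Z \<le> u) \<longrightarrow>
      (\<exists>w\<in>W. mark w j \<subset> M \<and> (\<forall>Z\<in>\<Z>. \<not> Z \<subseteq> mark w j \<and> \<not> mark w j \<subseteq> Z)))"
proof -
  let ?\<M> = "{M. M \<subseteq> {1..n} \<and> card M = L}"
  let ?W = "\<lambda>M. {w \<in> W. chain (fst w) L = M}"
  let ?N = "\<lambda>M. card (through n M)"
  have finW: "finite W" using W finite_windows finite_subset by blast
  have finM: "finite ?\<M>" by (rule finite_subset[of _ "Pow {1..n}"]) auto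
  have in\<M>: "chain p L \<in> ?\<M>" if "p \<in> perms n" for p
    using chain_subset[OF that Ln] card_chain[OF that] by simp
  have sumW: "(\<Sum>M\<in>?\<M>. card (?W M)) = card W"
    by (rule sum_card_fibres[OF finW finM in\<M>]) (use W windows_perm in auto)
  have "(\<Sum>M\<in>?\<M>. ?N M) = (\<Sum>M\<in>?\<M>. card {p \<in> perms n. chain p L = M})"
    by (rule sum.cong) (auto simp: through_def)
  also have "\<dots> = fact n"
    using sum_card_fibres[OF finite_perms finM in\<M>] by (simp add: card_perms)
  finally have sumN: "(\<Sum>M\<in>?\<M>. ?N M) = fact n" .
  \<comment> \<open>The sets of level \<open>L\<close> partition both the chains and the windows in
    \<open>W\<close>, so strict failure at every \<open>M\<close> would contradict
    \<open>big\<close> after summation.\<close>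
  have "\<exists>M\<in>?\<M>. \<epsilon> / 2 * ?N M \<le> card (?W M)"
  proof (rule ccontr)
    assume "\<not> ?thesis"
    then have less: "real (card (?W M)) < \<epsilon> / 2 * ?N M" if "M \<in> ?\<M>" for M
      using that by force
    have "{1..L} \<in> ?\<M>" using Ln by simp
    then have "?\<M> \<noteq> {}" by blast
    then have "(\<Sum>M\<in>?\<M>. real (card (?W M))) < (\<Sum>M\<in>?\<M>. \<epsilon> / 2 * ?N M)"
      by (rule sum_strict_mono[OF finM _ less])
    also have "\<dots> = \<epsilon> / 2 * real (\<Sum>M\<in>?\<M>. ?N M)" by (simp add: sum_distrib_left)
    also have "\<dots> = \<epsilon> / 2 * fact n" by (simp only: sumN of_nat_fact)
    finally show False using big by (simp only: sumW of_nat_sum[symmetric])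
  qed
  then obtain M where M: "M \<subseteq> {1..n}" "card M = L" and WM: "\<epsilon> / 2 * ?N M \<le> card (?W M)"
    by blast
  have N0: "0 < ?N M"
    using card_through[OF M(1)] fact_gt_zero[of n, where 'a = nat] by (metis mult_is_0 neq0_conv)
  have L0: "0 < L" using uL by simp
  have r: "0 \<le> real u / L" "real u / L \<le> 1" using uL by (simp_all add: field_simps)
  have avoid: "\<exists>w\<in>W. mark w j \<subset> M \<and> (\<forall>Z\<in>\<Z>. \<not> Z \<subseteq> mark w j \<and> \<not> mark w j \<subseteq> Z)"
    if j: "j \<le> k" and fZ: "finite \<Z>" "card \<Z> \<le> t"
      and Z: "\<forall>Z\<in>\<Z>. Z \<subseteq> {1..n} \<and> l \<le> card Z \<and> card Z \<le> u" for j \<Z>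
  proof (rule ccontr)
    assume no: "\<not> ?thesis"
    let ?Q1 = "\<lambda>Z. {p \<in> through n M. chain p l \<subseteq> Z}"
    let ?Q2 = "\<lambda>Z. {p \<in> through n M. Z \<subseteq> chain p u}"
    let ?Q = "\<Union>Z\<in>\<Z>. ?Q1 Z \<union> ?Q2 Z"
    let ?c = "?N M * (u / L) ^ l"
    have q1: "real (card (?Q1 Z)) \<le> ?c" if "Z \<in> \<Z>" for Z
    proof -
      have "finite Z" using Z that finite_subset by blast
      then have "card (?Q1 Z) * L ^ l \<le> ?N M * u ^ l"
        using card_through_inside[OF M(1) lu, of Z] that Z uL M(2) by simp
      then have "real (card (?Q1 Z) * L ^ l) \<le> real (?N M * u ^ l)" by (rule of_nat_mono)
      then show ?thesis using L0 by (simp add: power_divide field_simps)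
    qed
    have q2: "real (card (?Q2 Z)) \<le> ?c" if "Z \<in> \<Z>" for Z
    proof (cases "Z \<subseteq> M")
      case True
      then have "card (?Q2 Z) * L ^ card Z \<le> ?N M * u ^ card Z"
        using card_through_covering[OF M(1), of Z u] that Z uL M(2) by simp
      then have "real (card (?Q2 Z) * L ^ card Z) \<le> real (?N M * u ^ card Z)" by (rule of_nat_mono)
      then have "real (card (?Q2 Z)) \<le> ?N M * (u / L) ^ card Z"
        using L0 by (simp add: power_divide field_simps)
      \<comment> \<open>The base is at most 1 and \<open>l \<le> card Z\<close>, so the exponent may
        be lowered to \<open>l\<close>.\<close>
      also have "\<dots> \<le> ?c"
        using that Z by (intro mult_left_mono power_decreasing r) auto
      finally show ?thesis .
    next
      case False
      have "chain p u \<subseteq> M" if "p \<in> through n M" for p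
        using that chain_mono[of u L p] uL M(2) by (auto simp: through_def)
      then have "?Q2 Z = {}" using False by blast
      then show ?thesis using r by (simp only:) simp
    qed
    have "card ?Q \<le> (\<Sum>Z\<in>\<Z>. card (?Q1 Z \<union> ?Q2 Z))" using fZ by (intro card_UN_le)
    also have "\<dots> \<le> (\<Sum>Z\<in>\<Z>. card (?Q1 Z) + card (?Q2 Z))"
      by (intro sum_mono card_Un_le)
    finally have "real (card ?Q) \<le> real (\<Sum>Z\<in>\<Z>. card (?Q1 Z) + card (?Q2 Z))"
      by (rule of_nat_mono)
    also have "\<dots> = (\<Sum>Z\<in>\<Z>. real (card (?Q1 Z)) + real (card (?Q2 Z)))" by simp
    also have "\<dots> \<le> (\<Sum>Z\<in>\<Z>. 2 * ?c)"
      by (rule sum_mono, subst mult_2, rule add_mono) (rule q1 q2, assumption)+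
    also have "\<dots> \<le> t * (2 * ?c)"
      using fZ r by (simp add: mult_right_mono)
    finally have cQ: "real (card ?Q) \<le> t * (2 * ?c)" .
    have finQ: "finite ?Q" using fZ by simp
    have sub: "?W M \<subseteq> (SIGMA p:?Q. {s. s + k < card (hits p)})"
    proof
      fix w assume w: "w \<in> ?W M"
      then have ww: "w \<in> windows" "w \<in> W" and wM: "chain (fst w) L = M" using W by auto
      let ?B = "mark w j" and ?p = "fst w"
      have B: "l \<le> card ?B" "card ?B \<le> u" using F[OF mark_in_F[OF ww(1) j]] by auto
      have eqB: "?B = chain ?p (card ?B)" using mark_eq_chain[OF ww(1)] .
      have lB: "chain ?p l \<subseteq> ?B" using eqB chain_mono[OF B(1), of ?p] by simp
      have uB: "?B \<subseteq> chain ?p u" using eqB chain_mono[OF B(2), of ?p] by simp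
      have "?B \<subseteq> M" using uB chain_mono[of u L ?p] uL wM by auto
      moreover have "?B \<noteq> M" using B uL M(2) by auto
      ultimately obtain Z where "Z \<in> \<Z>" "Z \<subseteq> ?B \<or> ?B \<subseteq> Z" using no ww(2) by blast
      moreover have "?p \<in> through n M" using wM M(2) windows_perm[OF ww(1)] by (simp add: through_def)
      ultimately have "?p \<in> ?Q" using lB uB by blast
      then show "w \<in> (SIGMA p:?Q. {s. s + k < card (hits p)})"
        using ww(1) by (cases w) (simp add: windows_def)
    qed
    have "card (?W M) \<le> card (SIGMA p:?Q. {s. s + k < card (hits p)})"
      using finQ by (intro card_mono[OF _ sub] finite_SigmaI) (simp_all add: window_starts)
    also have "\<dots> = (\<Sum>p\<in>?Q. card {s. s + k < card (hits p)})"
      using finQ by (intro card_SigmaI) (simp_all add: window_starts)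
    also have "\<dots> \<le> (\<Sum>p\<in>?Q. n + 1)"
    proof (rule sum_mono)
      show "card {s. s + k < card (hits p)} \<le> n + 1" for p
        using card_hits_le[of p] by (simp add: window_starts)
    qed
    finally have "card (?W M) \<le> card ?Q * (n + 1)" by simp
    then have "real (card (?W M)) \<le> real (card ?Q * (n + 1))" by (rule of_nat_mono)
    also have "\<dots> = real (card ?Q) * (n + 1)" by (simp add: algebra_simps)
    also have "\<dots> \<le> t * (2 * ?c) * (n + 1)" using cQ by (rule mult_right_mono) simp
    also have "\<dots> = (n + 1) * (2 * t * (u / L) ^ l) * ?N M" by (simp add: ac_simps)
    also have "\<dots> < \<epsilon> / 2 * ?N M" using tiny N0 by (intro mult_strict_right_mono) simp_all
    finally show False using WM by simp
  qed
  show ?thesis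
    by (intro exI[of _ M] conjI allI impI M, elim conjE) (rule avoid)
qed

end

section \<open>Greedy embedding along the Hasse tree\<close>

lemma hasse_edges_converse [simp]: "hasse_edges (r\<inverse>) = hasse_edges r"
  unfolding hasse_edges_def covers_def by auto

lemma sym_hasse_edges: "sym (hasse_edges r)"
  unfolding hasse_edges_def sym_def by auto

lemma tree_poset_converse: "tree_poset r \<Longrightarrow> tree_poset (r\<inverse>)"
  unfolding tree_poset_def by simp

lemma poset_refl: "tree_poset r \<Longrightarrow> x \<in> Field r \<Longrightarrow> (x, x) \<in> r"
  by (auto simp: tree_poset_def partial_order_on_def preorder_on_def refl_on_def)

lemma poset_antisym: "tree_poset r \<Longrightarrow> (x, y) \<in> r \<Longrightarrow> (y, x) \<in> r \<Longrightarrow> x = y"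
  by (auto simp: tree_poset_def partial_order_on_def dest: antisymD)

lemma poset_trans: "tree_poset r \<Longrightarrow> (x, y) \<in> r \<Longrightarrow> (y, z) \<in> r \<Longrightarrow> (x, z) \<in> r"
  by (auto simp: tree_poset_def partial_order_on_def preorder_on_def dest: transD)

lemma poset_finite: "tree_poset r \<Longrightarrow> finite (Field r)"
  by (simp add: tree_poset_def)

lemma hasse_edges_Field: "(a, b) \<in> hasse_edges r \<Longrightarrow> a \<in> Field r \<and> b \<in> Field r"
  by (auto simp: hasse_edges_def covers_def Field_def)

text \<open>An element strictly between \<open>x\<close> and \<open>y\<close> splits the interval
  into two strictly smaller ones; the induction is on the size of the interval.\<close>

lemma cover_path:
  assumes T: "tree_poset r" and "(x, y) \<in> r"
  shows "(x, y) \<in> {(p, q). covers r q p}\<^sup>*"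
  using assms(2)
proof (induction "card {z. (x, z) \<in> r \<and> (z, y) \<in> r}" arbitrary: x y rule: less_induct)
  case less
  show ?case
  proof (cases "x = y \<or> covers r y x")
    case True
    then show ?thesis by auto
  next
    case False
    then obtain z where z: "(x, z) \<in> r" "x \<noteq> z" "(z, y) \<in> r" "z \<noteq> y"
      using less.prems by (auto simp: covers_def)
    have fin: "finite {z. (x, z) \<in> r \<and> (z, y) \<in> r}"
      by (rule finite_subset[OF _ poset_finite[OF T]]) (auto simp: Field_def)
    have xF: "x \<in> Field r" "y \<in> Field r" using less.prems by (auto simp: Field_def)
    have "card {w. (x, w) \<in> r \<and> (w, z) \<in> r} < card {w. (x, w) \<in> r \<and> (w, y) \<in> r}"
    proof (rule psubset_card_mono[OF fin])
      have "y \<in> {w. (x, w) \<in> r \<and> (w, y) \<in> r}" using less.prems poset_refl[OF T] xF by auto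
      moreover have "y \<notin> {w. (x, w) \<in> r \<and> (w, z) \<in> r}" using poset_antisym[OF T] z by blast
      moreover have "{w. (x, w) \<in> r \<and> (w, z) \<in> r} \<subseteq> {w. (x, w) \<in> r \<and> (w, y) \<in> r}"
        using poset_trans[OF T _ z(3)] by blast
      ultimately show "{w. (x, w) \<in> r \<and> (w, z) \<in> r} \<subset> {w. (x, w) \<in> r \<and> (w, y) \<in> r}" by blast
    qed
    moreover have "card {w. (z, w) \<in> r \<and> (w, y) \<in> r} < card {w. (x, w) \<in> r \<and> (w, y) \<in> r}"
    proof (rule psubset_card_mono[OF fin])
      have "x \<in> {w. (x, w) \<in> r \<and> (w, y) \<in> r}" using less.prems poset_refl[OF T] xF by auto
      moreover have "x \<notin> {w. (z, w) \<in> r \<and> (w, y) \<in> r}" using poset_antisym[OF T] z by blast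
      moreover have "{w. (z, w) \<in> r \<and> (w, y) \<in> r} \<subseteq> {w. (x, w) \<in> r \<and> (w, y) \<in> r}"
        using poset_trans[OF T z(1)] by blast
      ultimately show "{w. (z, w) \<in> r \<and> (w, y) \<in> r} \<subset> {w. (x, w) \<in> r \<and> (w, y) \<in> r}" by blast
    qed
    ultimately show ?thesis using less.hyps z by (meson rtrancl_trans)
  qed
qed

lemma covers_rtrancl:
  assumes T: "tree_poset r" and "(x, y) \<in> {(p, q). covers r q p}\<^sup>*" "x \<in> Field r"
  shows "(x, y) \<in> r"
  using assms(2)
proof induction
  case base
  then show ?case using poset_refl[OF T assms(3)] .
next
  case (step y z)
  then show ?case using poset_trans[OF T] by (auto simp: covers_def)
qed

lemma rtrancl_simple_path:
  assumes "(u, v) \<in> R\<^sup>*"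
  shows "\<exists>xs. xs \<noteq> [] \<and> hd xs = u \<and> last xs = v \<and> distinct xs \<and> successively (\<lambda>x y. (x, y) \<in> R) xs"
  using assms
proof (induction rule: converse_rtrancl_induct)
  case base
  then show ?case by (intro exI[of _ "[v]"]) simp
next
  case (step u w)
  then obtain xs where xs: "xs \<noteq> []" "hd xs = w" "last xs = v" "distinct xs"
    "successively (\<lambda>x y. (x, y) \<in> R) xs" by blast
  show ?case
  proof (cases "u \<in> set xs")
    case True
    then obtain ys zs where "xs = ys @ u # zs" by (meson split_list)
    then show ?thesis using xs by (intro exI[of _ "u # zs"]) (auto simp: successively_append_iff)
  next
    case False
    then show ?thesis using xs step(1) by (intro exI[of _ "u # xs"]) (auto simp: successively_Cons)
  qed
qed

lemma successively_subset:
  assumes "successively (\<lambda>x y. (x, y) \<in> R) xs" "R \<subseteq> S \<times> S" "xs \<noteq> []" "hd xs \<in> S"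
  shows "set xs \<subseteq> S"
  using assms
  by (induction xs rule: induct_list012) auto

text \<open>Cutting at the last exit makes the tail avoid \<open>S\<close> altogether, hence
  disjoint from any path inside \<open>S\<close>; this disjointness is what allows the two to be
  closed up to a cycle.\<close>

lemma rtrancl_last_exit:
  assumes "(x, z) \<in> C\<^sup>*" "x \<in> S" "z \<notin> S"
  shows "\<exists>y\<in>S. \<exists>y'. y' \<notin> S \<and> (x, y) \<in> C\<^sup>* \<and> (y, y') \<in> C \<and> (y', z) \<in> (C \<inter> (- S) \<times> (- S))\<^sup>*"
  using assms
proof (induction rule: rtrancl_induct)
  case (step z z')
  show ?case
  proof (cases "z \<in> S")
    case True
    then show ?thesis using step by blast
  next
    case False
    then obtain y y' where "y \<in> S" "y' \<notin> S" "(x, y) \<in> C\<^sup>*" "(y, y') \<in> C"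
      "(y', z) \<in> (C \<inter> (- S) \<times> (- S))\<^sup>*" using step by blast
    moreover have "(z, z') \<in> C \<inter> (- S) \<times> (- S)" using step False by blast
    ultimately show ?thesis by (meson rtrancl.rtrancl_into_rtrancl)
  qed
qed simp

text \<open>The bound on \<open>length xs\<close> supplies a third vertex; without it the two
  connecting edges could be a single edge traversed back and forth.\<close>

lemma graph_cycle_append:
  assumes xs: "successively (\<lambda>x y. (x, y) \<in> E) xs" "distinct xs" "set xs \<subseteq> V" "2 \<le> length xs"
    and ys: "successively (\<lambda>x y. (x, y) \<in> E) ys" "distinct ys" "set ys \<subseteq> V" "ys \<noteq> []"
    and disj: "set xs \<inter> set ys = {}"
    and edges: "(last xs, hd ys) \<in> E" "(last ys, hd xs) \<in> E"
  shows "graph_cycle V E (xs @ ys)"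
proof -
  let ?vs = "xs @ ys"
  have ne: "xs \<noteq> []" using xs(4) by auto
  have succ: "successively (\<lambda>x y. (x, y) \<in> E) ?vs"
    using xs ys edges ne by (simp add: successively_append_iff)
  have "(?vs ! i, ?vs ! (Suc i mod length ?vs)) \<in> E" if "i < length ?vs" for i
  proof (cases "Suc i < length ?vs")
    case True
    then show ?thesis using succ by (simp add: successively_conv_nth)
  next
    case False
    then have "Suc i = length ?vs" using that by simp
    then have i: "i = length ?vs - 1" "Suc i mod length ?vs = 0" by simp_all
    have "?vs ! i = last ?vs" using i(1) ys(4) by (metis append_is_Nil_conv last_conv_nth)
    moreover have "?vs ! 0 = hd xs" using ne by (simp add: nth_append hd_conv_nth)
    ultimately show ?thesis using edges(2) ys(4) i(2) by simp
  qed
  moreover have "3 \<le> length ?vs" using xs(4) ys(4) by (cases ys) auto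
  ultimately show ?thesis using xs ys disj unfolding graph_cycle_def by auto
qed

text \<open>
  A saturated chain from \<open>x\<close> to \<open>b\<close> that leaves \<open>S\<close> from some \<open>y \<noteq> a\<close> would close up, through
  \<open>S\<close>, to a cycle containing the edge from \<open>a\<close> to \<open>b\<close>.
\<close>

lemma tree_attach_below:
  assumes T: "tree_poset r" and S: "S \<subseteq> Field r"
    and conn: "\<And>x y. x \<in> S \<Longrightarrow> y \<in> S \<Longrightarrow> (x, y) \<in> (hasse_edges r \<inter> S \<times> S)\<^sup>*"
    and a: "a \<in> S" and b: "b \<notin> S" and ab: "(a, b) \<in> hasse_edges r"
    and x: "x \<in> S" and xb: "(x, b) \<in> r"
  shows "(x, a) \<in> r \<and> (a, b) \<in> r"
proof -
  let ?C = "{(p, q). covers r q p}"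
  have CE: "?C \<subseteq> hasse_edges r" by (auto simp: hasse_edges_def)
  have xF: "x \<in> Field r" using x S by blast
  from rtrancl_last_exit[OF cover_path[OF T xb] x b]
  obtain y y' where y: "y \<in> S" "y' \<notin> S" "(x, y) \<in> ?C\<^sup>*" "(y, y') \<in> ?C"
    and y'b: "(y', b) \<in> (?C \<inter> (- S) \<times> (- S))\<^sup>*" by blast
  have xy: "(x, y) \<in> r" using covers_rtrancl[OF T y(3) xF] .
  have y'F: "y' \<in> Field r" using y(4) by (auto simp: covers_def Field_def)
  have "(y', b) \<in> ?C\<^sup>*" using y'b rtrancl_mono[of "?C \<inter> (- S) \<times> (- S)" ?C] by blast
  then have y'b': "(y', b) \<in> r" using covers_rtrancl[OF T _ y'F] by blast
  show ?thesis
  proof (cases "y = a")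
    case True
    then have "(a, b) \<in> r" using y(4) y'b' poset_trans[OF T] by (auto simp: covers_def)
    then show ?thesis using xy True by simp
  next
    case False
    obtain xs where xs: "xs \<noteq> []" "hd xs = a" "last xs = y" "distinct xs"
      "successively (\<lambda>x y. (x, y) \<in> hasse_edges r \<inter> S \<times> S) xs"
      using rtrancl_simple_path[OF conn[OF a y(1)]] by blast
    obtain ys where ys: "ys \<noteq> []" "hd ys = y'" "last ys = b" "distinct ys"
      "successively (\<lambda>x y. (x, y) \<in> ?C \<inter> (- S) \<times> (- S)) ys"
      using rtrancl_simple_path[OF y'b] by blast
    have xsS: "set xs \<subseteq> S" by (rule successively_subset[OF xs(5) _ xs(1)]) (use xs a in auto)
    have ysS: "set ys \<subseteq> - S" by (rule successively_subset[OF ys(5) _ ys(1)]) (use ys y in auto)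
    have ysE: "successively (\<lambda>x y. (x, y) \<in> hasse_edges r) ys"
      using ys(5) by (rule successively_mono) (use CE in auto)
    have EF: "hasse_edges r \<subseteq> Field r \<times> Field r" by (auto dest: hasse_edges_Field)
    have ysF: "set ys \<subseteq> Field r"
      by (rule successively_subset[OF ysE EF ys(1)]) (simp add: ys(2) y'F)
    have "2 \<le> length xs"
    proof (rule ccontr)
      assume "\<not> 2 \<le> length xs"
      then have "length xs = Suc 0" using xs(1) length_greater_0_conv[of xs] by linarith
      then obtain z where "xs = [z]" by (auto simp: length_Suc_conv)
      then show False using xs False by simp
    qed
    then have "graph_cycle (Field r) (hasse_edges r) (xs @ ys)"
    proof (rule graph_cycle_append[rotated 3])
      show "successively (\<lambda>x y. (x, y) \<in> hasse_edges r) xs"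
        using xs(5) by (rule successively_mono) auto
      show "(last xs, hd ys) \<in> hasse_edges r" using xs ys y(4) CE by auto
      show "(last ys, hd xs) \<in> hasse_edges r"
        using xs ys ab sym_hasse_edges[of r] by (auto dest: symD)
    qed (use xs ys xsS ysS ysF ysE S in auto)
    then show ?thesis using T by (auto simp: tree_poset_def tree_graph_def)
  qed
qed

text \<open>The poset counterpart of \<open>attaches\<close>. The second equivalence is the first
  one for the converse order, which has the same Hasse diagram.\<close>

lemma tree_attach:
  assumes T: "tree_poset r" and S: "S \<subseteq> Field r"
    and conn: "\<And>x y. x \<in> S \<Longrightarrow> y \<in> S \<Longrightarrow> (x, y) \<in> (hasse_edges r \<inter> S \<times> S)\<^sup>*"
    and a: "a \<in> S" and b: "b \<notin> S" and ab: "(a, b) \<in> hasse_edges r" and x: "x \<in> S"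
  shows "(x, b) \<in> r \<longleftrightarrow> (x, a) \<in> r \<and> (a, b) \<in> r" "(b, x) \<in> r \<longleftrightarrow> (b, a) \<in> r \<and> (a, x) \<in> r"
proof -
  show "(x, b) \<in> r \<longleftrightarrow> (x, a) \<in> r \<and> (a, b) \<in> r"
    using tree_attach_below[OF T S conn a b ab x] poset_trans[OF T] by blast
  have "(x, a) \<in> r\<inverse> \<and> (a, b) \<in> r\<inverse>" if "(x, b) \<in> r\<inverse>"
    by (rule tree_attach_below[OF tree_poset_converse[OF T] _ _ a b _ x that]) (use S conn ab in auto)
  then show "(b, x) \<in> r \<longleftrightarrow> (b, a) \<in> r \<and> (a, x) \<in> r"
    using poset_trans[OF T] by blast
qed

lemma rtrancl_exit: "(x, y) \<in> R\<^sup>* \<Longrightarrow> x \<in> S \<Longrightarrow> y \<notin> S \<Longrightarrow> \<exists>a\<in>S. \<exists>b. b \<notin> S \<and> (a, b) \<in> R"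
  by (induction rule: rtrancl_induct) blast+

text \<open>Starting from \<open>m\<close> at \<open>M\<close>, a connected part \<open>S\<close>
  grows by one vertex \<open>b\<close> joined to some \<open>a\<close> in \<open>S\<close>.
  \<open>R j\<close> holds the sets allowed for rank \<open>j\<close>; \<open>step\<close> serves
  edges away from \<open>m\<close> and \<open>top\<close> serves edges at \<open>m\<close>. The
  bound \<open>card (Field r) + 1\<close> leaves room for the images placed so far and one set to be
  avoided.\<close>

lemma embed_tree:
  fixes r :: "'a rel" and R :: "nat \<Rightarrow> 'b set set" and M :: "'b set"
  assumes T: "tree_poset r" and m: "maximal_in r m"
    and rank: "\<And>x y. (x, y) \<in> r \<Longrightarrow> x \<noteq> y \<Longrightarrow> x \<noteq> m \<Longrightarrow> y \<noteq> m \<Longrightarrow> \<rho> x < \<rho> y"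
    and rank_le: "\<And>x. x \<in> Field r \<Longrightarrow> x \<noteq> m \<Longrightarrow> \<rho> x \<le> k"
    and R: "\<And>j. j \<le> k \<Longrightarrow> R j \<subseteq> G"
    and MG: "\<And>Z. Z \<in> G \<Longrightarrow> \<not> M \<subseteq> Z"
    and Y: "\<Y> \<subseteq> G" "finite \<Y>" "card \<Y> \<le> 1"
    and step: "\<And>A i j \<Z>. A \<in> R i \<Longrightarrow> i \<le> k \<Longrightarrow> j \<le> k \<Longrightarrow> i \<noteq> j \<Longrightarrow> finite \<Z> \<Longrightarrow>
      card \<Z> \<le> card (Field r) + 1 \<Longrightarrow> \<Z> \<subseteq> insert M G \<Longrightarrow>
      \<exists>B\<in>R j. (i < j \<longrightarrow> A \<subset> B) \<and> (j < i \<longrightarrow> B \<subset> A) \<and> attaches \<Z> A B"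
    and top: "\<And>j \<Z>. j \<le> k \<Longrightarrow> finite \<Z> \<Longrightarrow> card \<Z> \<le> card (Field r) + 1 \<Longrightarrow> \<Z> \<subseteq> G \<Longrightarrow>
      \<exists>B\<in>R j. B \<subset> M \<and> (\<forall>Z\<in>\<Z>. \<not> Z \<subseteq> B \<and> \<not> B \<subseteq> Z)"
  shows "\<exists>f. f m = M \<and> (\<forall>x\<in>Field r - {m}. f x \<in> G - \<Y>) \<and>
    (\<forall>x\<in>Field r. \<forall>y\<in>Field r. (x, y) \<in> r \<longleftrightarrow> f x \<subseteq> f y)"
proof -
  let ?E = "hasse_edges r"
  have mF: "m \<in> Field r" and mmax: "\<And>q. (m, q) \<in> r \<Longrightarrow> q = m" using m by (auto simp: maximal_in_def)
  define emb where "emb S f \<longleftrightarrow> f m = M \<and> (\<forall>x\<in>S - {m}. f x \<in> R (\<rho> x) \<and> f x \<notin> \<Y>) \<and>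
    (\<forall>x\<in>S. \<forall>y\<in>S. (x, y) \<in> r \<longleftrightarrow> f x \<subseteq> f y)" for S f
  have "\<exists>f. emb (Field r) f"
    if "S \<subseteq> Field r" "m \<in> S" "\<forall>x\<in>S. (m, x) \<in> (?E \<inter> S \<times> S)\<^sup>*" "emb S f" for S f
    using that
  proof (induction "card (Field r - S)" arbitrary: S f rule: less_induct)
    case less
    note S = less.prems(1) and mS = less.prems(2) and connm = less.prems(3) and emb = less.prems(4)
    show ?case
    proof (cases "S = Field r")
      case True
      then show ?thesis using emb by blast
    next
      case False
      then obtain v where v: "v \<in> Field r" "v \<notin> S" using S by blast
      have "(m, v) \<in> ?E\<^sup>*" using T mF v by (auto simp: tree_poset_def tree_graph_def)
      from rtrancl_exit[OF this mS v(2)] obtain a b where a: "a \<in> S" and b: "b \<notin> S" and ab: "(a, b) \<in> ?E"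
        by blast
      have bF: "b \<in> Field r" using hasse_edges_Field[OF ab] by simp
      have bm: "b \<noteq> m" "a \<noteq> b" using a b mS by auto
      have symS: "sym (?E \<inter> S \<times> S)" using sym_hasse_edges[of r] by (auto simp: sym_def)
      have conn: "(x, y) \<in> (?E \<inter> S \<times> S)\<^sup>*" if "x \<in> S" "y \<in> S" for x y
        using connm that sym_rtrancl[OF symS] by (meson rtrancl_trans symD)
      have att: "(x, b) \<in> r \<longleftrightarrow> (x, a) \<in> r \<and> (a, b) \<in> r" "(b, x) \<in> r \<longleftrightarrow> (b, a) \<in> r \<and> (a, x) \<in> r"
        if "x \<in> S" for x
        using tree_attach[OF T S _ a b ab that] conn by blast+
      have cmp: "(a, b) \<in> r \<or> (b, a) \<in> r" using ab by (auto simp: hasse_edges_def covers_def)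
      have fin: "finite S" "card S \<le> card (Field r)"
        using S poset_finite[OF T] by (auto intro: finite_subset card_mono)
      have fm: "f m = M" and fR: "\<And>x. x \<in> S \<Longrightarrow> x \<noteq> m \<Longrightarrow> f x \<in> R (\<rho> x) \<and> f x \<notin> \<Y>"
        and fr: "\<And>x y. x \<in> S \<Longrightarrow> y \<in> S \<Longrightarrow> (x, y) \<in> r \<longleftrightarrow> f x \<subseteq> f y"
        using emb by (auto simp: emb_def)
      have fG: "f x \<in> G" if "x \<in> S" "x \<noteq> m" for x
        using fR[OF that] R[OF rank_le] S that by blast
      have "\<exists>B\<in>R (\<rho> b). B \<notin> \<Y> \<and> (\<forall>x\<in>S. ((x, b) \<in> r \<longleftrightarrow> f x \<subseteq> B) \<and> ((b, x) \<in> r \<longleftrightarrow> B \<subseteq> f x))"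
      proof (cases "a = m")
        case True
        \<comment> \<open>By maximality of \<open>m\<close> the edge goes downwards, and by
          \<open>att\<close> no other element of \<open>S\<close> is comparable to \<open>b\<close>.
          So \<open>B\<close> has to lie below \<open>M\<close> and be incomparable to all other
          images, as \<open>top\<close> provides.\<close>
        have "(m, b) \<notin> r" using mmax bm by blast
        then have bmr: "(b, m) \<in> r" using cmp True by blast
        have sub: "f ` (S - {m}) \<union> \<Y> \<subseteq> G" using fG Y by auto
        have "card (f ` (S - {m}) \<union> \<Y>) \<le> card (f ` (S - {m})) + card \<Y>" by (rule card_Un_le)
        also have "card (f ` (S - {m})) \<le> card (S - {m})" using fin by (intro card_image_le) simp
        also have "card (S - {m}) \<le> card S" using fin by (intro card_mono) auto
        finally have "card (f ` (S - {m}) \<union> \<Y>) \<le> card (Field r) + 1" using fin Y by simp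
        moreover have "finite (f ` (S - {m}) \<union> \<Y>)" using fin Y by simp
        ultimately obtain B where B: "B \<in> R (\<rho> b)" "B \<subset> M"
          and incB: "\<forall>Z\<in>f ` (S - {m}) \<union> \<Y>. \<not> Z \<subseteq> B \<and> \<not> B \<subseteq> Z"
          using top[OF rank_le[OF bF bm(1)] _ _ sub] by blast
        note inc = bspec[OF incB]
        have "B \<notin> \<Y>" using inc[of B] by blast
        moreover have "((x, b) \<in> r \<longleftrightarrow> f x \<subseteq> B) \<and> ((b, x) \<in> r \<longleftrightarrow> B \<subseteq> f x)" if x: "x \<in> S" for x
        proof (cases "x = m")
          case True
          then show ?thesis using B(2) fm bmr \<open>(m, b) \<notin> r\<close> by blast
        next
          case False
          have "(x, b) \<notin> r" "(b, x) \<notin> r"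
            using att[OF x] \<open>a = m\<close> \<open>(m, b) \<notin> r\<close> mmax False by blast+
          then show ?thesis using inc[of "f x"] x False by blast
        qed
        ultimately show ?thesis using B(1) by blast
      next
        case False
        have sub: "f ` S \<union> \<Y> \<subseteq> insert M G" using fG fm Y by blast
        have "card (f ` S \<union> \<Y>) \<le> card (f ` S) + card \<Y>" by (rule card_Un_le)
        also have "card (f ` S) \<le> card S" using fin by (intro card_image_le) simp
        finally have cd: "card (f ` S \<union> \<Y>) \<le> card (Field r) + 1" using fin Y by simp
        have fa: "f a \<in> R (\<rho> a)" "f a \<notin> \<Y>" using fR[OF a False] by auto
        \<comment> \<open>Neither end of the edge is \<open>m\<close>, so the ranks determine its
          direction and \<open>step\<close> produces the inclusion the right way round.\<close>
        have rho: "(a, b) \<in> r \<longleftrightarrow> \<rho> a < \<rho> b" "(b, a) \<in> r \<longleftrightarrow> \<rho> b < \<rho> a"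
          using cmp rank[of a b] rank[of b a] bm False by auto
        then have "\<rho> a \<noteq> \<rho> b" using cmp by auto
        moreover have "finite (f ` S \<union> \<Y>)" using fin Y by simp
        moreover have "a \<in> Field r" using a S by blast
        ultimately obtain B where B: "B \<in> R (\<rho> b)"
          "\<rho> a < \<rho> b \<longrightarrow> f a \<subset> B" "\<rho> b < \<rho> a \<longrightarrow> B \<subset> f a" and aB: "attaches (f ` S \<union> \<Y>) (f a) B"
          using step[OF fa(1) rank_le[OF _ False] rank_le[OF bF bm(1)] _ _ cd sub] by blast
        have ABr: "(a, b) \<in> r \<longleftrightarrow> f a \<subseteq> B" "(b, a) \<in> r \<longleftrightarrow> B \<subseteq> f a"
          using B(2,3) rho \<open>\<rho> a \<noteq> \<rho> b\<close> by auto
        have neB: "B \<noteq> f a" using B(2,3) \<open>\<rho> a \<noteq> \<rho> b\<close> by auto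
        have "B \<notin> \<Y>"
        proof
          assume "B \<in> \<Y>"
          \<comment> \<open>Taking \<open>B\<close> itself as one of the sets to be respected would
            force \<open>B\<close> to equal \<open>f a\<close>; hence listing \<Y> among these sets
            keeps \<open>B\<close> out of it.\<close>
          then have "B \<subseteq> B \<longleftrightarrow> B \<subseteq> f a \<and> f a \<subseteq> B" using aB neB unfolding attaches_def by blast
          then show False using neB by blast
        qed
        moreover have "((x, b) \<in> r \<longleftrightarrow> f x \<subseteq> B) \<and> ((b, x) \<in> r \<longleftrightarrow> B \<subseteq> f x)" if x: "x \<in> S" for x
        proof (cases "x = a")
          case True
          then show ?thesis using ABr by simp
        next
          case False
          then have "f x \<noteq> f a" using fr[OF x a] fr[OF a x] poset_antisym[OF T] by blast
          then have "(f x \<subseteq> B \<longleftrightarrow> f x \<subseteq> f a \<and> f a \<subseteq> B) \<and> (B \<subseteq> f x \<longleftrightarrow> f a \<subseteq> f x \<and> B \<subseteq> f a)"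
            using aB x unfolding attaches_def by blast
          then show ?thesis using att[OF x] ABr fr[OF x a] fr[OF a x] by blast
        qed
        ultimately show ?thesis using B(1) by blast
      qed
      then obtain B where B: "B \<in> R (\<rho> b)" "B \<notin> \<Y>"
        "\<And>x. x \<in> S \<Longrightarrow> ((x, b) \<in> r \<longleftrightarrow> f x \<subseteq> B) \<and> ((b, x) \<in> r \<longleftrightarrow> B \<subseteq> f x)" by blast
      let ?S = "insert b S" and ?f = "f(b := B)"
      have "?S \<subseteq> Field r" "m \<in> ?S" using bF S mS by auto
      moreover have "\<forall>x\<in>?S. (m, x) \<in> (?E \<inter> ?S \<times> ?S)\<^sup>*"
      proof -
        have old: "(m, x) \<in> (?E \<inter> ?S \<times> ?S)\<^sup>*" if "x \<in> S" for x
          using connm that rtrancl_mono[of "?E \<inter> S \<times> S" "?E \<inter> ?S \<times> ?S"] by blast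
        moreover have "(a, b) \<in> ?E \<inter> ?S \<times> ?S" using ab a by blast
        ultimately have "(m, b) \<in> (?E \<inter> ?S \<times> ?S)\<^sup>*" using a by (meson rtrancl.rtrancl_into_rtrancl)
        then show ?thesis using old by blast
      qed
      moreover have "emb ?S ?f"
        unfolding emb_def using bm(1) fm fR fr B b poset_refl[OF T bF] by auto
      moreover have "card (Field r - ?S) < card (Field r - S)"
        by (rule psubset_card_mono) (use poset_finite[OF T] bF b in auto)
      ultimately show ?thesis using less.hyps by blast
    qed
  qed
  from this[of "{m}" "\<lambda>_. M"] obtain f where f: "emb (Field r) f"
    using mF poset_refl[OF T mF] by (auto simp: emb_def)
  then show ?thesis using R rank_le unfolding emb_def by blast
qed

section \<open>Embedding into large families\<close>

text \<open>Since (n choose j)(j choose h) = (n choose h)(n - h choose j - h), the quotient of (n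
  choose j) by (n choose h) is (n - h choose j - h)/(j choose j - h), to which the ratio bound
  applies.\<close>

lemma binomial_tail:
  assumes "h \<le> j" "j \<le> n" "n - h \<le> j"
  shows "(n choose j) * j ^ (j - h) \<le> (n choose h) * (n - h) ^ (j - h)"
proof -
  let ?z = "j - h"
  have eq: "j choose ?z = j choose h" using assms(1) by (metis binomial_symmetric)
  have pos: "0 < j choose h" using assms(1) by simp
  have "(n choose j) * j ^ ?z * (j choose h) = (n choose h) * ((n - h choose ?z) * j ^ ?z)"
    using choose_mult[OF assms(1,2)] by (simp add: ac_simps)
  also have "\<dots> \<le> (n choose h) * ((j choose ?z) * (n - h) ^ ?z)"
    by (rule mult_left_mono[OF binomial_ratio_le]) (use assms in auto)
  also have "\<dots> = (n choose h) * (n - h) ^ ?z * (j choose h)" by (simp add: eq ac_simps)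
  finally show ?thesis using pos by (simp only: mult_le_cancel2)
qed

text \<open>Above the band the base in \<open>binomial_tail\<close> is at most (h + 1)/(h + 1 + d)
  and the exponent exceeds \<open>d\<close>; below the band, the symmetry of binomial coefficients
  reduces to this case.\<close>

lemma binomial_outside_middle:
  fixes \<theta> :: real
  assumes h: "h = n div 2" and j: "j \<le> n" "j < h - d \<or> h + d < j"
    and \<theta>: "real (h + 1) / real (h + 1 + d) \<le> \<theta>" "\<theta> \<le> 1"
  shows "real (n choose j) \<le> \<theta> ^ d * real (n choose h)"
proof -
  have \<theta>0: "0 \<le> \<theta>" using \<theta>(1) by (rule order_trans[rotated]) simp
  have upper: "real (n choose i) \<le> \<theta> ^ d * real (n choose h)" if i: "i \<le> n" "h + 1 + d \<le> i" for i
  proof -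
    let ?z = "i - h"
    have nh: "n - h \<le> h + 1" using h by linarith
    have "real ((n choose i) * i ^ ?z) \<le> real ((n choose h) * (n - h) ^ ?z)"
      by (rule of_nat_mono[OF binomial_tail]) (use i nh in auto)
    then have "real (n choose i) \<le> real (n choose h) * (real (n - h) / real i) ^ ?z"
      using i by (simp add: power_divide field_simps)
    moreover have "real (n - h) / real i \<le> real (h + 1) / real (h + 1 + d)"
      using i nh by (intro frac_le) auto
    moreover from this have "(real (n - h) / real i) ^ ?z \<le> \<theta> ^ ?z"
      using \<theta> by (intro power_mono) auto
    moreover have "\<theta> ^ ?z \<le> \<theta> ^ d"
      using \<theta>(2) \<theta>0 i by (intro power_decreasing) auto
    ultimately have "real (n choose i) \<le> real (n choose h) * (real (n - h) / real i) ^ ?z"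
      "(real (n - h) / real i) ^ ?z \<le> \<theta> ^ d" by linarith+
    from order_trans[OF this(1) mult_left_mono[OF this(2)]] show ?thesis by (simp add: mult.commute)
  qed
  show ?thesis
  proof (cases "h + d < j")
    case True
    then show ?thesis using upper[of j] j by simp
  next
    case False
    then have "h + 1 + d \<le> n - j" using j h by linarith
    then show ?thesis using upper[of "n - j"] j binomial_symmetric[of j n] by simp
  qed
qed

lemma card_outside_middle:
  fixes \<theta> :: real
  assumes F: "F \<subseteq> Pow {1..n}" and h: "h = n div 2"
    and \<theta>: "real (h + 1) / real (h + 1 + d) \<le> \<theta>" "\<theta> \<le> 1"
  shows "real (card {A \<in> F. card A < h - d \<or> h + d < card A}) \<le> real (n + 1) * (\<theta> ^ d * (n choose h))"
proof -
  let ?J = "{j. j \<le> n \<and> (j < h - d \<or> h + d < j)}"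
  let ?B = "\<lambda>j. {A. A \<subseteq> {1..n} \<and> card A = j}"
  have finJ: "finite ?J" by (rule finite_subset[of _ "{..n}"]) auto
  have finB: "finite (?B j)" for j by (rule finite_subset[of _ "Pow {1..n}"]) auto
  have "\<theta> \<ge> 0" using \<theta>(1) by (rule order_trans[rotated]) simp
  have "card {A \<in> F. card A < h - d \<or> h + d < card A} \<le> card (\<Union>j\<in>?J. ?B j)"
  proof (rule card_mono)
    show "finite (\<Union>j\<in>?J. ?B j)" using finJ finB by blast
    show "{A \<in> F. card A < h - d \<or> h + d < card A} \<subseteq> (\<Union>j\<in>?J. ?B j)"
    proof
      fix A assume A: "A \<in> {A \<in> F. card A < h - d \<or> h + d < card A}"
      then have sub: "A \<subseteq> {1..n}" using F by auto
      then have "card A \<le> n" using card_mono[of "{1..n}" A] by simp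
      then show "A \<in> (\<Union>j\<in>?J. ?B j)" using A sub by blast
    qed
  qed
  also have "\<dots> \<le> (\<Sum>j\<in>?J. card (?B j))" by (rule card_UN_le[OF finJ])
  also have "\<dots> = (\<Sum>j\<in>?J. n choose j)" using n_subsets[of "{1..n}"] by simp
  finally have "real (card {A \<in> F. card A < h - d \<or> h + d < card A}) \<le> real (\<Sum>j\<in>?J. n choose j)"
    by (rule of_nat_mono)
  also have "\<dots> = (\<Sum>j\<in>?J. real (n choose j))" by simp
  also have "\<dots> \<le> (\<Sum>j\<in>?J. \<theta> ^ d * (n choose h))"
    by (rule sum_mono, rule binomial_outside_middle[OF h _ _ \<theta>]) auto
  also have "\<dots> = card ?J * (\<theta> ^ d * (n choose h))" by simp
  also have "\<dots> \<le> real (n + 1) * (\<theta> ^ d * (n choose h))"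
  proof (rule mult_right_mono)
    have "card ?J \<le> card {..n}" by (rule card_mono) auto
    then show "real (card ?J) \<le> real (n + 1)" by simp
    show "0 \<le> \<theta> ^ d * (n choose h)" using \<open>\<theta> \<ge> 0\<close> by simp
  qed
  finally show ?thesis .
qed

text \<open>The weighting of the LYM inequality: a set of size a lies on n!/(n choose a) chains,
  which is smallest on the middle level.\<close>

lemma sum_card_through_ge:
  fixes x :: real
  assumes F: "F \<subseteq> Pow {1..n}" and big: "x * (n choose (n div 2)) \<le> card F"
  shows "x * fact n \<le> real (\<Sum>A\<in>F. card (through n A))"
proof -
  let ?C = "real (n choose (n div 2))"
  have C0: "0 < ?C" using zero_less_binomial[of "n div 2" n] by simp
  have "x * fact n = x * ?C * (fact n / ?C)"
  proof -
    have "x * y = x * c * (y / c)" if "0 < c" for c y :: real using that by simp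
    then show ?thesis using C0 .
  qed
  also have "\<dots> \<le> card F * (fact n / ?C)" using big by (intro mult_right_mono) auto
  also have "\<dots> = (\<Sum>A\<in>F. fact n / ?C)" by simp
  also have "\<dots> \<le> (\<Sum>A\<in>F. real (card (through n A)))"
  proof (rule sum_mono)
    fix A assume "A \<in> F"
    then have "card (through n A) * (n choose card A) = fact n" using F by (intro card_through) auto
    then have "fact n \<le> card (through n A) * (n choose (n div 2))"
      using binomial_maximum[of n "card A"] by (metis mult_le_mono2)
    then have "real (fact n) \<le> real (card (through n A) * (n choose (n div 2)))" by (rule of_nat_mono)
    then show "fact n / ?C \<le> real (card (through n A))" by (simp only: pos_divide_le_eq[OF C0] of_nat_mult of_nat_fact)
  qed
  finally show ?thesis by simp
qed

lemma embed_in_layers: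
  fixes r :: "'a rel" and \<epsilon> :: real and k :: nat
  assumes T: "tree_poset r" and m: "maximal_in r m"
    and rank: "\<And>x y. (x, y) \<in> r \<Longrightarrow> x \<noteq> y \<Longrightarrow> x \<noteq> m \<Longrightarrow> y \<noteq> m \<Longrightarrow> \<rho> x < \<rho> y"
    and rank_le: "\<And>x. x \<in> Field r \<Longrightarrow> x \<noteq> m \<Longrightarrow> \<rho> x \<le> k"
    and lay: "layered_family n l u L q F" and t: "t = card (Field r) + 1"
    and e: "0 < \<epsilon>" and big: "(k + \<epsilon>) * fact n \<le> real (\<Sum>A\<in>F. card (through n A))"
    and small: "real ((k + 1)\<^sup>2) * (real (t * (2 * (L - l))) / q) \<le> \<epsilon> / (2 * (k + \<epsilon>))"
    and tiny: "real (n + 1) * (2 * t * (u / L) ^ l) < \<epsilon> / 2"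
  shows "\<exists>M\<subseteq>{1..n}. \<forall>Y. \<exists>f. f m = M \<and> (\<forall>x\<in>Field r - {m}. f x \<in> F - {Y}) \<and>
    (\<forall>x\<in>Field r. \<forall>y\<in>Field r. (x, y) \<in> r \<longleftrightarrow> f x \<subseteq> f y)"
proof -
  interpret layered_family n k l u L q F by (rule lay)
  from ex_rich_windows[OF e big small] obtain W where W: "W \<subseteq> windows" "\<epsilon> / 2 * fact n \<le> card W"
    and rich: "\<forall>w\<in>W. \<forall>i\<le>k. \<forall>j\<le>k. i \<noteq> j \<longrightarrow> (\<forall>\<Z>. small_sets t \<Z> \<longrightarrow>
      (\<exists>w'\<in>W. mark w' i = mark w i \<and> attaches \<Z> (mark w i) (mark w' j)))"
    by (elim exE conjE) (rule that)
  from ex_top_set[OF W(1) e W(2) tiny] obtain M where M: "M \<subseteq> {1..n}" "card M = L"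
    and top: "\<forall>j\<le>k. \<forall>\<Z>. finite \<Z> \<and> card \<Z> \<le> t \<and>
      (\<forall>Z\<in>\<Z>. Z \<subseteq> {1..n} \<and> l \<le> card Z \<and> card Z \<le> u) \<longrightarrow>
      (\<exists>w\<in>W. mark w j \<subset> M \<and> (\<forall>Z\<in>\<Z>. \<not> Z \<subseteq> mark w j \<and> \<not> mark w j \<subseteq> Z))"
    by (elim exE conjE) (rule that)
  let ?R = "\<lambda>j. (\<lambda>w. mark w j) ` W"
  \<comment> \<open>The set \<open>Y\<close> is arbitrary, whereas \<open>embed_tree\<close> wants
    the avoided sets inside the family; hence the intersection with \<open>F\<close>.\<close>
  have "\<exists>f. f m = M \<and> (\<forall>x\<in>Field r - {m}. f x \<in> F - ({Y} \<inter> F)) \<and>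
    (\<forall>x\<in>Field r. \<forall>y\<in>Field r. (x, y) \<in> r \<longleftrightarrow> f x \<subseteq> f y)" for Y
  proof (rule embed_tree[OF T m, where k = k and R = ?R and \<rho> = \<rho>])
    show "(\<lambda>w. mark w j) ` W \<subseteq> F" if "j \<le> k" for j using that W(1) mark_in_F by blast
    show "\<not> M \<subseteq> Z" if "Z \<in> F" for Z
    proof
      assume "M \<subseteq> Z"
      moreover have "finite Z" using F[OF that] finite_subset by blast
      ultimately have "card M \<le> card Z" by (rule card_mono[rotated])
      then show False using F[OF that] M(2) uL by simp
    qed
    show "card ({Y} \<inter> F) \<le> 1" using card_mono[of "{Y}" "{Y} \<inter> F"] by simp
    show "\<exists>B\<in>?R j. (i < j \<longrightarrow> A \<subset> B) \<and> (j < i \<longrightarrow> B \<subset> A) \<and> attaches \<Z> A B"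
      if A: "A \<in> ?R i" and ij: "i \<le> k" "j \<le> k" "i \<noteq> j" and Z: "finite \<Z>" "card \<Z> \<le> card (Field r) + 1"
        "\<Z> \<subseteq> insert M F" for A i j \<Z>
    proof -
      obtain w where w: "w \<in> W" "A = mark w i" using A by blast
      have "Z \<subseteq> {1..n} \<and> l \<le> card Z \<and> card Z \<le> L" if "Z \<in> \<Z>" for Z
      proof (cases "Z = M")
        case True
        then show ?thesis using M lu uL by simp
      next
        case False
        then have "Z \<in> F" using that Z(3) by blast
        then show ?thesis using F[of Z] uL by simp
      qed
      then have "small_sets t \<Z>" using Z by (simp add: small_sets_def t)
      with rich w(1) ij have "\<exists>w'\<in>W. mark w' i = mark w i \<and> attaches \<Z> (mark w i) (mark w' j)"
        by simp
      then obtain w' where w': "w' \<in> W" "mark w' i = A" "attaches \<Z> A (mark w' j)"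
        using w(2) by auto
      have "w' \<in> windows" using w' W(1) by blast
      then show ?thesis using w' mark_psubset[of w' i j] mark_psubset[of w' j i] ij
        by (intro bexI[of _ "mark w' j"]) auto
    qed
    show "\<exists>B\<in>?R j. B \<subset> M \<and> (\<forall>Z\<in>\<Z>. \<not> Z \<subseteq> B \<and> \<not> B \<subseteq> Z)"
      if "j \<le> k" "finite \<Z>" "card \<Z> \<le> card (Field r) + 1" "\<Z> \<subseteq> F" for j \<Z>
    proof -
      have "\<forall>Z\<in>\<Z>. Z \<subseteq> {1..n} \<and> l \<le> card Z \<and> card Z \<le> u" using that(4) F by blast
      then show ?thesis using top that by (simp add: t)
    qed
  qed (use rank rank_le in auto)
  then show ?thesis using M(1) by (intro exI[of _ M]) (simp add: Diff_Int_distrib Diff_Int)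
qed

section \<open>Choice of the parameters for large \<open>n\<close>\<close>

lemma filterlim_div_at_top: "0 < s \<Longrightarrow> filterlim (\<lambda>n::nat. n div s) at_top at_top"
  unfolding filterlim_at_top
proof
  fix Z :: nat
  assume "0 < s"
  then have "Z \<le> n div s" if "s * Z \<le> n" for n
    using div_le_mono[OF that, of s] by simp
  then show "\<forall>\<^sub>F n in at_top. Z \<le> n div s"
    by (rule eventually_mono[OF eventually_ge_at_top])
qed

lemma eventually_times_power_less:
  fixes \<theta> \<eta> :: real
  assumes "0 < s" "0 \<le> \<theta>" "\<theta> < 1" "0 < \<eta>"
  shows "\<forall>\<^sub>F n in sequentially. real (n div s) * \<theta> ^ (n div s) < \<eta>"
proof -
  have "(\<lambda>d. real d * \<theta> ^ d) \<longlonglongrightarrow> 0" using powser_times_n_limit_0[of \<theta>] assms by simp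
  then have "\<forall>\<^sub>F d in sequentially. real d * \<theta> ^ d < \<eta>" using assms(4) by (rule order_tendstoD)
  then show ?thesis
    using filterlim_div_at_top[OF assms(1)] by (auto simp: filterlim_iff)
qed

lemma eventually_embed_tree:
  fixes r :: "'a rel" and \<epsilon> :: real and k :: nat
  assumes T: "tree_poset r" and m: "maximal_in r m"
    and rank: "\<And>x y. (x, y) \<in> r \<Longrightarrow> x \<noteq> y \<Longrightarrow> x \<noteq> m \<Longrightarrow> y \<noteq> m \<Longrightarrow> \<rho> x < \<rho> y"
    and rank_le: "\<And>x. x \<in> Field r \<Longrightarrow> x \<noteq> m \<Longrightarrow> \<rho> x \<le> k"
    and e: "0 < \<epsilon>"
  shows "\<forall>\<^sub>F n in sequentially. \<forall>F\<subseteq>Pow {1..n}. (k + \<epsilon>) * (n choose (n div 2)) \<le> card F \<longrightarrow>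
    (\<exists>M\<subseteq>{1..n}. \<forall>Y. \<exists>f. f m = M \<and> (\<forall>x\<in>Field r - {m}. f x \<in> F - {Y}) \<and>
      (\<forall>x\<in>Field r. \<forall>y\<in>Field r. (x, y) \<in> r \<longleftrightarrow> f x \<subseteq> f y))"
proof -
  define t where "t = card (Field r) + 1"
  \<comment> \<open>Half of the excess \<epsilon> pays for discarding the members of
    \<open>F\<close> outside the middle band.\<close>
  define \<delta> where "\<delta> = \<epsilon> / 2"
  have d0: "0 < \<delta>" using e by (simp add: \<delta>_def)
  \<comment> \<open>With \<open>L - l = 3 * d\<close> and \<open>q = c * d\<close> the cleaning
    costs the proportion (k + 1)^2 * 6t/c; \<open>c\<close> is taken large enough to bring it down
    to \<delta>/(2(k + \<delta>)).\<close>
  obtain c0 :: nat where c0: "real ((k + 1)\<^sup>2) * (6 * t) * (2 * (k + \<delta>)) / \<delta> \<le> real c0"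
    using real_nat_ceiling_ge by blast
  define c where "c = c0 + 1"
  \<comment> \<open>For \<open>d = n div s\<close> this gives \<open>(c + 1) * d \<le> h\<close>, so
    that \<open>l\<close> and \<open>n - u\<close> are both at least \<open>c * d\<close>.\<close>
  define s where "s = 2 * (c + 1)"
  \<comment> \<open>One base for both exponential estimates: \<open>h + 1 \<le> s * d\<close> bounds
    (h + 1)/(h + 1 + d) as well as u/L by it.\<close>
  define \<theta> where "\<theta> = (s + 1) / real (s + 2)"
  have c: "1 \<le> c" and c_ge: "real ((k + 1)\<^sup>2) * (6 * t) * (2 * (k + \<delta>)) / \<delta> \<le> c"
    using c0 by (auto simp: c_def)
  have s0: "0 < s" by (simp add: s_def)
  have \<theta>: "0 \<le> \<theta>" "\<theta> < 1" by (simp_all add: \<theta>_def)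
  have t0: "0 < t" by (simp add: t_def)
  \<comment> \<open>From \<open>n + 1 \<le> 2 * s * d\<close>, the quantity to be kept below
    \<delta>/2 in \<open>tiny\<close> is at most 4st times d \<theta>^d, hence the 8 here. In
    \<open>ev2\<close> the quantity to be kept within \<delta> is 2s times d \<theta>^d.\<close>
  have ev1: "\<forall>\<^sub>F n in sequentially. real (n div s) * \<theta> ^ (n div s) < \<delta> / (8 * s * t)"
    using s0 t0 d0 by (intro eventually_times_power_less[OF s0 \<theta>]) simp
  have ev2: "\<forall>\<^sub>F n in sequentially. real (n div s) * \<theta> ^ (n div s) < \<delta> / (2 * s)"
    using s0 d0 by (intro eventually_times_power_less[OF s0 \<theta>]) simp
  show ?thesis
    using ev1 ev2 eventually_ge_at_top[of s]
  proof eventually_elim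
    case (elim n)
    define d where "d = n div s"
    define h where "h = n div 2"
    define l where "l = h - d"
    define u where "u = h + d"
    define L where "L = h + 2 * d"
    have d1: "1 \<le> d" using elim(3) s0 by (simp add: d_def div_greater_zero_iff Suc_le_eq)
    have "s * d \<le> n" by (simp add: d_def)
    then have h_ge: "(c + 1) * d \<le> h"
      by (simp add: h_def s_def less_eq_div_iff_mult_less_eq)
    have "n < s * (d + 1)" using s0 by (simp add: d_def dividend_less_times_div)
    then have "n < 2 * ((c + 1) * (d + 1))" by (simp add: s_def algebra_simps)
    then have "h + 1 \<le> (c + 1) * (d + 1)" by (simp add: h_def) 
    also have "\<dots> \<le> (c + 1) * (2 * d)" using d1 by (intro mult_left_mono) auto
    finally have h_le: "h + 1 \<le> s * d" by (simp add: s_def algebra_simps)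
    have n_le: "n + 1 \<le> 2 * s * d"
    proof -
      have "n + 1 \<le> s * (d + 1)" using \<open>n < s * (d + 1)\<close> by simp
      also have "\<dots> \<le> s * (2 * d)" using d1 by (intro mult_left_mono) auto
      finally show ?thesis by (simp add: ac_simps)
    qed
    have nh: "2 * h \<le> n" by (simp add: h_def)
    have d_le: "d \<le> c * d" using c by simp
    have l_ge: "c * d \<le> l" using h_ge by (simp add: l_def)
    have Ll: "L - l = 3 * d" using h_ge by (simp add: L_def l_def)
    have \<theta>1: "real (h + 1) / real (h + 1 + d) \<le> \<theta>"
    proof -
      have "real (h + 1) * real (s + 2) \<le> real (s + 1) * real (h + 1 + d)"
      proof -
        have "(h + 1) * (s + 2) \<le> (s + 1) * (h + 1 + d)" using h_le by (simp add: algebra_simps)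
        then show ?thesis by (metis of_nat_le_iff of_nat_mult)
      qed
      then show ?thesis by (simp add: \<theta>_def frac_le_eq divide_simps)
    qed
    have \<theta>2: "real u / real L \<le> \<theta>"
    proof -
      have "u * (s + 2) \<le> (s + 1) * L" using h_le by (simp add: u_def L_def algebra_simps)
      then have "real u * real (s + 2) \<le> real (s + 1) * real L" by (metis of_nat_le_iff of_nat_mult)
      then show ?thesis using d1 by (simp add: \<theta>_def L_def divide_simps)
    qed
    have tiny: "real (n + 1) * (2 * t * (u / L) ^ l) < \<delta> / 2"
    proof -
      have "(real u / L) ^ l \<le> \<theta> ^ l" using \<theta>2 by (intro power_mono) auto
      also have "\<dots> \<le> \<theta> ^ d" using \<theta> order_trans[OF d_le l_ge] by (intro power_decreasing) auto
      finally have *: "2 * t * (real u / L) ^ l \<le> 2 * t * \<theta> ^ d" by (rule mult_left_mono) simp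
      have "real (n + 1) \<le> real (2 * s * d)" using n_le by linarith
      then have "real (n + 1) * (2 * t * (real u / L) ^ l) \<le> real (2 * s * d) * (2 * t * \<theta> ^ d)"
        by (rule mult_mono[OF _ *]) auto
      also have "\<dots> = 4 * s * t * (real d * \<theta> ^ d)" by simp
      also have "\<dots> < 4 * s * t * (\<delta> / (8 * s * t))"
        using elim(1) s0 t0 unfolding d_def by (intro mult_strict_left_mono) auto
      also have "\<dots> = \<delta> / 2" using s0 t0 by simp
      finally show ?thesis by simp
    qed
    have small: "real ((k + 1)\<^sup>2) * (real (t * (2 * (L - l))) / real (c * d)) \<le> \<delta> / (2 * (k + \<delta>))"
    proof -
      have "real (t * (2 * (3 * d))) / real (c * d) = 6 * t / c" using d1 c by (simp add: field_simps)
      moreover have "real ((k + 1)\<^sup>2) * (6 * t / c) \<le> \<delta> / (2 * (k + \<delta>))"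
        using c_ge c d0 by (simp add: field_simps)
      ultimately show ?thesis by (simp only: Ll)
    qed
    show ?case
    proof (intro allI impI)
      fix F assume F: "F \<subseteq> Pow {1..n}" and big: "(k + \<epsilon>) * (n choose (n div 2)) \<le> card F"
      define F' where "F' = {A \<in> F. l \<le> card A \<and> card A \<le> u}"
      have finF: "finite F" using F finite_subset by blast
      have "F = F' \<union> {A \<in> F. card A < h - d \<or> h + d < card A}"
        by (auto simp: F'_def l_def u_def)
      then have "card F \<le> card F' + card {A \<in> F. card A < h - d \<or> h + d < card A}"
        by (metis card_Un_le)
      then have "real (card F) \<le> card F' + real (card {A \<in> F. card A < h - d \<or> h + d < card A})"
        by linarith
      also have "\<dots> \<le> card F' + real (n + 1) * (\<theta> ^ d * (n choose h))"
        using card_outside_middle[OF F h_def \<theta>1] \<theta> by simp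
      also have "real (n + 1) * (\<theta> ^ d * (n choose h)) \<le> \<delta> * (n choose h)"
      proof -
        have "real (n + 1) * \<theta> ^ d \<le> real (2 * s * d) * \<theta> ^ d"
        proof (rule mult_right_mono)
          show "real (n + 1) \<le> real (2 * s * d)" using n_le by linarith
        qed (use \<theta> in simp)
        also have "\<dots> = 2 * s * (real d * \<theta> ^ d)" by simp
        also have "\<dots> \<le> 2 * s * (\<delta> / (2 * s))"
          using elim(2) s0 unfolding d_def by (intro mult_left_mono) auto
        also have "\<dots> = \<delta>" using s0 by simp
        finally have "real (n + 1) * \<theta> ^ d * (n choose h) \<le> \<delta> * (n choose h)"
          by (rule mult_right_mono) simp
        then show ?thesis by (simp add: ac_simps)
      qed
      finally have "(k + \<delta>) * (n choose (n div 2)) \<le> card F'"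
        using big by (simp add: h_def \<delta>_def algebra_simps)
      moreover have F'sub: "F' \<subseteq> Pow {1..n}" using F by (auto simp: F'_def)
      ultimately have big': "(k + \<delta>) * fact n \<le> real (\<Sum>A\<in>F'. card (through n A))"
        by (intro sum_card_through_ge)
      have lay: "layered_family n l u L (c * d) F'"
      proof
        show "A \<subseteq> {1..n} \<and> l \<le> card A \<and> card A \<le> u" if "A \<in> F'" for A
          using that F by (auto simp: F'_def)
        show "l \<le> u" "u < L" using d1 by (auto simp: l_def u_def L_def)
        have "2 * d \<le> h" using h_ge d_le unfolding add_mult_distrib by linarith
        then show "L \<le> n" using nh by (simp add: L_def)
        show "0 < c * d" "c * d \<le> l" using c d1 l_ge by auto
        show "c * d + u \<le> n" using h_ge nh by (simp add: u_def)
      qed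
      have tiny': "real (n + 1) * (2 * real t * (u / L) ^ l) < \<delta> / 2" using tiny by simp
      have "\<exists>M\<subseteq>{1..n}. \<forall>Y. \<exists>f. f m = M \<and> (\<forall>x\<in>Field r - {m}. f x \<in> F' - {Y}) \<and>
        (\<forall>x\<in>Field r. \<forall>y\<in>Field r. (x, y) \<in> r \<longleftrightarrow> f x \<subseteq> f y)"
      proof (rule embed_in_layers[OF T m _ _ lay t_def d0 big' small tiny', where \<rho> = \<rho>])
        show "\<rho> x < \<rho> y" if "(x, y) \<in> r" "x \<noteq> y" "x \<noteq> m" "y \<noteq> m" for x y
          using that by (rule rank)
        show "\<rho> x \<le> k" if "x \<in> Field r" "x \<noteq> m" for x
          using that by (rule rank_le)
      qed
      moreover have "F' - {Y} \<subseteq> F - {Y}" for Y by (auto simp: F'_def)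
      ultimately show "\<exists>M\<subseteq>{1..n}. \<forall>Y. \<exists>f. f m = M \<and> (\<forall>x\<in>Field r - {m}. f x \<in> F - {Y}) \<and>
          (\<forall>x\<in>Field r. \<forall>y\<in>Field r. (x, y) \<in> r \<longleftrightarrow> f x \<subseteq> f y)"
        by (meson subsetD)
    qed
  qed
qed

section \<open>Copies, duality and lower bounds\<close>

definition strong_emb :: "'a rel \<Rightarrow> ('a \<Rightarrow> 'b set) \<Rightarrow> bool" where
  "strong_emb r f \<longleftrightarrow> (\<forall>p\<in>Field r. \<forall>q\<in>Field r. (p, q) \<in> r \<longleftrightarrow> f p \<subseteq> f q)"

definition remove_elem :: "'a rel \<Rightarrow> 'a \<Rightarrow> 'a rel" where
  "remove_elem r m = Restr r (Field r - {m})"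

lemma Field_remove_elem: "Partial_order r \<Longrightarrow> Field (remove_elem r m) = Field r - {m}"
  by (fastforce simp: remove_elem_def Field_def partial_order_on_def preorder_on_def refl_on_def)

lemma Partial_order_remove_elem: "Partial_order r \<Longrightarrow> Partial_order (remove_elem r m)"
  unfolding remove_elem_def by (rule Partial_order_Restr)

lemma Pminus_eq: "Pminus r = {remove_elem r m | m. maximal_in r m \<or> minimal_in r m}"
  by (simp add: Pminus_def remove_elem_def)

lemma strong_emb_inj:
  assumes "Partial_order r" "strong_emb r f"
  shows "inj_on f (Field r)"
proof (rule inj_onI)
  fix x y assume "x \<in> Field r" "y \<in> Field r" "f x = f y"
  then have "(x, y) \<in> r" "(y, x) \<in> r" using assms(2) by (auto simp: strong_emb_def)
  then show "x = y" using assms(1) by (auto simp: partial_order_on_def dest: antisymD)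
qed

lemma strong_copy_image: "Partial_order r \<Longrightarrow> strong_emb r f \<Longrightarrow> strong_copy r (f ` Field r)"
  unfolding strong_copy_def using strong_emb_inj[of r f]
  by (intro exI[of _ f]) (auto simp: bij_betw_def strong_emb_def)

lemma strong_copyE:
  assumes "strong_copy r G"
  obtains f where "strong_emb r f" "G = f ` Field r" "inj_on f (Field r)"
  using assms unfolding strong_copy_def strong_emb_def bij_betw_def by blast

lemma strong_emb_remove: "Partial_order r \<Longrightarrow> strong_emb r f \<Longrightarrow> strong_emb (remove_elem r m) f"
  unfolding strong_emb_def by (auto simp: Field_remove_elem) (auto simp: remove_elem_def)

lemma strong_copy_remove:
  assumes "Partial_order r" "strong_emb r f"
  shows "strong_copy (remove_elem r m) (f ` (Field r - {m}))"
  using strong_copy_image[OF Partial_order_remove_elem[OF assms(1)] strong_emb_remove[OF assms]]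
  by (simp add: Field_remove_elem[OF assms(1)])

section \<open>The maxima defining \<open>ar_star\<close> and \<open>La_star\<close>\<close>

definition admissible :: "nat \<Rightarrow> 'a rel \<Rightarrow> (nat set \<Rightarrow> nat) \<Rightarrow> bool" where
  "admissible n r c \<longleftrightarrow> \<not> (\<exists>G\<subseteq>Pow {1..n}. strong_copy r G \<and> inj_on c G)"

definition copy_free :: "'a rel set \<Rightarrow> 'b set set \<Rightarrow> bool" where
  "copy_free R F \<longleftrightarrow> \<not> (\<exists>r\<in>R. \<exists>G\<subseteq>F. strong_copy r G)"

lemma ar_star_alt: "ar_star n r = Max {card (c ` Pow {1..n}) | c. admissible n r c}"
  by (simp add: ar_star_def admissible_def)

lemma La_star_alt: "La_star n R = Max {card F | F. F \<subseteq> Pow {1..n} \<and> copy_free R F}"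
  by (simp add: La_star_def copy_free_def)

lemma finite_ar: "finite {card (c ` Pow {1..n}) | c :: nat set \<Rightarrow> nat. admissible n r c}"
proof (rule finite_subset)
  show "{card (c ` Pow {1..n}) | c :: nat set \<Rightarrow> nat. admissible n r c} \<subseteq> {..card (Pow {1..n})}"
    using card_image_le[of "Pow {1..n}"] by auto
qed simp

lemma finite_La: "finite {card F | F :: nat set set. F \<subseteq> Pow {1..n} \<and> copy_free R F}"
proof (rule finite_subset)
  show "{card F | F :: nat set set. F \<subseteq> Pow {1..n} \<and> copy_free R F} \<subseteq> {..card (Pow {1..n})}"
    using card_mono[of "Pow {1..n}"] by auto
qed simp

lemma ar_star_ge: "admissible n r c \<Longrightarrow> card (c ` Pow {1..n}) \<le> ar_star n r"
  unfolding ar_star_alt by (rule Max_ge[OF finite_ar]) blast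

lemma La_star_ge: "F \<subseteq> Pow {1..n} \<Longrightarrow> copy_free R F \<Longrightarrow> card F \<le> La_star n R"
  unfolding La_star_alt by (rule Max_ge[OF finite_La]) blast

text \<open>The constant colouring makes the set under \<open>Max\<close> nonempty: a copy with two
  or more members is not rainbow.\<close>

lemma ar_star_attained:
  assumes "2 \<le> card (Field r)"
  obtains c where "admissible n r c" "card (c ` Pow {1..n}) = ar_star n r"
proof -
  have "admissible n r (\<lambda>_. 0)"
    unfolding admissible_def
  proof (intro notI, elim exE conjE)
    fix G assume "strong_copy r G" and inj: "inj_on (\<lambda>_. 0 :: nat) G"
    then obtain f where f: "G = f ` Field r" "inj_on f (Field r)" by (elim strong_copyE)
    then have "card G = card (Field r)" by (simp add: card_image)
    moreover have "card G \<le> card ((\<lambda>_. 0 :: nat) ` G)" using inj by (simp add: card_image)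
    moreover have "card ((\<lambda>_. 0 :: nat) ` G) \<le> card {0 :: nat}" by (rule card_mono) auto
    ultimately show False using assms by simp
  qed
  then have "{card (c ` Pow {1..n}) | c :: nat set \<Rightarrow> nat. admissible n r c} \<noteq> {}" by blast
  from Max_in[OF finite_ar this] show ?thesis using that unfolding ar_star_alt by fastforce
qed

lemma La_star_attained:
  assumes "\<And>r. r \<in> R \<Longrightarrow> Field r \<noteq> {}"
  obtains F where "F \<subseteq> Pow {1..n}" "copy_free R F" "card F = La_star n R"
proof -
  have "copy_free R ({} :: nat set set)"
    unfolding copy_free_def
  proof (intro notI, elim bexE exE conjE)
    fix r and G :: "nat set set" assume "r \<in> R" "G \<subseteq> {}" "strong_copy r G"
    then show False using assms by (auto elim: strong_copyE)
  qed
  then have "{card F | F :: nat set set. F \<subseteq> Pow {1..n} \<and> copy_free R F} \<noteq> {}" by blast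
  from Max_in[OF finite_La this] show ?thesis using that unfolding La_star_alt by fastforce
qed

section \<open>Order reversal by complementation\<close>

lemma strong_copy_converse:
  assumes G: "G \<subseteq> Pow V" and "strong_copy (r\<inverse>) G"
  shows "strong_copy r ((\<lambda>A. V - A) ` G)"
proof -
  obtain f where f: "strong_emb (r\<inverse>) f" "G = f ` Field r" "inj_on f (Field r)"
    using assms(2) by (elim strong_copyE) (simp add: Field_converse)
  have sub: "f x \<subseteq> V" if "x \<in> Field r" for x using that f(2) G by blast
  have le: "(p, q) \<in> r \<longleftrightarrow> V - f p \<subseteq> V - f q" if "p \<in> Field r" "q \<in> Field r" for p q
    using f(1) that sub[OF that(1)] sub[OF that(2)] unfolding strong_emb_def by (simp add: Field_converse) blast
  have "inj_on (\<lambda>x. V - f x) (Field r)"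
  proof (rule inj_onI)
    fix x y assume xy: "x \<in> Field r" "y \<in> Field r" "V - f x = V - f y"
    then have "f x = f y" using sub[OF xy(1)] sub[OF xy(2)] by blast
    then show "x = y" using f(3) xy by (auto dest: inj_onD)
  qed
  then show ?thesis
    unfolding strong_copy_def using le f(2)
    by (intro exI[of _ "\<lambda>x. V - f x"]) (auto simp: bij_betw_def image_image)
qed

lemma Diff_image_Pow: "(\<lambda>A. V - A) ` Pow V = Pow V"
  by (auto simp: image_iff double_diff intro!: bexI[of _ "V - _"])

lemma inj_on_Diff: "inj_on (\<lambda>A. V - A) (Pow V)"
  by (rule inj_on_inverseI[of _ "\<lambda>A. V - A"]) auto

lemma ar_star_converse_le:
  assumes "2 \<le> card (Field r)"
  shows "ar_star n r \<le> ar_star n (r\<inverse>)"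
proof -
  let ?V = "{1..n}"
  obtain c where c: "admissible n r c" "card (c ` Pow ?V) = ar_star n r"
    using ar_star_attained[OF assms] .
  have "admissible n (r\<inverse>) (\<lambda>A. c (?V - A))"
    unfolding admissible_def
  proof (intro notI, elim exE conjE)
    fix G assume G: "G \<subseteq> Pow ?V" "strong_copy (r\<inverse>) G" "inj_on (\<lambda>A. c (?V - A)) G"
    have "inj_on c ((\<lambda>A. ?V - A) ` G)" using G(3) by (auto simp: inj_on_def)
    moreover have "(\<lambda>A. ?V - A) ` G \<subseteq> Pow ?V" by auto
    ultimately show False using c(1) strong_copy_converse[OF G(1,2)] unfolding admissible_def by blast
  qed
  from ar_star_ge[OF this] show ?thesis
    using c(2) by (simp only: image_image[symmetric] Diff_image_Pow)
qed

lemma ar_star_converse: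
  assumes "2 \<le> card (Field r)"
  shows "ar_star n (r\<inverse>) = ar_star n r"
  using ar_star_converse_le[of "r\<inverse>" n] ar_star_converse_le[OF assms, of n] assms
  by (simp add: Field_converse)

lemma La_star_converse_le:
  assumes "\<And>r. r \<in> R \<Longrightarrow> Field r \<noteq> {}"
  shows "La_star n R \<le> La_star n (converse ` R)"
proof -
  let ?V = "{1..n}"
  obtain F where F: "F \<subseteq> Pow ?V" "copy_free R F" "card F = La_star n R"
    using La_star_attained[OF assms] .
  have "copy_free (converse ` R) ((\<lambda>A. ?V - A) ` F)"
    unfolding copy_free_def
  proof (intro notI, elim bexE exE conjE imageE)
    fix r' r G assume r: "r \<in> R" "r' = r\<inverse>" and G: "G \<subseteq> (\<lambda>A. ?V - A) ` F" "strong_copy r' G"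
    then have "strong_copy r ((\<lambda>A. ?V - A) ` G)" by (intro strong_copy_converse) auto
    moreover have "?V - (?V - A) = A" if "A \<in> F" for A using that F(1) by blast
    then have "(\<lambda>A. ?V - A) ` G \<subseteq> F" using G(1) by fastforce
    ultimately show False using F(2) r(1) unfolding copy_free_def by blast
  qed
  moreover have "card ((\<lambda>A. ?V - A) ` F) = card F"
    by (rule card_image) (rule inj_on_subset[OF inj_on_Diff F(1)])
  ultimately show ?thesis using F(3) La_star_ge[of "(\<lambda>A. ?V - A) ` F" n "converse ` R"] by auto
qed

lemma La_star_converse:
  assumes "\<And>r. r \<in> R \<Longrightarrow> Field r \<noteq> {}"
  shows "La_star n (converse ` R) = La_star n R"
proof (rule antisym)
  have "La_star n (converse ` R) \<le> La_star n (converse ` converse ` R)"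
    by (rule La_star_converse_le) (use assms in \<open>auto simp: Field_converse\<close>)
  then show "La_star n (converse ` R) \<le> La_star n R" by (simp add: image_image)
qed (rule La_star_converse_le[OF assms])

lemma Pminus_converse: "Pminus (r\<inverse>) = converse ` Pminus r"
proof -
  have "remove_elem (r\<inverse>) m = (remove_elem r m)\<inverse>" for m
    by (auto simp: remove_elem_def Field_converse)
  moreover have "maximal_in (r\<inverse>) m \<longleftrightarrow> minimal_in r m" "minimal_in (r\<inverse>) m \<longleftrightarrow> maximal_in r m" for m
    by (auto simp: maximal_in_def minimal_in_def Field_converse)
  ultimately show ?thesis unfolding Pminus_eq by (auto simp: image_iff)
qed

text \<open>\<open>ranked r k\<close> says that \<open>r\<close> has height at most \<open>k\<close>.\<close>

definition ranked :: "'a rel \<Rightarrow> nat \<Rightarrow> bool" where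
  "ranked r k \<longleftrightarrow> (\<exists>\<rho> :: 'a \<Rightarrow> nat. (\<forall>x y. (x, y) \<in> r \<longrightarrow> x \<noteq> y \<longrightarrow> \<rho> x < \<rho> y) \<and> (\<forall>x\<in>Field r. \<rho> x < k))"

lemma ranked_converse:
  assumes "ranked r k" shows "ranked (r\<inverse>) k"
proof -
  obtain \<rho> :: "'a \<Rightarrow> nat" where \<rho>: "\<forall>x y. (x, y) \<in> r \<longrightarrow> x \<noteq> y \<longrightarrow> \<rho> x < \<rho> y" "\<forall>x\<in>Field r. \<rho> x < k"
    using assms by (auto simp: ranked_def)
  have "k - 1 - \<rho> x < k - 1 - \<rho> y" if "(y, x) \<in> r" "y \<noteq> x" for x y
  proof -
    have "\<rho> y < \<rho> x" "\<rho> x < k" using that \<rho> by (auto simp: Field_def)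
    then show ?thesis by linarith
  qed
  moreover have "k - 1 - \<rho> x < k" if "x \<in> Field r" for x using \<rho>(2) that by fastforce
  ultimately show ?thesis unfolding ranked_def
    by (intro exI[of _ "\<lambda>x. k - 1 - \<rho> x"]) (auto simp: Field_converse)
qed

lemma ranked_remove: "ranked r k \<Longrightarrow> ranked (remove_elem r m) k"
proof -
  have "Field (remove_elem r m) \<subseteq> Field r" "remove_elem r m \<subseteq> r"
    by (auto simp: remove_elem_def Field_def)
  then show "ranked r k \<Longrightarrow> ranked (remove_elem r m) k"
    unfolding ranked_def by (elim exE conjE, rename_tac \<rho>, rule_tac x = \<rho> in exI) blast
qed

text \<open>Inclusion is strict on distinct elements of a copy, so the cardinality counted from
  level \<open>h\<close> is a rank function.\<close>

lemma ranked_levels: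
  assumes "Partial_order r" "strong_emb r f"
    and lev: "\<And>x. x \<in> Field r \<Longrightarrow> finite (f x) \<and> h \<le> card (f x) \<and> card (f x) < h + k"
  shows "ranked r k"
proof -
  have "card (f x) - h < card (f y) - h" if xy: "(x, y) \<in> r" "x \<noteq> y" for x y
  proof -
    have F: "x \<in> Field r" "y \<in> Field r" using xy by (auto simp: Field_def)
    have "f x \<subseteq> f y" using assms(2) F xy(1) by (simp add: strong_emb_def)
    moreover have "f x \<noteq> f y" using strong_emb_inj[OF assms(1,2)] F xy(2) by (auto dest: inj_onD)
    ultimately have "card (f x) < card (f y)" using lev[OF F(2)] by (intro psubset_card_mono) auto
    then show ?thesis using lev[OF F(1)] by linarith
  qed
  moreover have "card (f x) - h < k" if "x \<in> Field r" for x using lev[OF that] by linarith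
  ultimately show ?thesis unfolding ranked_def by (intro exI[of _ "\<lambda>x. card (f x) - h"]) auto
qed

text \<open>The number of strict predecessors serves as a rank, and an element where it is largest
  is maximal.\<close>

lemma finite_poset_ranked:
  assumes T: "Partial_order r" "finite (Field r)" "Field r \<noteq> {}"
  shows "\<exists>k. ranked r k" "\<exists>m. maximal_in r m"
proof -
  define \<rho> where "\<rho> x = card {y. (y, x) \<in> r \<and> y \<noteq> x}" for x
  have fin: "finite {y. (y, x) \<in> r \<and> y \<noteq> x}" for x
    by (rule finite_subset[OF _ T(2)]) (auto simp: Field_def)
  have less: "\<rho> x < \<rho> y" if "(x, y) \<in> r" "x \<noteq> y" for x y
    unfolding \<rho>_def
  proof (rule psubset_card_mono[OF fin])
    have tr: "trans r" and an: "antisym r" using T(1) by (auto simp: partial_order_on_def preorder_on_def)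
    have "x \<in> {z. (z, y) \<in> r \<and> z \<noteq> y}" using that by simp
    moreover have "{z. (z, x) \<in> r \<and> z \<noteq> x} \<subseteq> {z. (z, y) \<in> r \<and> z \<noteq> y}"
      using transD[OF tr] antisymD[OF an] that by blast
    ultimately show "{z. (z, x) \<in> r \<and> z \<noteq> x} \<subset> {z. (z, y) \<in> r \<and> z \<noteq> y}" by blast
  qed
  have "\<rho> x < Suc (card (Field r))" for x
    unfolding \<rho>_def less_Suc_eq_le by (rule card_mono[OF T(2)]) (auto simp: Field_def)
  then show "\<exists>k. ranked r k" unfolding ranked_def using less by blast
  have "Max (\<rho> ` Field r) \<in> \<rho> ` Field r" using T by (intro Max_in) auto
  then obtain m where m: "m \<in> Field r" "\<rho> m = Max (\<rho> ` Field r)" by auto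
  have "q = m" if "(m, q) \<in> r" for q
  proof (rule ccontr)
    assume "q \<noteq> m"
    then have "\<rho> m < \<rho> q" using less that by blast
    moreover have "q \<in> Field r" using that by (auto simp: Field_def)
    then have "\<rho> q \<le> \<rho> m" using m(2) T(2) by simp
    ultimately show False by simp
  qed
  then show "\<exists>m. maximal_in r m" using m(1) by (auto simp: maximal_in_def)
qed

text \<open>
  The lower bound for \<open>ar_star\<close>: give the members of \<open>F\<close> distinct colours and all other sets
  one further colour, so that a rainbow copy has at most one element outside \<open>F\<close>.
\<close>

lemma card_le_ar_star:
  assumes F: "F \<subseteq> Pow {1..n}"
    and no: "\<And>f x. strong_emb r f \<Longrightarrow> f ` Field r \<subseteq> Pow {1..n} \<Longrightarrow> x \<in> Field r \<Longrightarrow>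
      f ` (Field r - {x}) \<subseteq> F \<Longrightarrow> x = x0 \<or> f x \<notin> F \<Longrightarrow> False"
    and x0: "x0 \<in> Field r"
  shows "card F \<le> ar_star n r"
proof -
  have finF: "finite F" using F finite_subset by blast
  obtain e :: "nat set \<Rightarrow> nat" where e: "inj_on e F"
    using finite_imp_inj_to_nat_seg[OF finF] by blast
  \<comment> \<open>Colour 0 is the common colour outside \<open>F\<close>; \<open>Suc\<close> keeps
    the colours of members away from it.\<close>
  define c where "c A = (if A \<in> F then Suc (e A) else 0)" for A
  have "admissible n r c"
    unfolding admissible_def
  proof (intro notI, elim exE conjE)
    fix G assume G: "G \<subseteq> Pow {1..n}" "strong_copy r G" "inj_on c G"
    obtain f where f: "strong_emb r f" "G = f ` Field r" "inj_on f (Field r)"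
      using G(2) by (elim strong_copyE)
    \<comment> \<open>If the copy lies inside \<open>F\<close>, no element is distinguished and
      \<open>x0\<close> stands in; otherwise \<open>x\<close> is an element mapped outside
      \<open>F\<close>.\<close>
    obtain x where x: "x \<in> Field r" "x = x0 \<or> f x \<notin> F" "f x \<notin> F \<or> f ` Field r \<subseteq> F"
      using x0 by blast
    have "f y \<in> F" if y: "y \<in> Field r" "y \<noteq> x" for y
    proof (rule ccontr)
      assume "f y \<notin> F"
      moreover from this have "f x \<notin> F" using x(3) y by blast
      ultimately have "c (f x) = c (f y)" by (simp add: c_def)
      then have "f x = f y" using G(3) f(2) x(1) y(1) by (auto dest: inj_onD)
      then show False using f(3) x(1) y by (auto dest: inj_onD)
    qed
    then show False using no[OF f(1) _ x(1) _ x(2)] f(2) G(1) by blast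
  qed
  from ar_star_ge[OF this] have "card (c ` Pow {1..n}) \<le> ar_star n r" .
  moreover have "inj_on c F" using e by (auto simp: c_def inj_on_def)
  then have "card F = card (c ` F)" by (simp add: card_image)
  moreover have "card (c ` F) \<le> card (c ` Pow {1..n})" using F by (intro card_mono) auto
  ultimately show ?thesis by simp
qed

lemma card_levels:
  "card {A. A \<subseteq> {1..n} \<and> h \<le> card A \<and> card A < h + k} = (\<Sum>i<k. n choose (h + i))"
proof -
  let ?B = "\<lambda>i. {A. A \<subseteq> {1..n} \<and> card A = h + i}"
  have "{A. A \<subseteq> {1..n} \<and> h \<le> card A \<and> card A < h + k} = (\<Union>i<k. ?B i)"
  proof (intro subset_antisym subsetI)
    fix A assume "A \<in> {A. A \<subseteq> {1..n} \<and> h \<le> card A \<and> card A < h + k}"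
    then have "A \<in> ?B (card A - h)" "card A - h < k" by auto
    then show "A \<in> (\<Union>i<k. ?B i)" by blast
  qed auto
  moreover have "card (\<Union>i<k. ?B i) = (\<Sum>i<k. card (?B i))"
    by (rule card_UN_disjoint) (auto intro: finite_subset[of _ "Pow {1..n}"])
  ultimately show ?thesis using n_subsets[of "{1..n}"] by simp
qed

lemma levels_le_La_star:
  assumes T: "Partial_order r" and no: "\<And>Q. Q \<in> Pminus r \<Longrightarrow> \<not> ranked Q k"
  shows "(\<Sum>i<k. n choose (h + i)) \<le> La_star n (Pminus r)"
proof -
  let ?F = "{A. A \<subseteq> {1..n} \<and> h \<le> card A \<and> card A < h + k}"
  have "copy_free (Pminus r) ?F"
    unfolding copy_free_def
  proof (intro notI, elim bexE exE conjE)
    fix Q G assume Q: "Q \<in> Pminus r" and G: "G \<subseteq> ?F" "strong_copy Q G"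
    obtain f where f: "strong_emb Q f" "G = f ` Field Q" using G(2) by (elim strong_copyE)
    have PQ: "Partial_order Q" using Q Partial_order_remove_elem[OF T] by (auto simp: Pminus_eq)
    have "finite (f x) \<and> h \<le> card (f x) \<and> card (f x) < h + k" if "x \<in> Field Q" for x
    proof -
      have "f x \<in> ?F" using that f(2) G(1) by blast
      then show ?thesis using finite_subset[of "f x" "{1..n}"] by simp
    qed
    then show False using no[OF Q] ranked_levels[OF PQ f(1)] by blast
  qed
  then have "card ?F \<le> La_star n (Pminus r)" by (intro La_star_ge) auto
  then show ?thesis by (simp only: card_levels)
qed

text \<open>All other images have size at least \<open>h\<close> and less than \<open>h + k\<close>,
  so an exceptional image that is too small contains none of them, and one that is too large is
  contained in none. Deleting its element, or \<open>m\<close> when the copy has no exceptional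
  image, leaves a member of \<open>Pminus r\<close> of height at most \<open>k\<close>.\<close>

lemma levels_le_ar_star:
  assumes T: "Partial_order r" and m: "maximal_in r m" and no: "\<And>Q. Q \<in> Pminus r \<Longrightarrow> \<not> ranked Q k"
  shows "(\<Sum>i<k. n choose (h + i)) \<le> ar_star n r"
proof -
  let ?F = "{A. A \<subseteq> {1..n} \<and> h \<le> card A \<and> card A < h + k}"
  have "card ?F \<le> ar_star n r"
  proof (rule card_le_ar_star)
    show "m \<in> Field r" using m by (simp add: maximal_in_def)
    fix f x
    assume f: "strong_emb r f" "f ` Field r \<subseteq> Pow {1..n}" and x: "x \<in> Field r"
      and sub: "f ` (Field r - {x}) \<subseteq> ?F" and or: "x = m \<or> f x \<notin> ?F"
    have lev: "finite (f y) \<and> h \<le> card (f y) \<and> card (f y) < h + k" if "y \<in> Field r" "y \<noteq> x" for y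
    proof -
      have "f y \<in> ?F" using that sub by blast
      then show ?thesis using finite_subset[of "f y" "{1..n}"] by simp
    qed
    have fx: "f x \<subseteq> {1..n}" "finite (f x)" using f(2) x finite_subset[of "f x" "{1..n}"] by auto
    have "maximal_in r x \<or> minimal_in r x"
    proof (cases "x = m")
      case False
      then have "card (f x) < h \<or> h + k \<le> card (f x)" using or fx by auto
      then show ?thesis
      proof
        assume a: "card (f x) < h"
        have "q = x" if q: "(q, x) \<in> r" for q
        proof (rule ccontr)
          assume "q \<noteq> x"
          moreover have qF: "q \<in> Field r" using q by (auto simp: Field_def)
          moreover have "f q \<subseteq> f x" using f(1) q qF x by (simp add: strong_emb_def)
          ultimately show False using lev[of q] a card_mono[OF fx(2), of "f q"] by simp
        qed
        then show ?thesis using x by (auto simp: minimal_in_def)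
      next
        assume a: "h + k \<le> card (f x)"
        have "q = x" if q: "(x, q) \<in> r" for q
        proof (rule ccontr)
          assume "q \<noteq> x"
          moreover have qF: "q \<in> Field r" using q by (auto simp: Field_def)
          moreover have "f x \<subseteq> f q" using f(1) q qF x by (simp add: strong_emb_def)
          ultimately show False using lev[of q] a card_mono[of "f q" "f x"] by simp
        qed
        then show ?thesis using x by (auto simp: maximal_in_def)
      qed
    qed (use m in simp)
    then have "remove_elem r x \<in> Pminus r" by (auto simp: Pminus_eq)
    moreover have "ranked (remove_elem r x) k"
      by (rule ranked_levels[OF Partial_order_remove_elem[OF T] strong_emb_remove[OF T f(1)], where h = h])
        (use lev in \<open>simp add: Field_remove_elem[OF T]\<close>)
    ultimately show False using no by blast
  qed auto
  then show ?thesis by (simp only: card_levels)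
qed

section \<open>Posets that are not stars\<close>

lemma asymp_equiv_by_bounds:
  fixes f C :: "nat \<Rightarrow> real"
  assumes a: "0 < a" and C: "\<forall>\<^sub>F n in sequentially. 0 < C n"
    and lower: "\<And>\<epsilon>. 0 < \<epsilon> \<Longrightarrow> \<forall>\<^sub>F n in sequentially. (a - \<epsilon>) * C n \<le> f n"
    and upper: "\<And>\<epsilon>. 0 < \<epsilon> \<Longrightarrow> \<forall>\<^sub>F n in sequentially. f n \<le> (a + \<epsilon>) * C n"
  shows "f \<sim>[at_top] (\<lambda>n. a * C n)"
proof (rule asymp_equivI', rule tendstoI)
  fix e :: real assume e: "0 < e"
  \<comment> \<open>The hypotheses have additive errors in the coefficient of \<open>C n\<close>;
    this choice makes the relative error at most e/2.\<close>
  define \<epsilon> where "\<epsilon> = a * e / 2"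
  have \<epsilon>: "0 < \<epsilon>" using a e by (simp add: \<epsilon>_def)
  show "\<forall>\<^sub>F n in sequentially. dist (f n / (a * C n)) 1 < e"
    using C lower[OF \<epsilon>] upper[OF \<epsilon>]
  proof eventually_elim
    case (elim n)
    have aC: "0 < a * C n" using a elim(1) by simp
    have "\<bar>f n - a * C n\<bar> \<le> e / 2 * (a * C n)"
      by (rule abs_leI) (use elim(2,3) in \<open>simp_all add: \<epsilon>_def algebra_simps\<close>)
    then have "\<bar>f n - a * C n\<bar> / (a * C n) \<le> e / 2" using aC by (simp add: pos_divide_le_eq)
    moreover have "dist (f n / (a * C n)) 1 = \<bar>f n - a * C n\<bar> / (a * C n)"
    proof -
      have "f n / (a * C n) - 1 = (f n - a * C n) / (a * C n)" using a elim(1) by (simp add: diff_divide_distrib)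
      then show ?thesis using abs_of_pos[OF aC] by (simp only: dist_real_def abs_divide)
    qed
    ultimately show ?case using e by linarith
  qed
qed

section \<open>Binomial coefficients near the centre\<close>

lemma binomial_Suc_mult: "(n choose Suc j) * Suc j = (n choose j) * (n - j)"
proof (cases "j \<le> n")
  case True
  then show ?thesis by (metis binomial_absorb_comp binomial_absorption mult.commute)
qed simp

text \<open>This is the quotient of consecutive binomial coefficients at bounded distance from the
  centre. Numerator and denominator differ by at most 2i + 2, and the denominator is at least
  n/2.\<close>

lemma central_factor_tendsto:
  "(\<lambda>n. real (n - (n div 2 + i)) / real (Suc (n div 2 + i))) \<longlonglongrightarrow> 1"
proof (rule LIM_zero_cancel, rule tendsto_0_le[where K = 1])
  show "\<forall>\<^sub>F n in sequentially. norm (real (n - (n div 2 + i)) / real (Suc (n div 2 + i)) - 1)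
      \<le> norm ((4 * real i + 4) / real n) * 1"
    using eventually_ge_at_top[of "2 * i + 2"]
  proof eventually_elim
    case (elim n)
    define h where "h = n div 2"
    have h: "2 * h \<le> n" "n \<le> 2 * h + 1" by (simp_all add: h_def)
    have le: "h + i \<le> n" using elim h by linarith
    have S0: "0 < real (Suc (h + i))" by simp
    have "real (n - (h + i)) / real (Suc (h + i)) - 1 = (real n - 2 * h - 2 * i - 1) / real (Suc (h + i))"
      using S0 le by (simp add: diff_divide_distrib[symmetric] divide_simps of_nat_diff)
    moreover have "\<bar>real n - 2 * h - 2 * i - 1\<bar> \<le> 2 * real i + 2"
      using h by linarith
    ultimately have "norm (real (n - (h + i)) / real (Suc (h + i)) - 1) \<le> (2 * real i + 2) / real (Suc (h + i))"
      using S0 by (simp add: abs_divide divide_right_mono)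
    also have "\<dots> \<le> (2 * real i + 2) / (real n / 2)"
      using h elim by (intro divide_left_mono) auto
    also have "\<dots> = (4 * real i + 4) / real n" by (simp add: field_simps)
    finally show ?case by (simp add: h_def)
  qed
  show "(\<lambda>n. (4 * real i + 4) / real n) \<longlonglongrightarrow> 0" by (rule lim_const_over_n)
qed

lemma central_binomial_shift_tendsto:
  "(\<lambda>n. real (n choose (n div 2 + i)) / real (n choose (n div 2))) \<longlonglongrightarrow> 1"
proof (induction i)
  case 0
  have "real (n choose (n div 2)) \<noteq> 0" for n using zero_less_binomial[of "n div 2" n] by simp
  then show ?case by (simp del: binomial_eq_0_iff of_nat_eq_0_iff)
next
  case (Suc i)
  have "real (n choose (n div 2 + Suc i)) / real (n choose (n div 2)) =
    real (n choose (n div 2 + i)) / real (n choose (n div 2)) *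
    (real (n - (n div 2 + i)) / real (Suc (n div 2 + i)))" for n
  proof -
    have "real ((n choose Suc (n div 2 + i)) * Suc (n div 2 + i)) =
        real ((n choose (n div 2 + i)) * (n - (n div 2 + i)))"
      by (simp only: binomial_Suc_mult)
    then have "real (n choose (n div 2 + Suc i)) =
        real (n choose (n div 2 + i)) * (real (n - (n div 2 + i)) / real (Suc (n div 2 + i)))"
      by (simp only: of_nat_mult add_Suc_right times_divide_eq_right) (simp add: eq_divide_eq)
    then show ?thesis by simp
  qed
  then show ?case using tendsto_mult[OF Suc central_factor_tendsto[of i]] by simp
qed

lemma eventually_levels_ge:
  assumes "0 < \<epsilon>"
  shows "\<forall>\<^sub>F n in sequentially. (real k - \<epsilon>) * real (n choose (n div 2)) \<le> real (\<Sum>i<k. n choose (n div 2 + i))"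
proof -
  have "(\<lambda>n. \<Sum>i<k. real (n choose (n div 2 + i)) / real (n choose (n div 2))) \<longlonglongrightarrow> (\<Sum>i<k. 1)"
    by (intro tendsto_sum central_binomial_shift_tendsto)
  then have "\<forall>\<^sub>F n in sequentially. real k - \<epsilon> < (\<Sum>i<k. real (n choose (n div 2 + i)) / real (n choose (n div 2)))"
    using assms by (intro order_tendstoD) auto
  then show ?thesis
  proof eventually_elim
    case (elim n)
    have C0: "0 < real (n choose (n div 2))" using zero_less_binomial[of "n div 2" n] by simp
    have "real k - \<epsilon> < real (\<Sum>i<k. n choose (n div 2 + i)) / real (n choose (n div 2))"
      using elim by (simp add: sum_divide_distrib)
    then show ?case by (simp only: pos_less_divide_eq[OF C0] less_imp_le)
  qed
qed

lemma eventually_strong_emb: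
  fixes r :: "'a rel"
  assumes T: "tree_poset r" and m: "maximal_in r m" and rk: "ranked (remove_elem r m) (Suc k)"
    and e: "0 < \<epsilon>"
  shows "\<forall>\<^sub>F n in sequentially. \<forall>F\<subseteq>Pow {1..n}. (real k + \<epsilon>) * (n choose (n div 2)) \<le> card F \<longrightarrow>
    (\<exists>M\<subseteq>{1..n}. \<forall>Y. \<exists>f. strong_emb r f \<and> f m = M \<and> f ` (Field r - {m}) \<subseteq> F - {Y})"
proof -
  have P: "Partial_order r" using T by (simp add: tree_poset_def)
  obtain \<rho> :: "'a \<Rightarrow> nat" where \<rho>: "\<forall>x y. (x, y) \<in> remove_elem r m \<longrightarrow> x \<noteq> y \<longrightarrow> \<rho> x < \<rho> y"
    "\<forall>x\<in>Field r - {m}. \<rho> x < Suc k"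
    using rk Field_remove_elem[OF P, of m] by (auto simp: ranked_def)
  have 1: "\<rho> x < \<rho> y" if "(x, y) \<in> r" "x \<noteq> y" "x \<noteq> m" "y \<noteq> m" for x y
  proof -
    have "(x, y) \<in> remove_elem r m" using that by (auto simp: remove_elem_def Field_def)
    then show ?thesis using \<rho>(1) that(2) by blast
  qed
  have 2: "\<rho> x \<le> k" if "x \<in> Field r" "x \<noteq> m" for x
    using \<rho>(2) that by (simp add: less_Suc_eq_le)
  have "\<forall>\<^sub>F n in sequentially. \<forall>F\<subseteq>Pow {1..n}. (k + \<epsilon>) * (n choose (n div 2)) \<le> card F \<longrightarrow>
    (\<exists>M\<subseteq>{1..n}. \<forall>Y. \<exists>f. f m = M \<and> (\<forall>x\<in>Field r - {m}. f x \<in> F - {Y}) \<and>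
      (\<forall>x\<in>Field r. \<forall>y\<in>Field r. (x, y) \<in> r \<longleftrightarrow> f x \<subseteq> f y))"
    by (rule eventually_embed_tree[OF T m _ _ e, where \<rho> = \<rho>]) (rule 1 2; assumption)+
  then show ?thesis
  proof eventually_elim
    case (elim n)
    show ?case
    proof (intro allI impI)
      fix F assume F: "F \<subseteq> Pow {1..n}" "(real k + \<epsilon>) * (n choose (n div 2)) \<le> card F"
      from elim[rule_format, OF F] obtain M where M: "M \<subseteq> {1..n}"
        and emb: "\<forall>Y. \<exists>f. f m = M \<and> (\<forall>x\<in>Field r - {m}. f x \<in> F - {Y}) \<and>
          (\<forall>x\<in>Field r. \<forall>y\<in>Field r. (x, y) \<in> r \<longleftrightarrow> f x \<subseteq> f y)"
        by (elim exE conjE) (rule that)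
      show "\<exists>M\<subseteq>{1..n}. \<forall>Y. \<exists>f. strong_emb r f \<and> f m = M \<and> f ` (Field r - {m}) \<subseteq> F - {Y}"
      proof (intro exI[of _ M] conjI allI M)
        fix Y
        from spec[OF emb[folded strong_emb_def], of Y] obtain f where "f m = M" "\<forall>x\<in>Field r - {m}. f x \<in> F - {Y}" "strong_emb r f"
          by (elim exE conjE) (rule that)
        then show "\<exists>f. strong_emb r f \<and> f m = M \<and> f ` (Field r - {m}) \<subseteq> F - {Y}"
          by (intro exI[of _ f]) auto
      qed
    qed
  qed
qed

text \<open>A transversal \<open>U\<close> of the colour classes has exactly
  \<open>ar_star n r\<close> members. In a copy with \<open>m\<close> at \<open>M\<close> and all
  else in \<open>U\<close>, the only possible colour clash is between \<open>M\<close> and the one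
  member of \<open>U\<close> of its colour, which the embedding is told to avoid.\<close>

lemma eventually_ar_star_le:
  fixes r :: "'a rel"
  assumes T: "tree_poset r" and m: "maximal_in r m" and rk: "ranked (remove_elem r m) (Suc k)"
    and two: "2 \<le> card (Field r)" and e: "0 < \<epsilon>"
  shows "\<forall>\<^sub>F n in sequentially. real (ar_star n r) \<le> (real k + \<epsilon>) * (n choose (n div 2))"
  using eventually_strong_emb[OF T m rk e]
proof eventually_elim
  case (elim n)
  let ?V = "{1..n}"
  have P: "Partial_order r" using T by (simp add: tree_poset_def)
  show ?case
  proof (rule ccontr)
    assume not: "\<not> ?case"
    obtain c where c: "admissible n r c" "card (c ` Pow ?V) = ar_star n r"
      using ar_star_attained[OF two] .
    obtain U where U: "U \<subseteq> Pow ?V" "inj_on c U" "c ` Pow ?V = c ` U"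
      using subset_image_inj[of "c ` Pow ?V" c "Pow ?V"] by blast
    have "card U = ar_star n r" using U c(2) by (simp add: card_image)
    then have "(real k + \<epsilon>) * (n choose (n div 2)) \<le> card U" using not by simp
    from elim[rule_format, OF U(1) this] obtain M where M: "M \<subseteq> ?V"
      "\<forall>Y. \<exists>f. strong_emb r f \<and> f m = M \<and> f ` (Field r - {m}) \<subseteq> U - {Y}"
      by (elim exE conjE) (rule that)
    \<comment> \<open>If the colour of \<open>M\<close> does not occur on \<open>U\<close>, any
      \<open>Y\<close> will do.\<close>
    obtain Y where Y: "\<forall>A\<in>U. c A = c M \<longrightarrow> A = Y"
    proof (cases "\<exists>A\<in>U. c A = c M")
      case True
      then obtain A where "A \<in> U" "c A = c M" by blast
      then show ?thesis by (intro that[of A] ballI impI, intro inj_onD[OF U(2)]) simp_all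
    qed (use that in blast)
    obtain f where f: "strong_emb r f" "f m = M" "f ` (Field r - {m}) \<subseteq> U - {Y}" using M(2) by blast
    have fU: "f x \<in> U" "c (f x) \<noteq> c M" if "x \<in> Field r" "x \<noteq> m" for x
      using that f(3) Y by blast+
    have "inj_on c (f ` Field r)"
    proof (intro inj_onI, elim imageE)
      fix A B x y assume AB: "c A = c B" "A = f x" "B = f y" "x \<in> Field r" "y \<in> Field r"
      show "A = B"
      proof (cases "x = m \<or> y = m")
        case True
        then have "x = m \<and> y = m" using fU(2)[of x] fU(2)[of y] f(2) AB by metis
        then show ?thesis using AB by simp
      next
        case False
        then show ?thesis using inj_onD[OF U(2), of A B] fU(1) AB by simp
      qed
    qed
    moreover have "f ` Field r \<subseteq> Pow ?V"
    proof
      fix A assume "A \<in> f ` Field r"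
      then obtain x where "x \<in> Field r" "A = f x" by blast
      then show "A \<in> Pow ?V" using fU(1)[of x] f(2) M(1) U(1) by (cases "x = m") auto
    qed
    ultimately show False using c(1) strong_copy_image[OF P f(1)] unfolding admissible_def by blast
  qed
qed

lemma Field_Pminus_nonempty:
  assumes "Partial_order r" "2 \<le> card (Field r)" "Q \<in> Pminus r"
  shows "Field Q \<noteq> {}"
proof
  assume "Field Q = {}"
  then obtain x where "Field r \<subseteq> {x}" using assms(3) Field_remove_elem[OF assms(1)] by (auto simp: Pminus_eq)
  then have "card (Field r) \<le> 1" using card_mono[of "{x}" "Field r"] by simp
  then show False using assms(2) by simp
qed

lemma eventually_La_star_le:
  fixes r :: "'a rel"
  assumes T: "tree_poset r" and m: "maximal_in r m" and rk: "ranked (remove_elem r m) (Suc k)"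
    and two: "2 \<le> card (Field r)" and e: "0 < \<epsilon>"
  shows "\<forall>\<^sub>F n in sequentially. real (La_star n (Pminus r)) \<le> (real k + \<epsilon>) * (n choose (n div 2))"
  using eventually_strong_emb[OF T m rk e]
proof eventually_elim
  case (elim n)
  have P: "Partial_order r" using T by (simp add: tree_poset_def)
  show ?case
  proof (rule ccontr)
    assume not: "\<not> ?case"
    obtain F :: "nat set set" where F: "F \<subseteq> Pow {1..n}" "copy_free (Pminus r) F" "card F = La_star n (Pminus r)"
      using La_star_attained[OF Field_Pminus_nonempty[OF P two]] .
    then have "(real k + \<epsilon>) * (n choose (n div 2)) \<le> card F" using not by simp
    from elim[rule_format, OF F(1) this] obtain M where
      "\<forall>Y. \<exists>f. strong_emb r f \<and> f m = M \<and> f ` (Field r - {m}) \<subseteq> F - {Y}"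
      by (elim exE conjE) (rule that)
    \<comment> \<open>There are no colours to respect here, so the avoided set is an arbitrary
      choice.\<close>
    from spec[OF this, of "{}"] obtain f where f: "strong_emb r f" "f ` (Field r - {m}) \<subseteq> F - {{}}"
      by (elim exE conjE) (rule that)
    then have "f ` (Field r - {m}) \<subseteq> F" by blast
    moreover have "remove_elem r m \<in> Pminus r" using m by (auto simp: Pminus_eq)
    ultimately show False using F(2) strong_copy_remove[OF P f(1)] unfolding copy_free_def by blast
  qed
qed

lemma ar_La_asymp_levels:
  fixes r :: "'a rel"
  assumes T: "tree_poset r" and m: "maximal_in r m" and rk: "ranked (remove_elem r m) (Suc k)"
    and two: "2 \<le> card (Field r)" and k: "0 < k" and no: "\<And>Q. Q \<in> Pminus r \<Longrightarrow> \<not> ranked Q k"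
  shows "(\<lambda>n. real (ar_star n r)) \<sim>[at_top] (\<lambda>n. real (La_star n (Pminus r)))"
proof -
  let ?C = "\<lambda>n. real (n choose (n div 2))"
  have P: "Partial_order r" using T by (simp add: tree_poset_def)
  have C0: "\<forall>\<^sub>F n in sequentially. 0 < ?C n"
    by (rule always_eventually) (use zero_less_binomial[of "_ div 2" _] in simp)
  have "(\<lambda>n. real (ar_star n r)) \<sim>[at_top] (\<lambda>n. real k * ?C n)"
  proof (rule asymp_equiv_by_bounds[OF _ C0])
    fix \<epsilon> :: real assume e: "0 < \<epsilon>"
    show "\<forall>\<^sub>F n in sequentially. (real k - \<epsilon>) * ?C n \<le> real (ar_star n r)"
      using eventually_levels_ge[OF e, of k]
      by (rule eventually_mono) (rule order_trans, assumption, rule of_nat_mono, rule levels_le_ar_star[OF P m no])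
    show "\<forall>\<^sub>F n in sequentially. real (ar_star n r) \<le> (real k + \<epsilon>) * ?C n"
      by (rule eventually_ar_star_le[OF T m rk two e])
  qed (use k in simp)
  moreover have "(\<lambda>n. real (La_star n (Pminus r))) \<sim>[at_top] (\<lambda>n. real k * ?C n)"
  proof (rule asymp_equiv_by_bounds[OF _ C0])
    fix \<epsilon> :: real assume e: "0 < \<epsilon>"
    show "\<forall>\<^sub>F n in sequentially. (real k - \<epsilon>) * ?C n \<le> real (La_star n (Pminus r))"
      using eventually_levels_ge[OF e, of k]
      by (rule eventually_mono) (rule order_trans, assumption, rule of_nat_mono, rule levels_le_La_star[OF P no])
    show "\<forall>\<^sub>F n in sequentially. real (La_star n (Pminus r)) \<le> (real k + \<epsilon>) * ?C n"
      by (rule eventually_La_star_le[OF T m rk two e])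
  qed (use k in simp)
  ultimately show ?thesis by (meson asymp_equiv_sym asymp_equiv_trans)
qed

section \<open>Stars and the main theorem\<close>

text \<open>A rank with the single value 0 makes the rest of the poset an antichain, so every Hasse
  edge has an end at \<open>m\<close>; connectedness then puts every element below
  \<open>m\<close>.\<close>

lemma star_relation:
  assumes T: "tree_poset r" and m: "maximal_in r m" and rk: "ranked (remove_elem r m) (Suc 0)"
    and x: "x \<in> Field r" and y: "y \<in> Field r"
  shows "(x, y) \<in> r \<longleftrightarrow> x = y \<or> y = m"
proof -
  have P: "Partial_order r" using T by (simp add: tree_poset_def)
  have anti: "x = y" if xy: "(x, y) \<in> r" and ne: "x \<noteq> m" "y \<noteq> m" for x y
  proof (rule ccontr)
    assume "x \<noteq> y"
    obtain \<rho> :: "'a \<Rightarrow> nat" where \<rho>: "\<forall>x y. (x, y) \<in> remove_elem r m \<longrightarrow> x \<noteq> y \<longrightarrow> \<rho> x < \<rho> y"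
      "\<forall>x\<in>Field (remove_elem r m). \<rho> x < Suc 0"
      using rk by (auto simp: ranked_def)
    have "(x, y) \<in> remove_elem r m" using xy ne by (auto simp: remove_elem_def Field_def)
    moreover from this have "y \<in> Field (remove_elem r m)" by (auto simp: Field_def)
    ultimately show False using \<rho> \<open>x \<noteq> y\<close> by fastforce
  qed
  have top: "(x, m) \<in> r" if x: "x \<in> Field r" for x
  proof (cases "x = m")
    case True
    then show ?thesis using poset_refl[OF T x] by simp
  next
    case False
    have "(x, m) \<in> (hasse_edges r)\<^sup>*" using T x m by (auto simp: tree_poset_def tree_graph_def maximal_in_def)
    then obtain z where "(x, z) \<in> hasse_edges r" using False by (metis converse_rtranclE)
    then have z: "(x, z) \<in> r \<or> (z, x) \<in> r" "x \<noteq> z" by (auto simp: hasse_edges_def covers_def)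
    then have "z = m" using anti False by metis
    then show ?thesis using z m by (auto simp: maximal_in_def)
  qed
  show ?thesis
  proof
    assume "(x, y) \<in> r"
    then show "x = y \<or> y = m" using anti m by (metis maximal_in_def)
  next
    assume "x = y \<or> y = m"
    then show "(x, y) \<in> r" using top[OF x] poset_refl[OF T x] by blast
  qed
qed

text \<open>Pigeonhole over the n + 1 levels: some level contains \<open>s\<close> members, and sets
  of equal size are pairwise incomparable.\<close>

lemma large_family_antichain:
  assumes F: "F \<subseteq> Pow {1..n}" and big: "(n + 1) * (s - 1) < card F"
  shows "\<exists>G\<subseteq>F. card G = s \<and> (\<forall>A\<in>G. \<forall>B\<in>G. A \<subseteq> B \<longrightarrow> A = B)"
proof -
  have finF: "finite F" using F finite_subset by blast
  have "\<exists>j\<le>n. s \<le> card {A \<in> F. card A = j}"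
  proof (rule ccontr)
    assume "\<not> ?thesis"
    then have le: "card {A \<in> F. card A = j} \<le> s - 1" if "j \<le> n" for j using that by force
    have "card A \<in> {..n}" if "A \<in> F" for A
      using card_mono[of "{1..n}" A] that F by auto
    then have "card F = (\<Sum>j\<in>{..n}. card {A \<in> F. card A = j})"
      by (intro sum_card_fibres[symmetric] finF) auto
    also have "\<dots> \<le> (\<Sum>j\<in>{..n}. s - 1)" by (rule sum_mono, rule le) simp
    finally show False using big by simp
  qed
  then obtain j where "s \<le> card {A \<in> F. card A = j}" by blast
  then obtain G where G: "G \<subseteq> {A \<in> F. card A = j}" "card G = s"
    by (meson obtain_subset_with_card_n)
  have "A = B" if "A \<in> G" "B \<in> G" "A \<subseteq> B" for A B
  proof -
    have "B \<subseteq> {1..n}" using that G F by blast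
    then have "finite B" by (rule finite_subset) simp
    moreover have "card A = card B" using that G by auto
    ultimately show ?thesis using that(3) by (simp add: card_subset_eq)
  qed
  then show ?thesis using G by blast
qed

text \<open>
  The union of \<open>s - 1\<close> mutually incomparable chains; the chain of a member is recorded by its
  unique element below \<open>s\<close>.
\<close>

definition star_family :: "nat \<Rightarrow> nat \<Rightarrow> nat set set" where
  "star_family n s = (\<lambda>(i, j). insert i {s..<j}) ` ({1..<s} \<times> {s..n + 1})"

lemma star_set_trace: "i < s \<Longrightarrow> insert i {s..<j} \<inter> {..<s} = {i :: nat}"
  by auto

lemma star_familyE:
  assumes "A \<in> star_family n s"
  obtains i j where "i \<in> {1..<s}" "A = insert i {s..<j}" "A \<inter> {..<s} = {i}"
proof -
  from assms obtain i j where "i \<in> {1..<s}" "A = insert i {s..<j}"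
    unfolding star_family_def by auto
  then show ?thesis using that star_set_trace[of i s j] by simp
qed

lemma star_family_chain:
  assumes A: "A \<in> star_family n s" and B: "B \<in> star_family n s" and eq: "A \<inter> {..<s} = B \<inter> {..<s}"
  shows "A \<subseteq> B \<or> B \<subseteq> A"
proof -
  obtain i j where ij: "A = insert i {s..<j}" "A \<inter> {..<s} = {i}" using A by (elim star_familyE)
  obtain i' j' where ij': "B = insert i' {s..<j'}" "B \<inter> {..<s} = {i'}" using B by (elim star_familyE)
  have "i = i'" using eq ij(2) ij'(2) by simp
  then show ?thesis using ij(1) ij'(1) by (cases "j \<le> j'") auto
qed

lemma star_family_subset_trace:
  assumes A: "A \<in> star_family n s" and B: "B \<in> star_family n s" and "A \<subseteq> B"
  shows "A \<inter> {..<s} = B \<inter> {..<s}"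
proof -
  obtain i where "A \<inter> {..<s} = {i}" using A by (elim star_familyE)
  moreover obtain i' where "B \<inter> {..<s} = {i'}" using B by (elim star_familyE)
  moreover have "A \<inter> {..<s} \<subseteq> B \<inter> {..<s}" using assms(3) by blast
  ultimately show ?thesis by simp
qed

lemma star_family_sub: "1 \<le> s \<Longrightarrow> s \<le> n + 1 \<Longrightarrow> star_family n s \<subseteq> Pow {1..n}"
  unfolding star_family_def by auto

lemma card_star_family:
  assumes "1 \<le> s" "s \<le> n + 1"
  shows "card (star_family n s) = (s - 1) * (n + 2 - s)"
proof -
  have "inj_on (\<lambda>(i, j). insert i {s..<j}) ({1..<s} \<times> {s..n + 1})"
  proof (rule inj_onI, clarify)
    fix i j i' j'
    assume i: "i \<in> {1..<s}" "i' \<in> {1..<s}" and j: "j \<in> {s..n + 1}" "j' \<in> {s..n + 1}"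
      and eq: "insert i {s..<j} = insert i' {s..<j'}"
    have "card (insert i {s..<j}) = Suc (j - s)" "card (insert i' {s..<j'}) = Suc (j' - s)"
      using i by simp_all
    then have "j - s = j' - s" using eq by simp
    then have "j = j'" using j by auto
    moreover have "i \<in> insert i' {s..<j'}" using eq by blast
    then have "i = i'" using i by auto
    ultimately show "i = i' \<and> j = j'" by simp
  qed
  then have "card (star_family n s) = card ({1..<s} \<times> {s..n + 1})"
    unfolding star_family_def by (rule card_image)
  also have "\<dots> = (s - 1) * (n + 2 - s)" using assms by (simp add: card_cartesian_product Suc_diff_le)
  finally show ?thesis .
qed

context
  fixes r :: "'a rel" and m :: 'a and s :: nat
  assumes T: "tree_poset r" and m: "maximal_in r m" and rk: "ranked (remove_elem r m) (Suc 0)"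
    and s: "s = card (Field r) - 1" "3 \<le> s"
begin

lemma star_poset: "Partial_order r"
  using T by (simp add: tree_poset_def)

lemma star_top_in: "m \<in> Field r"
  using m by (simp add: maximal_in_def)

lemma card_star_leaves: "card (Field r - {m}) = s"
  using star_top_in s(1) poset_finite[OF T] by simp

lemmas star_rel = star_relation[OF T m rk]

text \<open>Without \<open>m\<close>, the \<open>s\<close> pairwise incomparable leaves would need
  distinct traces below \<open>s\<close>, and only \<open>s - 1\<close> exist. Without a leaf,
  \<open>3 \<le> s\<close> leaves two others below \<open>m\<close>; contained in a common member,
  they share its trace, lie on one chain and are comparable.\<close>

lemma star_family_no_copy:
  assumes x: "x \<in> Field r" and f: "strong_emb (remove_elem r x) f"
    and sub: "f ` (Field r - {x}) \<subseteq> star_family n s"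
  shows False
proof -
  have rel: "(p, q) \<in> r \<longleftrightarrow> f p \<subseteq> f q" if "p \<in> Field r - {x}" "q \<in> Field r - {x}" for p q
  proof -
    have "(p, q) \<in> remove_elem r x \<longleftrightarrow> f p \<subseteq> f q"
      using f that Field_remove_elem[OF star_poset] by (simp add: strong_emb_def)
    then show ?thesis using that by (simp add: remove_elem_def)
  qed
  let ?tr = "\<lambda>A. A \<inter> {..<s}"
  show False
  proof (cases "x = m")
    case True
    have "inj_on (\<lambda>y. ?tr (f y)) (Field r - {m})"
    proof (rule inj_onI)
      fix p q assume pq: "p \<in> Field r - {m}" "q \<in> Field r - {m}" "?tr (f p) = ?tr (f q)"
      then have "f p \<in> star_family n s" "f q \<in> star_family n s" using sub True by blast+
      then have "f p \<subseteq> f q \<or> f q \<subseteq> f p" using star_family_chain pq(3) by blast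
      then have "(p, q) \<in> r \<or> (q, p) \<in> r" using rel pq True by blast
      then show "p = q" using star_rel[of p q] star_rel[of q p] pq by blast
    qed
    then have "s = card ((\<lambda>y. ?tr (f y)) ` (Field r - {m}))"
      using card_star_leaves by (simp add: card_image)
    also have "\<dots> \<le> card ((\<lambda>i. {i}) ` {1..<s})"
    proof (rule card_mono)
      show "(\<lambda>y. ?tr (f y)) ` (Field r - {m}) \<subseteq> (\<lambda>i. {i}) ` {1..<s}"
      proof
        fix A assume "A \<in> (\<lambda>y. ?tr (f y)) ` (Field r - {m})"
        then obtain y where y: "y \<in> Field r - {m}" "A = ?tr (f y)" by blast
        then have "f y \<in> star_family n s" using sub True by blast
        then obtain i where "i \<in> {1..<s}" "?tr (f y) = {i}" by (elim star_familyE)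
        then show "A \<in> (\<lambda>i. {i}) ` {1..<s}" using y(2) by simp
      qed
    qed simp
    also have "\<dots> \<le> card {1..<s}" by (rule card_image_le) simp
    finally show False using s(2) by simp
  next
    case False
    have "card (Field r - {m} - {x}) = s - 1" using card_star_leaves x False by simp
    then have "2 \<le> card (Field r - {m} - {x})" using s(2) by simp
    then obtain G where "G \<subseteq> Field r - {m} - {x}" "card G = 2" by (meson obtain_subset_with_card_n)
    then obtain p q where pq: "p \<in> Field r - {m} - {x}" "q \<in> Field r - {m} - {x}" "p \<noteq> q"
      by (auto simp: card_2_iff)
    have mx: "m \<in> Field r - {x}" using star_top_in False by simp
    have in_fam: "f p \<in> star_family n s" "f q \<in> star_family n s" "f m \<in> star_family n s"
      using sub pq mx by blast+
    have "(p, m) \<in> r" "(q, m) \<in> r" using star_rel[of p m] star_rel[of q m] star_top_in pq by auto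
    then have "f p \<subseteq> f m" "f q \<subseteq> f m" using rel[of p m] rel[of q m] pq mx by auto
    then have "?tr (f p) = ?tr (f q)" using star_family_subset_trace in_fam by metis
    then have "f p \<subseteq> f q \<or> f q \<subseteq> f p" using star_family_chain in_fam by blast
    then have "(p, q) \<in> r \<or> (q, p) \<in> r" using rel[of p q] rel[of q p] pq by auto
    then show False using star_rel[of p q] star_rel[of q p] pq by auto
  qed
qed

lemma star_La_ge:
  assumes "s \<le> n + 1" shows "(s - 1) * (n + 2 - s) \<le> La_star n (Pminus r)"
proof -
  have "copy_free (Pminus r) (star_family n s)"
    unfolding copy_free_def
  proof (intro notI, elim bexE exE conjE)
    fix Q G assume Q: "Q \<in> Pminus r" and G: "G \<subseteq> star_family n s" "strong_copy Q G"
    obtain x where x: "Q = remove_elem r x" "x \<in> Field r"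
      using Q by (auto simp: Pminus_eq maximal_in_def minimal_in_def)
    obtain f where f: "strong_emb Q f" "G = f ` Field Q" using G(2) by (elim strong_copyE)
    then show False using star_family_no_copy[OF x(2)] x(1) G(1) Field_remove_elem[OF star_poset, of x] by auto
  qed
  then have "card (star_family n s) \<le> La_star n (Pminus r)"
    using star_family_sub assms s(2) by (intro La_star_ge) simp_all
  then show ?thesis using card_star_family assms s(2) by simp
qed

lemma star_ar_ge:
  assumes "s \<le> n + 1" shows "(s - 1) * (n + 2 - s) \<le> ar_star n r"
proof -
  have "card (star_family n s) \<le> ar_star n r"
  proof (rule card_le_ar_star)
    show "star_family n s \<subseteq> Pow {1..n}" using star_family_sub assms s(2) by simp
    show "m \<in> Field r" by (rule star_top_in)
    show False if "strong_emb r f" "x \<in> Field r" "f ` (Field r - {x}) \<subseteq> star_family n s" for f x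
      using star_family_no_copy[OF that(2) strong_emb_remove[OF star_poset that(1)] that(3)] .
  qed
  then show ?thesis using card_star_family assms s(2) by simp
qed

lemma star_La_le: "La_star n (Pminus r) \<le> (n + 1) * (s - 1)"
proof (rule ccontr)
  assume not: "\<not> ?thesis"
  have two: "2 \<le> card (Field r)" using s by simp
  obtain F :: "nat set set" where F: "F \<subseteq> Pow {1..n}" "copy_free (Pminus r) F" "card F = La_star n (Pminus r)"
    using La_star_attained[OF Field_Pminus_nonempty[OF star_poset two]] .
  obtain G where G: "G \<subseteq> F" "card G = s" "\<forall>A\<in>G. \<forall>B\<in>G. A \<subseteq> B \<longrightarrow> A = B"
    using large_family_antichain[OF F(1), of s] F(3) not by auto
  have "finite G" using G(2) s(2) card.infinite by fastforce
  then obtain g where g: "bij_betw g (Field r - {m}) G"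
    using finite_same_card_bij[of "Field r - {m}" G] poset_finite[OF T] card_star_leaves G(2) by auto
  have "strong_emb (remove_elem r m) g"
    unfolding strong_emb_def Field_remove_elem[OF star_poset]
  proof (intro ballI)
    fix p q assume pq: "p \<in> Field r - {m}" "q \<in> Field r - {m}"
    have "(p, q) \<in> remove_elem r m \<longleftrightarrow> p = q"
      using pq star_rel[of p q] by (auto simp: remove_elem_def)
    moreover have "g p \<in> G" "g q \<in> G" using g pq by (auto simp: bij_betw_def)
    then have "g p \<subseteq> g q \<longleftrightarrow> g p = g q" using G(3) by blast
    moreover have "g p = g q \<longleftrightarrow> p = q" using g pq by (auto simp: bij_betw_def dest: inj_onD)
    ultimately show "(p, q) \<in> remove_elem r m \<longleftrightarrow> g p \<subseteq> g q" by blast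
  qed
  from strong_copy_image[OF Partial_order_remove_elem[OF star_poset] this]
  have "strong_copy (remove_elem r m) G"
    using g by (simp add: Field_remove_elem[OF star_poset] bij_betw_def)
  moreover have "remove_elem r m \<in> Pminus r" using m by (auto simp: Pminus_eq)
  ultimately show False using F(2) G(1) unfolding copy_free_def by blast
qed

text \<open>The full set can always carry \<open>m\<close>. The additional 1 accounts for its
  colour: after that colour is removed from a transversal, any antichain of \<open>s\<close>
  remaining sets completes a rainbow copy.\<close>

lemma star_ar_le: "ar_star n r \<le> (n + 1) * (s - 1) + 1"
proof (rule ccontr)
  assume not: "\<not> ?thesis"
  let ?V = "{1..n}"
  have two: "2 \<le> card (Field r)" using s by simp
  obtain c where c: "admissible n r c" "card (c ` Pow ?V) = ar_star n r"
    using ar_star_attained[OF two] .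
  obtain U where U: "U \<subseteq> Pow ?V" "inj_on c U" "c ` Pow ?V = c ` U"
    using subset_image_inj[of "c ` Pow ?V" c "Pow ?V"] by blast
  have finU: "finite U" using U(1) finite_subset by blast
  have cU: "card U = ar_star n r" using U c(2) by (simp add: card_image)
  let ?U = "{A \<in> U. c A \<noteq> c ?V}"
  have finc: "finite {A \<in> U. c A = c ?V}" using finU by simp
  have "card {A \<in> U. c A = c ?V} \<le> Suc 0"
    unfolding card_le_Suc0_iff_eq[OF finc] by (intro ballI inj_onD[OF U(2)]) simp_all
  moreover have "?U \<union> {A \<in> U. c A = c ?V} = U" by blast
  then have "card U \<le> card ?U + card {A \<in> U. c A = c ?V}"
    using card_Un_le[of ?U "{A \<in> U. c A = c ?V}"] by simp
  ultimately have "(n + 1) * (s - 1) < card ?U" using not cU by linarith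
  moreover have "?U \<subseteq> Pow ?V" using U(1) by blast
  ultimately obtain G where G: "G \<subseteq> ?U" "card G = s" "\<forall>A\<in>G. \<forall>B\<in>G. A \<subseteq> B \<longrightarrow> A = B"
    using large_family_antichain[of ?U n s] by blast
  have "finite G" using G(2) s(2) card.infinite by fastforce
  then obtain g where g: "bij_betw g (Field r - {m}) G"
    using finite_same_card_bij[of "Field r - {m}" G] poset_finite[OF T] card_star_leaves G(2) by auto
  define f where "f = g(m := ?V)"
  have fm: "f m = ?V" by (simp add: f_def)
  have fG: "f x \<in> G" "f x = g x" if "x \<in> Field r" "x \<noteq> m" for x
    using that g by (auto simp: f_def bij_betw_def)
  have GV: "A \<subseteq> ?V \<and> A \<noteq> ?V \<and> c A \<noteq> c ?V" if "A \<in> G" for A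
    using that G(1) U(1) by auto
  have "strong_emb r f"
    unfolding strong_emb_def
  proof (intro ballI)
    fix p q assume pq: "p \<in> Field r" "q \<in> Field r"
    consider "q = m" | "p = m" "q \<noteq> m" | "p \<noteq> m" "q \<noteq> m" by blast
    then show "(p, q) \<in> r \<longleftrightarrow> f p \<subseteq> f q"
    proof cases
      case 1
      have "f p \<subseteq> ?V" using fG(1)[of p] GV[of "f p"] pq fm by (cases "p = m") auto
      then show ?thesis using star_rel[OF pq] 1 fm by simp
    next
      case 2
      then have "f q \<subseteq> ?V \<and> f q \<noteq> ?V" using fG(1)[of q] GV pq by blast
      then show ?thesis using star_rel[OF pq] 2 fm by blast
    next
      case 3
      then have "f p \<in> G" "f q \<in> G" "f p = g p" "f q = g q" using fG pq by blast+
      then have "f p \<subseteq> f q \<longleftrightarrow> g p = g q" using G(3) by (metis subset_refl)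
      moreover have "g p = g q \<longleftrightarrow> p = q" using g pq 3 by (auto simp: bij_betw_def dest: inj_onD)
      ultimately show ?thesis using star_rel[OF pq] 3 by blast
    qed
  qed
  from strong_copy_image[OF star_poset this] have "strong_copy r (f ` Field r)" .
  moreover have img: "A \<in> insert ?V G" if "A \<in> f ` Field r" for A using that fG(1) fm by fastforce
  have "f ` Field r \<subseteq> Pow ?V" using img GV by blast
  moreover have "inj_on c (insert ?V G)"
    using U(2) G(1) GV by (auto simp: inj_on_def)
  then have "inj_on c (f ` Field r)" by (rule inj_on_subset) (use img in blast)
  ultimately show False using c(1) unfolding admissible_def by blast
qed

text \<open>Both bounds differ from (s - 1)n by a constant: the lower one is smaller by (s - 1)(s -
  2), the upper one larger by s.\<close>

lemma star_bounds_imp_asymp: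
  fixes g :: "nat \<Rightarrow> nat"
  assumes lo: "\<And>n. s \<le> n + 1 \<Longrightarrow> (s - 1) * (n + 2 - s) \<le> g n" and up: "\<And>n. g n \<le> (n + 1) * (s - 1) + 1"
  shows "(\<lambda>n. real (g n)) \<sim>[at_top] (\<lambda>n. real (s - 1) * real n)"
proof (rule asymp_equiv_by_bounds)
  show "0 < real (s - 1)" using s(2) by simp
  show "\<forall>\<^sub>F n in sequentially. 0 < real n" using eventually_gt_at_top[of 0] by eventually_elim simp
next
  fix \<epsilon> :: real assume e: "0 < \<epsilon>"
  show "\<forall>\<^sub>F n in sequentially. (real (s - 1) - \<epsilon>) * real n \<le> real (g n)"
    using eventually_ge_at_top[of s] eventually_ge_at_top[of "nat \<lceil>real (s - 1) * real s / \<epsilon>\<rceil>"]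
  proof eventually_elim
    case (elim n)
    have "real (s - 1) * real s / \<epsilon> \<le> real n" using elim(2) by linarith
    then have "real (s - 1) * real s \<le> \<epsilon> * real n" using e by (simp add: pos_divide_le_eq mult.commute)
    then have "(real (s - 1) - \<epsilon>) * real n \<le> real (s - 1) * (real n - real s)"
      by (simp add: algebra_simps)
    also have "\<dots> \<le> real (s - 1) * real (n + 2 - s)"
      using elim(1) by (intro mult_left_mono) (auto simp: of_nat_diff)
    also have "\<dots> = real ((s - 1) * (n + 2 - s))" by simp
    also have "\<dots> \<le> real (g n)" using lo[of n] elim(1) by (intro of_nat_mono) simp
    finally show ?case .
  qed
  show "\<forall>\<^sub>F n in sequentially. real (g n) \<le> (real (s - 1) + \<epsilon>) * real n"
    using eventually_ge_at_top[of "nat \<lceil>(real (s - 1) + 1) / \<epsilon>\<rceil>"]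
  proof eventually_elim
    case (elim n)
    have "(real (s - 1) + 1) / \<epsilon> \<le> real n" using elim by linarith
    then have "real (s - 1) + 1 \<le> \<epsilon> * real n" using e by (simp add: pos_divide_le_eq mult.commute)
    moreover have "real (g n) \<le> real ((n + 1) * (s - 1) + 1)" using up[of n] by (rule of_nat_mono)
    then have "real (g n) \<le> (real n + 1) * real (s - 1) + 1"
      by (simp only: of_nat_add of_nat_mult of_nat_1)
    ultimately show ?case by (simp add: algebra_simps)
  qed
qed

lemma ar_La_asymp_star: "(\<lambda>n. real (ar_star n r)) \<sim>[at_top] (\<lambda>n. real (La_star n (Pminus r)))"
proof -
  have "(\<lambda>n. real (ar_star n r)) \<sim>[at_top] (\<lambda>n. real (s - 1) * real n)"
    by (rule star_bounds_imp_asymp[OF star_ar_ge star_ar_le])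
  moreover have "(\<lambda>n. real (La_star n (Pminus r))) \<sim>[at_top] (\<lambda>n. real (s - 1) * real n)"
    by (rule star_bounds_imp_asymp) (rule star_La_ge, assumption, rule le_trans[OF star_La_le], simp)
  ultimately show ?thesis by (meson asymp_equiv_sym asymp_equiv_trans)
qed

end

text \<open>For \<open>k = 0\<close> the poset is a star. Two leaves are ruled out by
  \<open>lin\<close>, since they would be incomparable; in that case deleting a leaf leaves a
  two-element chain, which a chain of sets cannot avoid.\<close>

lemma ar_La_asymp_maximal:
  fixes r :: "'a rel"
  assumes T: "tree_poset r" and three: "3 \<le> card (Field r)"
    and lin: "card (Field r) = 3 \<Longrightarrow> Linear_order r"
    and m: "maximal_in r m" and rk: "ranked (remove_elem r m) (Suc k)"
    and no: "\<And>Q. Q \<in> Pminus r \<Longrightarrow> \<not> ranked Q k"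
  shows "(\<lambda>n. real (ar_star n r)) \<sim>[at_top] (\<lambda>n. real (La_star n (Pminus r)))"
proof (cases "k = 0")
  case False
  then show ?thesis using ar_La_asymp_levels[OF T m rk _ _ no] three by simp
next
  case True
  then have rk0: "ranked (remove_elem r m) (Suc 0)" using rk by simp
  have "card (Field r) \<noteq> 3"
  proof
    assume c: "card (Field r) = 3"
    have mF: "m \<in> Field r" using m by (simp add: maximal_in_def)
    then have "card (Field r - {m}) = 2" using c poset_finite[OF T] by simp
    then obtain p q where pq: "Field r - {m} = {p, q}" "p \<noteq> q" by (auto simp: card_2_iff)
    then have "p \<in> Field r" "q \<in> Field r" "p \<noteq> m" "q \<noteq> m" by blast+
    moreover have "(p, q) \<in> r \<or> (q, p) \<in> r"
      using lin[OF c] pq(2) calculation by (auto simp: linear_order_on_def total_on_def)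
    ultimately show False
      using star_relation[OF T m rk0, of p q] star_relation[OF T m rk0, of q p] pq(2) by blast
  qed
  then have "3 \<le> card (Field r) - 1" using three by simp
  then show ?thesis by (rule ar_La_asymp_star[OF T m rk0 refl])
qed

theorem theorem1p5:
  fixes T :: "'a rel"
  assumes "tree_poset T"
    and "3 \<le> card (Field T)"
    and "card (Field T) = 3 \<Longrightarrow> Linear_order T"
  shows "(\<lambda>n. real (ar_star n T)) \<sim>[at_top] (\<lambda>n. real (La_star n (Pminus T)))"
proof -
  have P: "Partial_order T" "finite (Field T)" using assms(1) by (auto simp: tree_poset_def)
  have two: "2 \<le> card (Field T)" using assms(2) by simp
  have ne: "Field T \<noteq> {}" using assms(2) by auto
  define K where "K = (LEAST K. \<exists>Q\<in>Pminus T. ranked Q K)"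
  obtain K0 m0 where "ranked T K0" "maximal_in T m0" using finite_poset_ranked[OF P ne] by blast
  then have ex: "\<exists>K. \<exists>Q\<in>Pminus T. ranked Q K" using ranked_remove by (fastforce simp: Pminus_eq)
  obtain Q where Q: "Q \<in> Pminus T" "ranked Q K" using LeastI_ex[OF ex] by (auto simp: K_def)
  \<comment> \<open>Height 0 means the empty poset, and deleting one of at least two elements leaves
    something.\<close>
  have "K \<noteq> 0" using Q(2) Field_Pminus_nonempty[OF P(1) two Q(1)] by (auto simp: ranked_def)
  then obtain k where k: "K = Suc k" using not0_implies_Suc by blast
  have no: "\<not> ranked Q' k" if "Q' \<in> Pminus T" for Q'
    using not_less_Least[of k "\<lambda>K. \<exists>Q\<in>Pminus T. ranked Q K"] that k by (auto simp: K_def)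
  obtain m where m: "Q = remove_elem T m" "maximal_in T m \<or> minimal_in T m"
    using Q(1) by (auto simp: Pminus_eq)
  from m(2) show ?thesis
  proof
    assume "maximal_in T m"
    then show ?thesis using ar_La_asymp_maximal[OF assms, of m k] Q(2) k m(1) no by simp
  next
    \<comment> \<open>Height does not change under reversal, so \<open>T\<inverse>\<close> satisfies
      the hypotheses of the maximal case with the same \<open>k\<close>; complementation transfers
      the conclusion back.\<close>
    assume "minimal_in T m"
    then have max: "maximal_in (T\<inverse>) m" by (auto simp: maximal_in_def minimal_in_def Field_converse)
    have "remove_elem (T\<inverse>) m = Q\<inverse>" by (auto simp: m(1) remove_elem_def Field_converse)
    then have rk: "ranked (remove_elem (T\<inverse>) m) (Suc k)" using ranked_converse Q(2) k by simp
    have no': "\<not> ranked Q' k" if "Q' \<in> Pminus (T\<inverse>)" for Q'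
    proof
      assume "ranked Q' k"
      then have "ranked (Q'\<inverse>) k" by (rule ranked_converse)
      moreover have "Q'\<inverse> \<in> Pminus T" using that by (auto simp: Pminus_converse)
      ultimately show False using no by blast
    qed
    have "(\<lambda>n. real (ar_star n (T\<inverse>))) \<sim>[at_top] (\<lambda>n. real (La_star n (Pminus (T\<inverse>))))"
      by (rule ar_La_asymp_maximal[OF tree_poset_converse[OF assms(1)] _ _ max rk no'])
        (use assms(2,3) in \<open>simp_all add: Field_converse\<close>)
    then show ?thesis
      using La_star_converse[OF Field_Pminus_nonempty[OF P(1) two]]
      by (simp add: ar_star_converse[OF two] Pminus_converse)
  qed
qed

end
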